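(* Let $\Gamma=(V,E)$ be a finite simplicial graph with a vertex-labelling by non-trivial finitely generated groups $G_v$ ($v\in V$), and let $G_\Gamma$ be the corresponding graph product. The group $G_\Gamma$ has more than one end, i.e. $e(G_\Gamma)>1$, if and only if at least one of the following holds: (i) the graph $\Gamma$ is complete, exactly one vertex group has more than one end, and all other vertex groups are finite; or (ii) there are non-empty full subgraphs $\Gamma_1$ and $\Gamma_2$ of $\Gamma$, neither containing the other, such that $G_\Gamma$ decomposes as the (non-trivial) amalgamated product $$G_\Gamma\cong G_{\Gamma_1} *_{G_{\Gamma_1\cap\Gamma_2}} G_{\Gamma_2},$$ where $G_{\Gamma_1\cap\Gamma_2}$ is a finite group.
   Context: A simplicial graph $\Gamma=(V,E)$ consists of a set $V$ of vertices and a set $E$ of 2-element subsets of $V$ (edges). A subgraph $\Gamma'=(V',E')$ is full (or induced) if $E'$ contains all edges $\{v,w\}\in E$ with $v,w\in V'$. A graph is complete if every two distinct vertices are joined by an edge (the empty graph counts as complete). Graph product: given a finite simplicial graph $\Gamma=(V,E)$ and a non-trivial finitely generated group $G_v$ for each $v\in V$, the graph product $G_\Gamma$ is the quotient of the free product $\ast_{v\in V}G_v$ by the normal closure of all commutators $[g,h]$ with $g\in G_u$, $h\in G_w$, $\{u,w\}\in E$. The graph product over the empty graph is the trivial group. For a full subgraph $\Delta$ of $\Gamma$, $G_\Delta$ is the graph product over $\Delta$ with the restricted labelling; it is canonically isomorphic to the subgroup of $G_\Gamma$ generated by the $G_v$, $v\in\Delta$. The amalgamated product in (ii) is formed along the canonical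 embeddings of $G_{\Gamma_1\cap\Gamma_2}$ into $G_{\Gamma_1}$ and $G_{\Gamma_2}$. An amalgamated product $A*_C B$ is non-trivial if $C$ is a proper subgroup of both $A$ and $B$. Number of ends: for a finitely generated group $G$ with finite generating set $S$, $e(G):=\sup\{\#\pi_0^u(\mathrm{Cay}(G,S)-C)\mid C\subseteq \mathrm{Cay}(G,S)\text{ finite subgraph}\}$, where $\mathrm{Cay}(G,S)$ is the Cayley graph of $G$ with respect to $S$ and $\#\pi_0^u(\mathrm{Cay}(G,S)-C)$ is the number of unbounded connected components of $\mathrm{Cay}(G,S)-C$. This does not depend on $S$. *)

theory Defs
  imports "HOL-Algebra.Coset" "HOL-Algebra.Generated_Groups" "HOL-Library.Extended_Nat"
begin

record 'v sgraph =
  vertices :: "'v set"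
  edges :: "'v set set"

definition simplicial_graph :: "'v sgraph \<Rightarrow> bool" where
  "simplicial_graph \<Gamma> \<longleftrightarrow>
     (\<forall>e\<in>edges \<Gamma>. \<exists>u\<in>vertices \<Gamma>. \<exists>w\<in>vertices \<Gamma>. u \<noteq> w \<and> e = {u, w})"

definition finite_graph :: "'v sgraph \<Rightarrow> bool" where
  "finite_graph \<Gamma> \<longleftrightarrow> finite (vertices \<Gamma>) \<and> finite (edges \<Gamma>)"

definition subgraph :: "'v sgraph \<Rightarrow> 'v sgraph \<Rightarrow> bool" where
  "subgraph \<Delta> \<Gamma> \<longleftrightarrow>
     simplicial_graph \<Delta> \<and> vertices \<Delta> \<subseteq> vertices \<Gamma> \<and> edges \<Delta> \<subseteq> edges \<Gamma>"

definition full_subgraph :: "'v sgraph \<Rightarrow> 'v sgraph \<Rightarrow> bool" where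
  "full_subgraph \<Delta> \<Gamma> \<longleftrightarrow>
     subgraph \<Delta> \<Gamma> \<and>
     (\<forall>u\<in>vertices \<Delta>. \<forall>w\<in>vertices \<Delta>. {u, w} \<in> edges \<Gamma> \<longrightarrow> {u, w} \<in> edges \<Delta>)"

definition complete_graph :: "'v sgraph \<Rightarrow> bool" where
  "complete_graph \<Gamma> \<longleftrightarrow>
     (\<forall>u\<in>vertices \<Gamma>. \<forall>w\<in>vertices \<Gamma>. u \<noteq> w \<longrightarrow> {u, w} \<in> edges \<Gamma>)"

definition graph_inter :: "'v sgraph \<Rightarrow> 'v sgraph \<Rightarrow> 'v sgraph" where
  "graph_inter \<Gamma>1 \<Gamma>2 =
     \<lparr>vertices = vertices \<Gamma>1 \<inter> vertices \<Gamma>2, edges = edges \<Gamma>1 \<inter> edges \<Gamma>2\<rparr>"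

text \<open>Removing a subgraph also removes every edge with an endpoint in it.\<close>

definition graph_minus :: "'v sgraph \<Rightarrow> 'v sgraph \<Rightarrow> 'v sgraph" where
  "graph_minus \<Gamma> \<Delta> =
     \<lparr>vertices = vertices \<Gamma> - vertices \<Delta>,
      edges = {e \<in> edges \<Gamma> - edges \<Delta>. e \<subseteq> vertices \<Gamma> - vertices \<Delta>}\<rparr>"

definition adj :: "'v sgraph \<Rightarrow> ('v \<times> 'v) set" where
  "adj \<Gamma> = {(x, y). {x, y} \<in> edges \<Gamma>}"

definition components :: "'v sgraph \<Rightarrow> 'v set set" where
  "components \<Gamma> = vertices \<Gamma> // {(x, y) \<in> vertices \<Gamma> \<times> vertices \<Gamma>. (x, y) \<in> (adj \<Gamma>)\<^sup>*}"

text \<open>Boundedness with respect to the path metric of the graph: \<open>(x, y) \<in> adj \<Gamma> ^^ k\<close> says that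
  there is an edge path of length \<open>k\<close> from \<open>x\<close> to \<open>y\<close>.\<close>

definition bounded_in :: "'v sgraph \<Rightarrow> 'v set \<Rightarrow> bool" where
  "bounded_in \<Gamma> K \<longleftrightarrow> (\<exists>n. \<forall>x\<in>K. \<forall>y\<in>K. \<exists>k\<le>n. (x, y) \<in> adj \<Gamma> ^^ k)"

definition finite_generating_set :: "('a, 'b) monoid_scheme \<Rightarrow> 'a set \<Rightarrow> bool" where
  "finite_generating_set G S \<longleftrightarrow> finite S \<and> S \<subseteq> carrier G \<and> generate G S = carrier G"

definition finitely_generated_group :: "('a, 'b) monoid_scheme \<Rightarrow> bool" where
  "finitely_generated_group G \<longleftrightarrow> group G \<and> (\<exists>S. finite_generating_set G S)"

definition cayley_graph :: "('a, 'b) monoid_scheme \<Rightarrow> 'a set \<Rightarrow> 'a sgraph" where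
  "cayley_graph G S =
     \<lparr>vertices = carrier G,
      edges = {{g, g \<otimes>\<^bsub>G\<^esub> s} | g s. g \<in> carrier G \<and> s \<in> S \<and> g \<otimes>\<^bsub>G\<^esub> s \<noteq> g}\<rparr>"

definition ecard :: "'a set \<Rightarrow> enat" where
  "ecard A = (if finite A then enat (card A) else \<infinity>)"

definition unbounded_components :: "'v sgraph \<Rightarrow> 'v sgraph \<Rightarrow> 'v set set" where
  "unbounded_components \<Gamma> C = {K \<in> components (graph_minus \<Gamma> C). \<not> bounded_in \<Gamma> K}"

definition ends_wrt :: "('a, 'b) monoid_scheme \<Rightarrow> 'a set \<Rightarrow> enat" where
  "ends_wrt G S =
     (SUP C\<in>{C. subgraph C (cayley_graph G S) \<and> finite_graph C}.
        ecard (unbounded_components (cayley_graph G S) C))"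

text \<open>The value does not depend on the finite generating set.\<close>

definition number_of_ends :: "('a, 'b) monoid_scheme \<Rightarrow> enat" where
  "number_of_ends G = ends_wrt G (SOME S. finite_generating_set G S)"

text \<open>The elements of the free product of the groups \<open>G i\<close> (\<open>i \<in> I\<close>) are the words in syllables
  \<open>(i, g)\<close> with \<open>g \<in> G i\<close>, modulo the congruence generated by dropping trivial syllables and
  multiplying adjacent syllables from the same factor.\<close>

definition words :: "'i set \<Rightarrow> ('i \<Rightarrow> ('a, 'b) monoid_scheme) \<Rightarrow> ('i \<times> 'a) list set" where
  "words I G = lists (SIGMA i:I. carrier (G i))"

inductive_set word_eq :: "'i set \<Rightarrow> ('i \<Rightarrow> ('a, 'b) monoid_scheme) \<Rightarrow>
    (('i \<times> 'a) list \<times> ('i \<times> 'a) list) set"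
  for I :: "'i set" and G :: "'i \<Rightarrow> ('a, 'b) monoid_scheme" where
  refl: "w \<in> words I G \<Longrightarrow> (w, w) \<in> word_eq I G"
| sym: "(w, w') \<in> word_eq I G \<Longrightarrow> (w', w) \<in> word_eq I G"
| trans: "(w, w') \<in> word_eq I G \<Longrightarrow> (w', w'') \<in> word_eq I G \<Longrightarrow> (w, w'') \<in> word_eq I G"
| unit: "u \<in> words I G \<Longrightarrow> v \<in> words I G \<Longrightarrow> i \<in> I \<Longrightarrow>
    (u @ [(i, \<one>\<^bsub>G i\<^esub>)] @ v, u @ v) \<in> word_eq I G"
| mult: "u \<in> words I G \<Longrightarrow> v \<in> words I G \<Longrightarrow> i \<in> I \<Longrightarrow> g \<in> carrier (G i) \<Longrightarrow> h \<in> carrier (G i) \<Longrightarrow>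
    (u @ [(i, g), (i, h)] @ v, u @ [(i, g \<otimes>\<^bsub>G i\<^esub> h)] @ v) \<in> word_eq I G"

definition word_class :: "'i set \<Rightarrow> ('i \<Rightarrow> ('a, 'b) monoid_scheme) \<Rightarrow>
    ('i \<times> 'a) list \<Rightarrow> ('i \<times> 'a) list set" where
  "word_class I G w = word_eq I G `` {w}"

definition free_product :: "'i set \<Rightarrow> ('i \<Rightarrow> ('a, 'b) monoid_scheme) \<Rightarrow>
    ('i \<times> 'a) list set monoid" where
  "free_product I G =
     \<lparr>carrier = words I G // word_eq I G,
      mult = (\<lambda>X Y. \<Union>x\<in>X. \<Union>y\<in>Y. word_class I G (x @ y)),
      one = word_class I G []\<rparr>"

definition free_incl :: "'i set \<Rightarrow> ('i \<Rightarrow> ('a, 'b) monoid_scheme) \<Rightarrow>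
    'i \<Rightarrow> 'a \<Rightarrow> ('i \<times> 'a) list set" where
  "free_incl I G i g = word_class I G [(i, g)]"

definition normal_closure :: "('a, 'b) monoid_scheme \<Rightarrow> 'a set \<Rightarrow> 'a set" where
  "normal_closure G R = \<Inter>{N. N \<lhd> G \<and> R \<subseteq> N}"

definition commutator :: "('a, 'b) monoid_scheme \<Rightarrow> 'a \<Rightarrow> 'a \<Rightarrow> 'a" where
  "commutator G x y = x \<otimes>\<^bsub>G\<^esub> y \<otimes>\<^bsub>G\<^esub> inv\<^bsub>G\<^esub> x \<otimes>\<^bsub>G\<^esub> inv\<^bsub>G\<^esub> y"

text \<open>The factor \<open>A\<close> has index \<open>True\<close> and \<open>B\<close> has index \<open>False\<close>; \<open>\<alpha> c\<close> and \<open>\<beta> c\<close> are identified.\<close>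

definition amalgamated_product :: "'a monoid \<Rightarrow> 'a monoid \<Rightarrow> 'c monoid \<Rightarrow>
    ('c \<Rightarrow> 'a) \<Rightarrow> ('c \<Rightarrow> 'a) \<Rightarrow> (bool \<times> 'a) list set set monoid" where
  "amalgamated_product A B C \<alpha> \<beta> =
     (let G = case_bool A B; F = free_product UNIV G in
        F Mod normal_closure F
          {free_incl UNIV G True (\<alpha> c) \<otimes>\<^bsub>F\<^esub> inv\<^bsub>F\<^esub> (free_incl UNIV G False (\<beta> c)) | c.
             c \<in> carrier C})"

text \<open>The embeddings are recorded explicitly, so \<open>C\<close> being a proper subgroup of both factors
  is a statement about its images.\<close>

definition nontrivial_amalgam :: "'a monoid \<Rightarrow> 'a monoid \<Rightarrow> 'c monoid \<Rightarrow>
    ('c \<Rightarrow> 'a) \<Rightarrow> ('c \<Rightarrow> 'a) \<Rightarrow> bool" where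
  "nontrivial_amalgam A B C \<alpha> \<beta> \<longleftrightarrow> \<alpha> ` carrier C \<subset> carrier A \<and> \<beta> ` carrier C \<subset> carrier B"

definition graph_relators :: "'v sgraph \<Rightarrow> ('v \<Rightarrow> ('a, 'b) monoid_scheme) \<Rightarrow>
    ('v \<times> 'a) list set set" where
  "graph_relators \<Gamma> G =
     {commutator (free_product (vertices \<Gamma>) G)
        (free_incl (vertices \<Gamma>) G u g) (free_incl (vertices \<Gamma>) G w h) | u w g h.
        {u, w} \<in> edges \<Gamma> \<and> g \<in> carrier (G u) \<and> h \<in> carrier (G w)}"

definition graph_product :: "'v sgraph \<Rightarrow> ('v \<Rightarrow> ('a, 'b) monoid_scheme) \<Rightarrow>
    ('v \<times> 'a) list set set monoid" where
  "graph_product \<Gamma> G =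
     (let F = free_product (vertices \<Gamma>) G in F Mod normal_closure F (graph_relators \<Gamma> G))"

definition gp_class :: "'v sgraph \<Rightarrow> ('v \<Rightarrow> ('a, 'b) monoid_scheme) \<Rightarrow>
    ('v \<times> 'a) list \<Rightarrow> ('v \<times> 'a) list set set" where
  "gp_class \<Gamma> G w =
     (let F = free_product (vertices \<Gamma>) G in
        normal_closure F (graph_relators \<Gamma> G) #>\<^bsub>F\<^esub> word_class (vertices \<Gamma>) G w)"

text \<open>The canonical homomorphism from the graph product over a subgraph \<open>\<Delta>\<close> to the one over \<open>\<Gamma>\<close>
  sends the class of a word over \<open>\<Delta>\<close> to the class of the same word over \<open>\<Gamma>\<close>; the choice of the
  representing word is immaterial.\<close>

definition gp_embed :: "'v sgraph \<Rightarrow> 'v sgraph \<Rightarrow> ('v \<Rightarrow> ('a, 'b) monoid_scheme) \<Rightarrow>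
    ('v \<times> 'a) list set set \<Rightarrow> ('v \<times> 'a) list set set" where
  "gp_embed \<Delta> \<Gamma> G X = gp_class \<Gamma> G (SOME w. w \<in> words (vertices \<Delta>) G \<and> gp_class \<Delta> G w = X)"

end

theory Submission
  imports Defs "HOL-Algebra.Bij"
begin

text \<open>A finitely generated group has more than one end iff it has a subset \<open>A\<close>, infinite with infinite
  complement, such that \<open>g A\<close> differs from \<open>A\<close> by finitely many elements for every \<open>g\<close>. Elements of
  a graph product are studied through their reduced words; \<open>init v\<close> says that an element can start
  with a syllable at \<open>v\<close>, and the vertices with this property span a clique.

  If \<open>\<Gamma>\<close> is the union of two full subgraphs meeting in \<open>\<Delta>\<close> with \<open>G\<^sub>\<Delta>\<close> finite, the elements whose last
  syllable outside \<open>\<Delta>\<close> lies in the first subgraph form such a set \<open>A\<close>. Any amalgam as in (ii) is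
  itself a graph product over a graph of this kind.

  Conversely, let \<open>A\<close> be almost invariant. All but finitely many cosets of vertex groups lie inside \<open>A\<close>
  or its complement, so \<open>A\<close> is constant on the part of every coset consisting of words with at least
  \<open>m\<close> syllables, if \<open>m\<close> is large. Suppose that \<open>\<Gamma>\<close> is not complete and that no clique of finite vertex
  groups separates it. Then \<open>m\<close> can be lowered to \<open>0\<close>, each time changing \<open>A\<close> at finitely many
  elements: an element \<open>\<phi>\<close> of length \<open>m\<close> gets the common value of its extensions \<open>s \<phi>\<close> with \<open>s\<close> outside the
  clique \<open>\<sigma>\<close> of initial vertices of \<open>\<phi>\<close>. Extensions at adjacent vertices have the same value; hence so do
  all extensions if \<open>\<Gamma> - \<sigma>\<close> is connected, and if it is not, then every part of \<open>\<Gamma> - \<sigma>\<close> is adjacent to a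
  vertex of \<open>\<sigma>\<close> with infinite group, along whose coset \<open>A\<close> is almost constant. At \<open>m = 0\<close> the set \<open>A\<close> is
  constant, so it was finite or cofinite to begin with.\<close>

section \<open>Ends and almost invariant sets\<close>

text \<open>Complete graphs need an argument of their own, because there an element can have every
  vertex initial and then has no extension from which to take a value. The group is a direct product
  in that case, and \<open>A\<close> is compared along the cosets of one infinite factor
  \<open>G v\<close>. If \<open>A\<close> is almost constant on each of them, the constants agree,
  since multiplication by another factor carries one coset pointwise to another; so \<open>A\<close>
  is finite or cofinite. A second infinite factor forces almost constancy, and so does a
  \<open>G v\<close> that does not split at infinity itself. For other graphs the obstacle is that
  flatness compares two extensions of the same element only through a common longer extension, which
  exists when their vertices are adjacent. Values in different parts of \<Gamma> - \<sigma> can be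
  linked only through the clique \<sigma> itself, and only along a coset long enough to have a value
  up to finitely many exceptions. This is why the obstruction is a clique whose vertex groups are
  all finite. Condition (ii) supplies an abstract isomorphism, so \<Gamma> need not be the union of
  \<Gamma>1 and \<Gamma>2; the splitting is found in the amalgam and carried over.\<close>

definition splits_at_infinity :: "('a, 'b) monoid_scheme \<Rightarrow> bool" where
  "splits_at_infinity G \<longleftrightarrow>
     (\<exists>A\<subseteq>carrier G. infinite A \<and> infinite (carrier G - A) \<and>
        (\<forall>g\<in>carrier G. finite {x \<in> A. g \<otimes>\<^bsub>G\<^esub> x \<notin> A}))"

lemma one_less_ecard_iff: "1 < ecard A \<longleftrightarrow> (\<exists>x\<in>A. \<exists>y\<in>A. x \<noteq> y)"
proof (cases "finite A")
  case True
  have "1 < ecard A \<longleftrightarrow> \<not> card A \<le> Suc 0"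
    using True by (simp add: ecard_def one_enat_def not_le)
  then show ?thesis
    using True by (simp add: card_le_Suc0_iff_eq)
next
  case False
  then obtain x where "x \<in> A" by (metis finite.emptyI ex_in_conv)
  moreover have "A - {x} \<noteq> {}" using False by (metis finite.emptyI finite_insert insert_Diff_single Diff_eq_empty_iff finite_subset)
  ultimately show ?thesis
    using False by (auto simp: ecard_def)
qed

lemma in_components_iff:
  "Y \<in> components \<Gamma> \<longleftrightarrow> (\<exists>x\<in>vertices \<Gamma>. Y = {y \<in> vertices \<Gamma>. (x, y) \<in> (adj \<Gamma>)\<^sup>*})"
  by (auto simp: components_def quotient_def)

lemma adj_sym: "(x, y) \<in> adj \<Gamma> \<Longrightarrow> (y, x) \<in> adj \<Gamma>"
  by (simp add: adj_def insert_commute)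

lemma adj_rtrancl_sym: "(x, y) \<in> (adj \<Gamma>)\<^sup>* \<Longrightarrow> (y, x) \<in> (adj \<Gamma>)\<^sup>*"
  by (meson adj_sym symD symI sym_rtrancl)

section \<open>Cayley graphs: finite balls, components and their boundaries\<close>

locale cayley = group G for G :: "('a, 'b) monoid_scheme" (structure) +
  fixes S :: "'a set"
  assumes gen: "finite_generating_set G S"
begin

abbreviation "\<K> \<equiv> cayley_graph G S"

lemma S_carrier: "s \<in> S \<Longrightarrow> s \<in> carrier G"
  using gen by (auto simp: finite_generating_set_def)

lemma finite_S: "finite S"
  using gen by (auto simp: finite_generating_set_def)

lemma generate_S: "generate G S = carrier G"
  using gen by (auto simp: finite_generating_set_def)

lemma vertices_cayley [simp]: "vertices \<K> = carrier G"
  by (simp add: cayley_graph_def)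

lemma adj_cayley_iff:
  "(x, y) \<in> adj \<K> \<longleftrightarrow> x \<in> carrier G \<and> y \<in> carrier G \<and> x \<noteq> y \<and> (\<exists>s\<in>S. y = x \<otimes> s \<or> x = y \<otimes> s)"
  using S_carrier by (fastforce simp: adj_def cayley_graph_def doubleton_eq_iff)

lemma adj_cayley_mult: "x \<in> carrier G \<Longrightarrow> s \<in> S \<Longrightarrow> (x, x \<otimes> s) \<in> (adj \<K>)\<^sup>*"
  using S_carrier by (cases "x \<otimes> s = x") (auto simp: adj_cayley_iff intro!: r_into_rtrancl)

lemma adj_cayley_generate:
  "h \<in> generate G S \<Longrightarrow> x \<in> carrier G \<Longrightarrow> (x, x \<otimes> h) \<in> (adj \<K>)\<^sup>*"
proof (induction arbitrary: x rule: generate.induct)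
  case one then show ?case by simp
next
  case (incl h) then show ?case by (simp add: adj_cayley_mult)
next
  case (inv h)
  have "(x \<otimes> inv h, x \<otimes> inv h \<otimes> h) \<in> (adj \<K>)\<^sup>*"
    using inv S_carrier by (intro adj_cayley_mult) auto
  then show ?case
    using inv S_carrier by (auto simp: m_assoc intro: adj_rtrancl_sym)
next
  case (eng h1 h2)
  have c: "h1 \<in> carrier G" "h2 \<in> carrier G"
    using eng generate_S by auto
  have "(x, x \<otimes> h1) \<in> (adj \<K>)\<^sup>*" "(x \<otimes> h1, x \<otimes> h1 \<otimes> h2) \<in> (adj \<K>)\<^sup>*"
    using eng c by auto
  then have "(x, x \<otimes> h1 \<otimes> h2) \<in> (adj \<K>)\<^sup>*" by (rule rtrancl_trans)
  then show ?case using c eng by (simp add: m_assoc)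
qed

lemma cayley_connected: "x \<in> carrier G \<Longrightarrow> y \<in> carrier G \<Longrightarrow> (x, y) \<in> (adj \<K>)\<^sup>*"
  using adj_cayley_generate[of "inv x \<otimes> y" x] generate_S by (simp add: m_assoc [symmetric])

lemma finite_adj_cayley: "finite {y. (x, y) \<in> adj \<K>}"
proof -
  have "{y. (x, y) \<in> adj \<K>} \<subseteq> (\<lambda>s. x \<otimes> s) ` S \<union> (\<lambda>s. x \<otimes> inv s) ` S"
  proof
    fix y assume "y \<in> {y. (x, y) \<in> adj \<K>}"
    then obtain s where s: "s \<in> S" "y = x \<otimes> s \<or> x = y \<otimes> s" "y \<in> carrier G"
      by (auto simp: adj_cayley_iff)
    moreover have "y = y \<otimes> s \<otimes> inv s" using s S_carrier by (simp add: m_assoc)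
    ultimately show "y \<in> (\<lambda>s. x \<otimes> s) ` S \<union> (\<lambda>s. x \<otimes> inv s) ` S" by auto
  qed
  then show ?thesis
    using finite_S finite_subset by blast
qed

lemma finite_ball: "finite {y. (x, y) \<in> adj \<K> ^^ k}"
proof (induction k)
  case (Suc k)
  have "{y. (x, y) \<in> adj \<K> ^^ Suc k} \<subseteq> (\<Union>z\<in>{y. (x, y) \<in> adj \<K> ^^ k}. {y. (z, y) \<in> adj \<K>})"
    by auto
  then show ?case
    using Suc finite_adj_cayley by (meson finite_UN_I finite_subset)
qed simp

text \<open>Balls are finite because \<open>S\<close> is, so bounded sets are finite; conversely
  connectedness joins the finitely many pairs of a finite set by paths of bounded length. Unbounded
  components are thereby the infinite ones.\<close>

lemma bounded_in_cayley_iff: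
  assumes "Y \<subseteq> carrier G" shows "bounded_in \<K> Y \<longleftrightarrow> finite Y"
proof
  assume b: "bounded_in \<K> Y"
  show "finite Y"
  proof (cases "Y = {}")
    case False
    then obtain x where x: "x \<in> Y" by auto
    obtain n where "\<forall>y\<in>Y. \<exists>k\<le>n. (x, y) \<in> adj \<K> ^^ k"
      using b x by (auto simp: bounded_in_def)
    then have "Y \<subseteq> (\<Union>k\<le>n. {y. (x, y) \<in> adj \<K> ^^ k})" by auto
    then show ?thesis using finite_ball by (meson finite_UN_I finite_atMost finite_subset)
  qed simp
next
  assume f: "finite Y"
  have "\<exists>k. (fst p, snd p) \<in> adj \<K> ^^ k" if "p \<in> Y \<times> Y" for p
    using that assms by (intro rtrancl_imp_relpow cayley_connected) auto
  then obtain k where k: "\<And>p. p \<in> Y \<times> Y \<Longrightarrow> (fst p, snd p) \<in> adj \<K> ^^ k p"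
    by metis
  have "\<exists>j\<le>Max (k ` (Y \<times> Y)). (x, y) \<in> adj \<K> ^^ j" if "x \<in> Y" "y \<in> Y" for x y
  proof (intro exI conjI)
    show "k (x, y) \<le> Max (k ` (Y \<times> Y))" using that f by (intro Max_ge) auto
    show "(x, y) \<in> adj \<K> ^^ k (x, y)" using k[of "(x, y)"] that by simp
  qed
  then show "bounded_in \<K> Y" unfolding bounded_in_def by blast
qed

lemma components_minus_subset: "Y \<in> components (graph_minus \<K> C) \<Longrightarrow> Y \<subseteq> carrier G - vertices C"
  by (auto simp: in_components_iff graph_minus_def)

lemma unbounded_components_iff:
  "Y \<in> unbounded_components \<K> C \<longleftrightarrow> Y \<in> components (graph_minus \<K> C) \<and> infinite Y"
  using bounded_in_cayley_iff[of Y] components_minus_subset[of Y C]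
  by (auto simp: unbounded_components_def)

text \<open>An edge of a simplicial \<open>C\<close> has its endpoints in \<open>C\<close>, so
  deleting the vertices of \<open>C\<close> already deletes its edges.\<close>

lemma adj_minus_iff:
  assumes "simplicial_graph C"
  shows "(x, y) \<in> adj (graph_minus \<K> C) \<longleftrightarrow>
     (x, y) \<in> adj \<K> \<and> x \<notin> vertices C \<and> y \<notin> vertices C"
proof
  assume "(x, y) \<in> adj (graph_minus \<K> C)"
  then show "(x, y) \<in> adj \<K> \<and> x \<notin> vertices C \<and> y \<notin> vertices C"
    by (auto simp: adj_def graph_minus_def)
next
  assume *: "(x, y) \<in> adj \<K> \<and> x \<notin> vertices C \<and> y \<notin> vertices C"
  then have "{x, y} \<notin> edges C"
    using assms by (auto simp: simplicial_graph_def doubleton_eq_iff)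
  then show "(x, y) \<in> adj (graph_minus \<K> C)"
    using * by (auto simp: adj_def graph_minus_def adj_cayley_iff[unfolded adj_def, simplified])
qed

text \<open>An element that leaves \<open>A\<close> under \<open>h1 \<otimes> h2\<close> either
  leaves it under \<open>h1\<close>, or is moved by \<open>h1\<close> to one that leaves it under
  \<open>h2\<close>. Finiteness therefore passes from the generators and their inverses to all of
  the group.\<close>

lemma finite_crossing_generate:
  assumes A: "A \<subseteq> carrier G"
    and S: "\<And>s. s \<in> S \<Longrightarrow> finite {x \<in> A. x \<otimes> s \<notin> A} \<and> finite {x \<in> A. x \<otimes> inv s \<notin> A}"
    and "h \<in> generate G S"
  shows "finite {x \<in> A. x \<otimes> h \<notin> A}"
  using \<open>h \<in> generate G S\<close>
proof (induction rule: generate.induct)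
  case one
  have "{x \<in> A. x \<otimes> \<one> \<notin> A} = {}" using A by auto
  then show ?case by (metis finite.emptyI)
next
  case (incl h) then show ?case using S by auto
next
  case (inv h) then show ?case using S by auto
next
  case (eng h1 h2)
  have c: "h1 \<in> carrier G" "h2 \<in> carrier G"
    using eng generate_S by auto
  have "{x \<in> A. x \<otimes> (h1 \<otimes> h2) \<notin> A} \<subseteq>
     {x \<in> A. x \<otimes> h1 \<notin> A} \<union> (\<lambda>y. y \<otimes> inv h1) ` {x \<in> A. x \<otimes> h2 \<notin> A}"
  proof
    fix x assume x: "x \<in> {x \<in> A. x \<otimes> (h1 \<otimes> h2) \<notin> A}"
    show "x \<in> {x \<in> A. x \<otimes> h1 \<notin> A} \<union> (\<lambda>y. y \<otimes> inv h1) ` {x \<in> A. x \<otimes> h2 \<notin> A}"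
    proof (cases "x \<otimes> h1 \<in> A")
      case True
      then show ?thesis
        using x A c by (intro UnI2 image_eqI[of _ _ "x \<otimes> h1"]) (auto simp: m_assoc)
    qed (use x in auto)
  qed
  then show ?case
    using eng.IH by (meson finite_UnI finite_imageI finite_subset)
qed

lemma component_closed:
  assumes "simplicial_graph C" "Y \<in> components (graph_minus \<K> C)"
    and "x \<in> Y" "(x, y) \<in> adj \<K>" "y \<notin> vertices C"
  shows "y \<in> Y"
proof -
  obtain z where z: "Y = {y \<in> vertices (graph_minus \<K> C). (z, y) \<in> (adj (graph_minus \<K> C))\<^sup>*}"
    using assms(2) by (auto simp: in_components_iff)
  have "x \<notin> vertices C" using assms(2,3) components_minus_subset by auto
  then have "(x, y) \<in> adj (graph_minus \<K> C)"
    using assms by (simp add: adj_minus_iff)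
  moreover have "y \<in> carrier G" using assms(4) by (simp add: adj_cayley_iff)
  ultimately show ?thesis
    using z assms(3,5) by (auto simp: graph_minus_def)
qed

text \<open>A neighbour of a component that does not belong to it must lie in \<open>C\<close>. So a
  step by a generator out of \<open>Y\<close> ends in a finite set, and right translation is
  injective.\<close>

lemma finite_component_crossing:
  assumes C: "subgraph C \<K>" "finite_graph C" and Y: "Y \<in> components (graph_minus \<K> C)"
    and g: "g \<in> carrier G"
  shows "finite {x \<in> Y. x \<otimes> g \<notin> Y}"
proof (rule finite_crossing_generate)
  have simp: "simplicial_graph C" and fin: "finite (vertices C)"
    using C by (auto simp: subgraph_def finite_graph_def)
  show Yc: "Y \<subseteq> carrier G" using components_minus_subset[OF Y] by auto
  show "g \<in> generate G S" using g generate_S by simp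
  fix s assume s: "s \<in> S"
  note sc = S_carrier[OF s]
  have out: "x \<otimes> s \<in> vertices C" if "x \<in> Y" "x \<otimes> s \<notin> Y" for x
  proof (rule ccontr)
    assume n: "x \<otimes> s \<notin> vertices C"
    have "(x, x \<otimes> s) \<in> adj \<K>" using that Yc sc s by (auto simp: adj_cayley_iff)
    then show False using component_closed[OF simp Y that(1) _ n] that by auto
  qed
  then have "{x \<in> Y. x \<otimes> s \<notin> Y} \<subseteq> (\<lambda>y. y \<otimes> inv s) ` vertices C"
  proof (intro subsetI, elim CollectE conjE)
    fix x assume x: "x \<in> Y" "x \<otimes> s \<notin> Y"
    have "x = x \<otimes> s \<otimes> inv s" using x Yc sc by (auto simp: m_assoc)
    then show "x \<in> (\<lambda>y. y \<otimes> inv s) ` vertices C" using out[OF x] by (rule image_eqI)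
  qed
  moreover have out': "x \<otimes> inv s \<in> vertices C" if "x \<in> Y" "x \<otimes> inv s \<notin> Y" for x
  proof (rule ccontr)
    assume n: "x \<otimes> inv s \<notin> vertices C"
    have "x \<in> carrier G" using that Yc by auto
    moreover have "x = x \<otimes> inv s \<otimes> s" using \<open>x \<in> carrier G\<close> sc by (simp add: m_assoc)
    moreover have "x \<noteq> x \<otimes> inv s" using that by auto
    ultimately have "(x, x \<otimes> inv s) \<in> adj \<K>" using sc s by (auto simp: adj_cayley_iff)
    then show False using component_closed[OF simp Y that(1) _ n] that by auto
  qed
  then have "{x \<in> Y. x \<otimes> inv s \<notin> Y} \<subseteq> (\<lambda>y. y \<otimes> s) ` vertices C"
  proof (intro subsetI, elim CollectE conjE)
    fix x assume x: "x \<in> Y" "x \<otimes> inv s \<notin> Y"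
    have "x = x \<otimes> inv s \<otimes> s" using x Yc sc by (auto simp: m_assoc)
    then show "x \<in> (\<lambda>y. y \<otimes> s) ` vertices C" using out'[OF x] by (rule image_eqI)
  qed
  ultimately show "finite {x \<in> Y. x \<otimes> s \<notin> Y} \<and> finite {x \<in> Y. x \<otimes> inv s \<notin> Y}"
    using fin finite_subset by blast
qed

text \<open>Edges of the Cayley graph are right multiplications, so a component is almost invariant
  on the right; inversion turns it into a set that is almost invariant on the left. The second
  unbounded component makes the complement infinite.\<close>

lemma ends_imp_splits:
  assumes "1 < ends_wrt G S"
  shows "splits_at_infinity G"
proof -
  obtain C where C: "subgraph C \<K>" "finite_graph C"
    and e: "1 < ecard (unbounded_components \<K> C)"
    using assms by (auto simp: ends_wrt_def less_SUP_iff)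
  obtain Y Z where YZ: "Y \<in> unbounded_components \<K> C" "Z \<in> unbounded_components \<K> C" "Y \<noteq> Z"
    using e by (auto simp: one_less_ecard_iff)
  then have Y: "Y \<in> components (graph_minus \<K> C)" "infinite Y"
    and Z: "Z \<in> components (graph_minus \<K> C)" "infinite Z"
    by (auto simp: unbounded_components_iff)
  have disj: "Y \<inter> Z = {}"
  proof (rule ccontr)
    assume "Y \<inter> Z \<noteq> {}"
    then obtain u where "u \<in> Y" "u \<in> Z" by auto
    then show False
      using Y Z \<open>Y \<noteq> Z\<close> by (auto simp: in_components_iff) (meson adj_rtrancl_sym rtrancl_trans)+
  qed
  have Yc: "Y \<subseteq> carrier G" and Zc: "Z \<subseteq> carrier G"
    using components_minus_subset Y Z by auto
  let ?A = "m_inv G ` Y"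
  have inj: "inj_on (m_inv G) Y" "inj_on (m_inv G) Z"
    using Yc Zc by (meson inj_on_subset inv_inj)+
  have "infinite ?A" using Y inj by (simp add: finite_image_iff)
  moreover have "m_inv G ` Z \<subseteq> carrier G - ?A"
    using Zc Yc disj by (auto dest!: inv_inj[THEN inj_onD, rotated -1]) 
  moreover have "infinite (m_inv G ` Z)" using Z inj by (simp add: finite_image_iff)
  moreover have "finite {x \<in> ?A. g \<otimes> x \<notin> ?A}" if g: "g \<in> carrier G" for g
  proof -
    have "{x \<in> ?A. g \<otimes> x \<notin> ?A} \<subseteq> m_inv G ` {x \<in> Y. x \<otimes> inv g \<notin> Y}"
    proof
      fix x assume "x \<in> {x \<in> ?A. g \<otimes> x \<notin> ?A}"
      then obtain y where y: "y \<in> Y" "x = inv y" "g \<otimes> x \<notin> ?A" by auto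
      have "inv (y \<otimes> inv g) = g \<otimes> x"
        using y g Yc by (auto simp: inv_mult_group)
      then have "y \<otimes> inv g \<notin> Y" using y by (metis imageI)
      then show "x \<in> m_inv G ` {x \<in> Y. x \<otimes> inv g \<notin> Y}" using y by auto
    qed
    then show ?thesis
      using finite_component_crossing[OF C Y(1)] g by (meson finite_imageI finite_subset inv_closed)
  qed
  moreover have "?A \<subseteq> carrier G" using Yc by auto
  ultimately show ?thesis
    unfolding splits_at_infinity_def by (meson finite_subset)
qed

text \<open>By connectedness every point outside \<open>B\<close> can reach a neighbour of
  \<open>B\<close> without entering \<open>B\<close>. Since \<open>B\<close> has finitely many
  neighbours, finitely many components cover \<open>A - B\<close>, and one of them is infinite. It
  stays in \<open>A\<close> because no edge off \<open>B\<close> leaves \<open>A\<close>.\<close>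

lemma infinite_component_inside:
  assumes B: "finite B" "B \<subseteq> carrier G" "\<one> \<in> B" and A: "A \<subseteq> carrier G" "infinite A"
    and cross: "\<And>x y. x \<in> A \<Longrightarrow> (x, y) \<in> adj \<K> \<Longrightarrow> x \<notin> B \<Longrightarrow> y \<notin> B \<Longrightarrow> y \<in> A"
  shows "\<exists>Y\<in>components (graph_minus \<K> \<lparr>vertices = B, edges = {}\<rparr>). infinite Y \<and> Y \<subseteq> A"
proof -
  let ?C = "\<lparr>vertices = B, edges = {}\<rparr>"
  let ?R = "(adj (graph_minus \<K> ?C))\<^sup>*"
  have simp: "simplicial_graph ?C" by (simp add: simplicial_graph_def)
  define T where "T = (\<Union>b\<in>B. {y. (b, y) \<in> adj \<K>})"
  define comp where "comp t = {y \<in> vertices (graph_minus \<K> ?C). (t, y) \<in> ?R}" for t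
  have "finite T" unfolding T_def using B finite_adj_cayley by blast
  have inside: "y \<in> A" if "(x, y) \<in> ?R" "x \<in> A" for x y
    using that
  proof (induction rule: rtrancl_induct)
    case (step y z) then show ?case using cross simp by (auto simp: adj_minus_iff)
  qed
  \<comment> \<open>A path to \<open>\<one>\<close> has to enter \<open>B\<close>; the last point
    before the first entry is a neighbour of \<open>B\<close>.\<close>
  have reach: "\<exists>t\<in>T - B. (y, t) \<in> ?R" if "(y, \<one>) \<in> (adj \<K>)\<^sup>*" "y \<notin> B" for y
    using that
  proof (induction rule: converse_rtrancl_induct)
    case base then show ?case using B by simp
  next
    case (step y z)
    show ?case
    proof (cases "z \<in> B")
      case True
      then have "y \<in> T" using adj_sym[OF step(1)] by (auto simp: T_def)
      then show ?thesis using step by auto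
    next
      case False
      then have "(y, z) \<in> adj (graph_minus \<K> ?C)" using step simp by (simp add: adj_minus_iff)
      then show ?thesis using step False by (meson converse_rtrancl_into_rtrancl)
    qed
  qed
  have "A - B \<subseteq> (\<Union>t\<in>(T - B) \<inter> A. comp t)"
  proof
    fix y assume y: "y \<in> A - B"
    then obtain t where t: "t \<in> T - B" "(y, t) \<in> ?R"
      using reach[of y] A cayley_connected[of y \<one>] by auto
    then show "y \<in> (\<Union>t\<in>(T - B) \<inter> A. comp t)"
      using y A inside[OF t(2)] adj_rtrancl_sym[OF t(2)] by (auto simp: comp_def graph_minus_def)
  qed
  moreover have "infinite (A - B)" using A B by simp
  ultimately obtain t where t: "t \<in> (T - B) \<inter> A" "infinite (comp t)"
    by (meson \<open>finite T\<close> finite_Diff finite_Int finite_UN_I finite_subset)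
  have "comp t \<in> components (graph_minus \<K> ?C)"
    using t A by (auto simp: in_components_iff comp_def graph_minus_def)
  moreover have "comp t \<subseteq> A" using t inside by (auto simp: comp_def)
  ultimately show ?thesis using t by auto
qed

lemma splits_imp_ends:
  assumes "splits_at_infinity G"
  shows "1 < ends_wrt G S"
proof -
  obtain A' where A': "A' \<subseteq> carrier G" "infinite A'" "infinite (carrier G - A')"
    and ai: "\<And>g. g \<in> carrier G \<Longrightarrow> finite {x \<in> A'. g \<otimes> x \<notin> A'}"
    using assms unfolding splits_at_infinity_def by auto
  define A where "A = m_inv G ` A'"
  have mem: "x \<in> A \<longleftrightarrow> inv x \<in> A'" if "x \<in> carrier G" for x
    using that A' by (auto simp: A_def image_iff) (metis inv_inv subsetD)
  have A: "A \<subseteq> carrier G" using A' by (auto simp: A_def)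
  have inj: "inj_on (m_inv G) Y" if "Y \<subseteq> carrier G" for Y
    using that by (meson inj_on_subset inv_inj)
  have "infinite A" unfolding A_def using A' inj by (simp add: finite_image_iff)
  have "m_inv G ` (carrier G - A') \<subseteq> carrier G - A"
    using mem by auto
  moreover have "infinite (m_inv G ` (carrier G - A'))"
    using A' inj by (simp add: finite_image_iff)
  ultimately have "infinite (carrier G - A)" by (meson finite_subset)
  have right: "finite {x \<in> A. x \<otimes> g \<notin> A}" if g: "g \<in> carrier G" for g
  proof -
    have "{x \<in> A. x \<otimes> g \<notin> A} \<subseteq> m_inv G ` {x \<in> A'. inv g \<otimes> x \<notin> A'}"
    proof
      fix x assume x: "x \<in> {x \<in> A. x \<otimes> g \<notin> A}"
      then have xc: "x \<in> carrier G" using A by auto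
      then have "inv x \<in> {x \<in> A'. inv g \<otimes> x \<notin> A'}"
        using x g mem[of x] mem[of "x \<otimes> g"] by (auto simp: inv_mult_group)
      then show "x \<in> m_inv G ` {x \<in> A'. inv g \<otimes> x \<notin> A'}"
        using xc by (metis imageI inv_inv)
    qed
    then show ?thesis using ai g by (meson finite_imageI finite_subset inv_closed)
  qed
  \<comment> \<open>\<open>B\<close> collects the points from which a generator or its inverse
    leaves the set. The extra point \<open>\<one>\<close> is the target of the paths in
    \<open>infinite_component_inside\<close>.\<close>
  define B where "B = {\<one>} \<union> (\<Union>s\<in>S. {x \<in> A. x \<otimes> s \<notin> A} \<union> {x \<in> A. x \<otimes> inv s \<notin> A})"
  have "finite B" unfolding B_def using right finite_S S_carrier by auto
  have "B \<subseteq> carrier G" "\<one> \<in> B" unfolding B_def using A by auto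
  have cross: "y \<in> A" if "x \<in> A" and xy: "(x, y) \<in> adj \<K>" and "x \<notin> B" for x y
  proof (rule ccontr)
    assume "y \<notin> A"
    have c: "x \<in> carrier G" "y \<in> carrier G" using that by (auto simp: adj_cayley_iff)
    obtain s where s: "s \<in> S" "y = x \<otimes> s \<or> x = y \<otimes> s"
      using xy unfolding adj_cayley_iff by auto
    then have "y = x \<otimes> s \<or> y = x \<otimes> inv s"
      using c S_carrier by (auto simp: m_assoc)
    then show False using \<open>y \<notin> A\<close> \<open>x \<in> A\<close> \<open>x \<notin> B\<close> s by (auto simp: B_def)
  qed
  let ?C = "\<lparr>vertices = B, edges = {}\<rparr>"
  obtain Y where Y: "Y \<in> components (graph_minus \<K> ?C)" "infinite Y" "Y \<subseteq> A"
    using infinite_component_inside[OF \<open>finite B\<close> \<open>B \<subseteq> carrier G\<close> \<open>\<one> \<in> B\<close> A \<open>infinite A\<close>] cross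
    by blast
  \<comment> \<open>The same \<open>B\<close> serves the complement: an edge entering
    \<open>A\<close> at a point outside \<open>B\<close>, read backwards, would leave
    \<open>A\<close> from that point.\<close>
  have "\<exists>Y\<in>components (graph_minus \<K> ?C). infinite Y \<and> Y \<subseteq> carrier G - A"
  proof (rule infinite_component_inside[OF \<open>finite B\<close> \<open>B \<subseteq> carrier G\<close> \<open>\<one> \<in> B\<close>])
    show "y \<in> carrier G - A" if "x \<in> carrier G - A" "(x, y) \<in> adj \<K>" "y \<notin> B" for x y
    proof -
      have "(y, x) \<in> adj \<K>" using that(2) by (rule adj_sym)
      then show ?thesis using that cross[of y x] unfolding adj_cayley_iff by blast
    qed
  qed (use \<open>infinite (carrier G - A)\<close> in auto)
  then obtain Z where Z: "Z \<in> components (graph_minus \<K> ?C)" "infinite Z" "Z \<subseteq> carrier G - A"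
    by auto
  have "Y \<in> unbounded_components \<K> ?C" "Z \<in> unbounded_components \<K> ?C"
    using Y Z by (simp_all add: unbounded_components_iff)
  moreover have "Y \<noteq> Z"
  proof
    assume "Y = Z"
    then have "Y = {}" using Y(3) Z(3) by blast
    then show False using Y(2) by simp
  qed
  ultimately have "1 < ecard (unbounded_components \<K> ?C)"
    unfolding one_less_ecard_iff by blast
  moreover have "subgraph ?C \<K> \<and> finite_graph ?C"
    using \<open>finite B\<close> \<open>B \<subseteq> carrier G\<close>
    by (auto simp: subgraph_def finite_graph_def simplicial_graph_def)
  ultimately show ?thesis
    unfolding ends_wrt_def less_SUP_iff by blast
qed

end

lemma number_of_ends_gt_1_iff:
  assumes "finitely_generated_group G"
  shows "number_of_ends G > 1 \<longleftrightarrow> splits_at_infinity G"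
proof -
  let ?S = "SOME S. finite_generating_set G S"
  have "finite_generating_set G ?S" and "group G"
    using assms someI_ex[of "finite_generating_set G"]
    by (simp_all add: finitely_generated_group_def)
  then have c: "cayley G ?S"
    by (simp add: cayley_def cayley_axioms_def)
  show ?thesis
    unfolding number_of_ends_def
    by (rule iffI[OF cayley.ends_imp_splits[OF c] cayley.splits_imp_ends[OF c]])
qed

section \<open>Invariance under isomorphism\<close>

lemma splits_at_infinity_iso_imp:
  assumes "group G" "h \<in> iso G H" "splits_at_infinity G"
  shows "splits_at_infinity H"
proof -
  interpret group G by fact
  obtain A where A: "A \<subseteq> carrier G" "infinite A" "infinite (carrier G - A)"
    and ai: "\<And>g. g \<in> carrier G \<Longrightarrow> finite {x \<in> A. g \<otimes>\<^bsub>G\<^esub> x \<notin> A}"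
    using assms(3) unfolding splits_at_infinity_def by blast
  have b: "bij_betw h (carrier G) (carrier H)" and hom: "h \<in> hom G H"
    using assms(2) by (auto simp: iso_def)
  have inj: "inj_on h (carrier G)" and surj: "h ` carrier G = carrier H"
    using b by (auto simp: bij_betw_def)
  have "h ` (carrier G - A) = carrier H - h ` A"
    using inj_on_image_set_diff[OF inj, of "carrier G" A] A surj by simp
  then have "infinite (carrier H - h ` A)"
    using A(3) finite_image_iff[OF inj_on_subset[OF inj Diff_subset], of A] by metis
  moreover have "infinite (h ` A)" using A finite_image_iff[OF inj_on_subset[OF inj]] by simp
  moreover have "finite {x \<in> h ` A. g \<otimes>\<^bsub>H\<^esub> x \<notin> h ` A}" if g: "g \<in> carrier H" for g
  proof -
    obtain g' where g': "g' \<in> carrier G" "g = h g'" using g surj by auto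
    have "h (g' \<otimes>\<^bsub>G\<^esub> y) = g \<otimes>\<^bsub>H\<^esub> h y" if "y \<in> A" for y
      using hom_mult[OF hom g'(1), of y] that A g'(2) by auto
    then have "{x \<in> h ` A. g \<otimes>\<^bsub>H\<^esub> x \<notin> h ` A} \<subseteq> h ` {x \<in> A. g' \<otimes>\<^bsub>G\<^esub> x \<notin> A}"
      by (smt (verit) image_iff mem_Collect_eq subsetI)
    then show ?thesis using ai g' by (meson finite_imageI finite_subset)
  qed
  moreover have "h ` A \<subseteq> carrier H" using A surj by auto
  ultimately show ?thesis
    unfolding splits_at_infinity_def by (intro exI[of _ "h ` A"] conjI ballI) auto
qed

lemma splits_at_infinity_iso:
  assumes "group G" "group H" "G \<cong> H"
  shows "splits_at_infinity G \<longleftrightarrow> splits_at_infinity H"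
proof -
  obtain h where h: "h \<in> iso G H" using assms(3) by (auto simp: is_iso_def)
  show ?thesis
  proof
    show "splits_at_infinity G \<Longrightarrow> splits_at_infinity H"
      by (rule splits_at_infinity_iso_imp[OF assms(1) h])
    show "splits_at_infinity H \<Longrightarrow> splits_at_infinity G"
      by (rule splits_at_infinity_iso_imp[OF assms(2) group.iso_set_sym[OF assms(1) h]])
  qed
qed

section \<open>Free products and their quotients\<close>

lemma (in group) normal_closure_normal:
  assumes "R \<subseteq> carrier G" shows "normal_closure G R \<lhd> G"
proof -
  let ?\<N> = "{N. N \<lhd> G \<and> R \<subseteq> N}"
  have "carrier G \<lhd> G"
    using subgroup_self by (auto simp: normal_inv_iff)
  then have ne: "carrier G \<in> ?\<N>" using assms by simp
  have sub: "subgroup (\<Inter>?\<N>) G"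
    using ne normal_imp_subgroup by (intro subgroups_Inter) auto
  have "x \<otimes> h \<otimes> inv x \<in> \<Inter>?\<N>" if "x \<in> carrier G" "h \<in> \<Inter>?\<N>" for x h
    using that normal.inv_op_closed2 by fastforce
  then have "\<Inter>?\<N> \<lhd> G"
    using sub by (simp only: normal_inv_iff) blast
  then show ?thesis by (simp add: normal_closure_def)
qed

lemma normal_closure_superset: "R \<subseteq> normal_closure G R"
  by (auto simp: normal_closure_def)

lemma normal_closure_least: "N \<lhd> G \<Longrightarrow> R \<subseteq> N \<Longrightarrow> normal_closure G R \<subseteq> N"
  by (auto simp: normal_closure_def)

section \<open>Words and the universal property of free products\<close>

definition word_eval ::
    "('c, 'd) monoid_scheme \<Rightarrow> ('i \<Rightarrow> 'a \<Rightarrow> 'c) \<Rightarrow> ('i \<times> 'a) list \<Rightarrow> 'c" where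
  "word_eval H f w = foldr (\<lambda>s x. f (fst s) (snd s) \<otimes>\<^bsub>H\<^esub> x) w \<one>\<^bsub>H\<^esub>"

lemma word_eval_Nil [simp]: "word_eval H f [] = \<one>\<^bsub>H\<^esub>"
  and word_eval_Cons [simp]: "word_eval H f (s # w) = f (fst s) (snd s) \<otimes>\<^bsub>H\<^esub> word_eval H f w"
  by (simp_all add: word_eval_def)

locale group_family =
  fixes I :: "'i set" and G :: "'i \<Rightarrow> ('a, 'b) monoid_scheme"
  assumes group_factor: "i \<in> I \<Longrightarrow> group (G i)"
begin

abbreviation "W \<equiv> words I G"
abbreviation "F \<equiv> free_product I G"
abbreviation "wcls \<equiv> word_class I G"

lemma words_Nil [simp]: "[] \<in> W"
  and words_Cons [simp]: "s # w \<in> W \<longleftrightarrow> fst s \<in> I \<and> snd s \<in> carrier (G (fst s)) \<and> w \<in> W"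
  and words_append [simp]: "w @ w' \<in> W \<longleftrightarrow> w \<in> W \<and> w' \<in> W"
  by (cases s; auto simp: words_def)+

lemma word_eq_words: "(w, w') \<in> word_eq I G \<Longrightarrow> w \<in> W \<and> w' \<in> W"
proof (induction rule: word_eq.induct)
  case (unit u v i)
  then show ?case using group.is_monoid[OF group_factor] by (auto intro: monoid.one_closed)
next
  case (mult u v i g h)
  then show ?case using group.is_monoid[OF group_factor] by (auto intro: monoid.m_closed)
qed auto

lemma equiv_word_eq: "equiv W (word_eq I G)"
  using word_eq_words
  by (intro equivI refl_onI symI transI)
    (auto intro: word_eq.refl word_eq.sym word_eq.trans)

lemma word_eq_context:
  "(w, w') \<in> word_eq I G \<Longrightarrow> x \<in> W \<Longrightarrow> y \<in> W \<Longrightarrow> (x @ w @ y, x @ w' @ y) \<in> word_eq I G"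
proof (induction rule: word_eq.induct)
  case (refl w) then show ?case by (intro word_eq.refl) simp
next
  case (sym w w') then show ?case by (blast intro: word_eq.sym)
next
  case (trans w w' w'') then show ?case by (blast intro: word_eq.trans)
next
  case (unit u v i)
  then show ?case using word_eq.unit[of "x @ u" I G "v @ y" i] by simp
next
  case (mult u v i g h)
  then show ?case using word_eq.mult[of "x @ u" I G "v @ y" i g h] by simp
qed

lemma word_eq_append:
  assumes "(u, u') \<in> word_eq I G" "(v, v') \<in> word_eq I G"
  shows "(u @ v, u' @ v') \<in> word_eq I G"
proof -
  have "(u @ v, u' @ v) \<in> word_eq I G"
    using word_eq_context[OF assms(1), of "[]" v] word_eq_words[OF assms(2)] by simp
  moreover have "(u' @ v, u' @ v') \<in> word_eq I G"
    using word_eq_context[OF assms(2), of u' "[]"] word_eq_words[OF assms(1)] by simp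
  ultimately show ?thesis by (rule word_eq.trans)
qed

lemma wcls_eq_iff: "w \<in> W \<Longrightarrow> w' \<in> W \<Longrightarrow> wcls w = wcls w' \<longleftrightarrow> (w, w') \<in> word_eq I G"
  unfolding word_class_def by (rule eq_equiv_class_iff[OF equiv_word_eq])

lemma carrier_free_product: "carrier F = wcls ` W"
  by (auto simp: free_product_def quotient_def word_class_def)

lemma mult_free_product:
  assumes "u \<in> W" "v \<in> W" shows "wcls u \<otimes>\<^bsub>F\<^esub> wcls v = wcls (u @ v)"
proof -
  have self: "w \<in> wcls w" if "w \<in> W" for w
    using that by (simp add: word_class_def word_eq.refl)
  have "wcls (x @ y) = wcls (u @ v)" if "x \<in> wcls u" "y \<in> wcls v" for x y
  proof -
    have "(u @ v, x @ y) \<in> word_eq I G"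
      using that by (auto simp: word_class_def intro: word_eq_append)
    then show ?thesis
      using word_eq_words wcls_eq_iff by metis
  qed
  note * = this
  have "wcls u \<otimes>\<^bsub>F\<^esub> wcls v = (\<Union>x\<in>wcls u. \<Union>y\<in>wcls v. wcls (x @ y))"
    by (simp add: free_product_def)
  also have "\<dots> = (\<Union>x\<in>wcls u. \<Union>y\<in>wcls v. wcls (u @ v))"
    using * by simp
  also have "\<dots> = wcls (u @ v)"
    using self[OF assms(1)] self[OF assms(2)] by blast
  finally show ?thesis .
qed

lemma one_free_product: "\<one>\<^bsub>F\<^esub> = wcls []"
  by (simp add: free_product_def)

definition word_inv :: "('i \<times> 'a) list \<Rightarrow> ('i \<times> 'a) list" where
  "word_inv w = rev (map (\<lambda>(i, g). (i, inv\<^bsub>G i\<^esub> g)) w)"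

lemma word_inv_words: "w \<in> W \<Longrightarrow> word_inv w \<in> W"
  by (induction w) (auto simp: word_inv_def group.inv_closed group_factor)

lemma word_eq_inv: "w \<in> W \<Longrightarrow> (word_inv w @ w, []) \<in> word_eq I G"
proof (induction w)
  case (Cons s w)
  obtain i g where s: "s = (i, g)" by (cases s)
  have ig: "i \<in> I" "g \<in> carrier (G i)" "w \<in> W" using Cons.prems s by auto
  interpret Gi: group "G i" by (rule group_factor[OF ig(1)])
  have w: "word_inv w \<in> W" by (rule word_inv_words[OF ig(3)])
  have "(word_inv w @ [(i, inv\<^bsub>G i\<^esub> g), (i, g)] @ w, word_inv w @ [(i, \<one>\<^bsub>G i\<^esub>)] @ w) \<in> word_eq I G"
    using word_eq.mult[OF w ig(3) ig(1), of "inv\<^bsub>G i\<^esub> g" g] ig by simp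
  also have "(word_inv w @ [(i, \<one>\<^bsub>G i\<^esub>)] @ w, word_inv w @ w) \<in> word_eq I G"
    by (rule word_eq.unit[OF w ig(3) ig(1)])
  finally (word_eq.trans) have "(word_inv (s # w) @ (s # w), word_inv w @ w) \<in> word_eq I G"
    by (simp add: word_inv_def s)
  then show ?case using Cons.IH[OF ig(3)] word_eq.trans by blast
qed (simp add: word_inv_def word_eq.refl)

lemma group_free_product: "group F"
proof (rule groupI)
  show "\<exists>y\<in>carrier F. y \<otimes>\<^bsub>F\<^esub> x = \<one>\<^bsub>F\<^esub>" if x: "x \<in> carrier F" for x
  proof -
    obtain w where w: "w \<in> W" "x = wcls w" using x by (auto simp: carrier_free_product)
    then have "wcls (word_inv w) \<otimes>\<^bsub>F\<^esub> x = \<one>\<^bsub>F\<^esub>"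
      using word_eq_inv[OF w(1)] word_inv_words[OF w(1)]
      by (simp add: mult_free_product one_free_product wcls_eq_iff)
    then show ?thesis using word_inv_words[OF w(1)] by (auto simp: carrier_free_product)
  qed
qed (auto simp: carrier_free_product mult_free_product one_free_product)

lemma word_eval_closed:
  assumes H: "group H" and f: "\<And>i. i \<in> I \<Longrightarrow> f i \<in> hom (G i) H" and w: "w \<in> W"
  shows "word_eval H f w \<in> carrier H"
proof -
  interpret H: group H by fact
  show ?thesis using w by (induction w) (auto intro: hom_in_carrier[OF f])
qed

lemma word_eval_append:
  assumes H: "group H" and f: "\<And>i. i \<in> I \<Longrightarrow> f i \<in> hom (G i) H" and "u \<in> W" and v: "v \<in> W"
  shows "word_eval H f (u @ v) = word_eval H f u \<otimes>\<^bsub>H\<^esub> word_eval H f v"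
proof -
  interpret H: group H by fact
  note cl = word_eval_closed[OF H f]
  show ?thesis using \<open>u \<in> W\<close>
    by (induction u) (auto simp: cl v H.m_assoc hom_in_carrier[OF f])
qed

lemma word_eval_word_eq:
  assumes H: "group H" and f: "\<And>i. i \<in> I \<Longrightarrow> f i \<in> hom (G i) H"
  shows "(w, w') \<in> word_eq I G \<Longrightarrow> word_eval H f w = word_eval H f w'"
proof (induction rule: word_eq.induct)
  case (unit u v i)
  interpret H: group H by fact
  have "f i \<one>\<^bsub>G i\<^esub> = \<one>\<^bsub>H\<^esub>" using f unit H group_factor by (intro hom_one) auto
  moreover have "[(i, \<one>\<^bsub>G i\<^esub>)] @ v \<in> W"
    using unit group.is_monoid[OF group_factor] by (auto intro: monoid.one_closed)
  ultimately show ?case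
    using unit by (simp add: word_eval_append[OF H f] word_eval_closed[OF H f])
next
  case (mult u v i g h)
  interpret H: group H by fact
  interpret Gi: group "G i" using mult group_factor by simp
  have "f i (g \<otimes>\<^bsub>G i\<^esub> h) = f i g \<otimes>\<^bsub>H\<^esub> f i h" using f mult by (intro hom_mult[of _ "G i"]) auto
  then show ?case
    using mult hom_in_carrier[OF f]
    by (simp add: word_eval_append[OF H f] word_eval_closed[OF H f] H.m_assoc)
qed auto

lemma free_product_universal:
  assumes H: "group H" and f: "\<And>i. i \<in> I \<Longrightarrow> f i \<in> hom (G i) H"
  obtains h where "h \<in> hom F H" "\<And>w. w \<in> W \<Longrightarrow> h (wcls w) = word_eval H f w"
proof -
  define h where "h X = word_eval H f (SOME w. w \<in> W \<and> wcls w = X)" for X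
  have h: "h (wcls w) = word_eval H f w" if "w \<in> W" for w
  proof -
    let ?w = "SOME w'. w' \<in> W \<and> wcls w' = wcls w"
    have "?w \<in> W \<and> wcls ?w = wcls w" using that
      someI[of "\<lambda>w'. w' \<in> W \<and> wcls w' = wcls w" w] by simp
    then have "(?w, w) \<in> word_eq I G" using that wcls_eq_iff[of ?w w] by blast
    then show ?thesis unfolding h_def by (intro word_eval_word_eq[OF H] f)
  qed
  have "h \<in> hom F H"
    by (rule homI)
      (auto simp: carrier_free_product mult_free_product h word_eval_append[OF H f]
        word_eval_closed[OF H f])
  then show ?thesis using h by (rule that)
qed

end

text \<open>Graph products (indexed by the vertices) and amalgamated products (indexed by the two
  truth values) are both instances, so one universal property builds the maps between them in either
  direction.\<close>

locale presented_group = group_family I G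
  for I :: "'i set" and G :: "'i \<Rightarrow> ('a, 'b) monoid_scheme" +
  fixes R :: "('i \<times> 'a) list set set"
  assumes relators: "R \<subseteq> carrier (free_product I G)"
begin

declare mult_FactGroup [simp del] one_FactGroup [simp del]

abbreviation "N \<equiv> normal_closure F R"
abbreviation "Q \<equiv> F Mod N"

definition pcls :: "('i \<times> 'a) list \<Rightarrow> ('i \<times> 'a) list set set" where
  "pcls w = N #>\<^bsub>F\<^esub> wcls w"

sublocale F: group F by (rule group_free_product)
sublocale N: normal N F by (rule F.normal_closure_normal[OF relators])
sublocale Q: group Q by (rule N.factorgroup_is_group)

lemma carrier_Q: "carrier Q = pcls ` W"
  by (auto simp: carrier_FactGroup carrier_free_product pcls_def)

lemma pcls_closed [intro, simp]: "w \<in> W \<Longrightarrow> pcls w \<in> carrier Q"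
  by (simp add: carrier_Q)

lemma wcls_closed [intro, simp]: "w \<in> W \<Longrightarrow> wcls w \<in> carrier F"
  by (simp add: carrier_free_product)

lemma pcls_append: "u \<in> W \<Longrightarrow> v \<in> W \<Longrightarrow> pcls (u @ v) = pcls u \<otimes>\<^bsub>Q\<^esub> pcls v"
  by (simp add: pcls_def N.rcos_sum mult_free_product mult_FactGroup)

lemma pcls_Nil: "pcls [] = \<one>\<^bsub>Q\<^esub>"
  using N.subset by (simp add: pcls_def one_FactGroup flip: one_free_product)

lemma pcls_word_eq: "(w, w') \<in> word_eq I G \<Longrightarrow> pcls w = pcls w'"
  using wcls_eq_iff[of w w'] word_eq_words[of w w'] by (simp add: pcls_def)

lemma pcls_relator: "w \<in> W \<Longrightarrow> wcls w \<in> R \<Longrightarrow> pcls w = \<one>\<^bsub>Q\<^esub>"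
  using normal_closure_superset[of R F] F.coset_join2[OF _ N.is_subgroup, of "wcls w"]
  by (auto simp: pcls_def one_FactGroup)

lemma pcls_unit: "i \<in> I \<Longrightarrow> pcls [(i, \<one>\<^bsub>G i\<^esub>)] = \<one>\<^bsub>Q\<^esub>"
  using pcls_word_eq[OF word_eq.unit[of "[]" I G "[]" i]] by (simp add: pcls_Nil)

lemma pcls_mult:
  assumes "i \<in> I" "g \<in> carrier (G i)" "h \<in> carrier (G i)"
  shows "pcls [(i, g \<otimes>\<^bsub>G i\<^esub> h)] = pcls [(i, g)] \<otimes>\<^bsub>Q\<^esub> pcls [(i, h)]"
  using pcls_word_eq[OF word_eq.mult[of "[]" I G "[]" i g h]] pcls_append[of "[(i, g)]" "[(i, h)]"]
    assms by simp

lemma pcls_hom: "i \<in> I \<Longrightarrow> (\<lambda>g. pcls [(i, g)]) \<in> hom (G i) Q"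
  by (rule homI) (auto simp: pcls_mult)

lemma pcls_inv:
  assumes "i \<in> I" "g \<in> carrier (G i)"
  shows "pcls [(i, inv\<^bsub>G i\<^esub> g)] = inv\<^bsub>Q\<^esub> pcls [(i, g)]"
proof -
  interpret group_hom "G i" Q "\<lambda>g. pcls [(i, g)]"
    using assms pcls_hom group_factor by (simp add: group_hom_def group_hom_axioms_def)
  show ?thesis using hom_inv assms by simp
qed

lemma pcls_Cons:
  assumes "s # w \<in> W" shows "pcls (s # w) = pcls [s] \<otimes>\<^bsub>Q\<^esub> pcls w"
  using pcls_append[of "[s]" w] assms by simp

lemma pcls_word_eval: "w \<in> W \<Longrightarrow> pcls w = word_eval Q (\<lambda>i g. pcls [(i, g)]) w"
proof (induction w)
  case (Cons s w)
  then show ?case using pcls_Cons[of s w] by simp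
qed (simp add: pcls_Nil)

lemma universal:
  assumes H: "group H" and f: "\<And>i. i \<in> I \<Longrightarrow> f i \<in> hom (G i) H"
    and R: "\<And>w. w \<in> W \<Longrightarrow> wcls w \<in> R \<Longrightarrow> word_eval H f w = \<one>\<^bsub>H\<^esub>"
  obtains h where "h \<in> hom Q H" "\<And>w. w \<in> W \<Longrightarrow> h (pcls w) = word_eval H f w"
proof -
  obtain h where h: "h \<in> hom F H" "\<And>w. w \<in> W \<Longrightarrow> h (wcls w) = word_eval H f w"
    using free_product_universal[OF H f] by blast
  interpret h: group_hom F H h
    using h H F.is_group by (simp add: group_hom_def group_hom_axioms_def)
  have "R \<subseteq> kernel F H h"
    using relators R h by (fastforce simp: kernel_def carrier_free_product)
  then have "N \<subseteq> kernel F H h"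
    by (rule normal_closure_least[OF h.normal_kernel])
  then obtain k where "k \<in> hom Q H" "\<And>x. x \<in> carrier F \<Longrightarrow> k (N #>\<^bsub>F\<^esub> x) = h x"
    using h.FactGroup_universal_kernel[OF N.normal_axioms] by blast
  then show ?thesis using h(2) by (intro that[of k]) (simp_all add: pcls_def)
qed

lemma hom_eq_on_generators:
  assumes H: "group H" and h: "h \<in> hom Q H" and k: "k \<in> hom Q H"
    and eq: "\<And>i g. i \<in> I \<Longrightarrow> g \<in> carrier (G i) \<Longrightarrow> h (pcls [(i, g)]) = k (pcls [(i, g)])"
    and x: "x \<in> carrier Q"
  shows "h x = k x"
proof -
  obtain w where w: "w \<in> W" "x = pcls w" using x unfolding carrier_Q by blast
  have "h (pcls w) = k (pcls w)" using w(1)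
  proof (induction w)
    case Nil
    then show ?case
      using hom_one[OF h Q.is_group H] hom_one[OF k Q.is_group H] by (simp add: pcls_Nil)
  next
    case (Cons s w)
    then have "pcls [s] \<in> carrier Q" "pcls w \<in> carrier Q" by auto
    moreover have "h (pcls [s]) = k (pcls [s])" using eq[of "fst s" "snd s"] Cons by simp
    ultimately show ?case
      using Cons by (simp only: pcls_Cons hom_mult[OF h] hom_mult[OF k]) simp
  qed
  then show ?thesis using w by simp
qed

lemma finitely_generated:
  assumes "finite I" and fg: "\<And>i. i \<in> I \<Longrightarrow> finitely_generated_group (G i)"
  shows "finitely_generated_group Q"
proof -
  obtain S where S: "\<And>i. i \<in> I \<Longrightarrow> finite_generating_set (G i) (S i)"
    using fg unfolding finitely_generated_group_def by metis
  let ?T = "\<Union>i\<in>I. (\<lambda>g. pcls [(i, g)]) ` S i"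
  have S_carrier: "S i \<subseteq> carrier (G i)" "finite (S i)" "generate (G i) (S i) = carrier (G i)"
    if "i \<in> I" for i
    using S[OF that] by (auto simp: finite_generating_set_def)
  have S_in: "g \<in> carrier (G i)" if "i \<in> I" "g \<in> S i" for i g
    using that S_carrier(1) by blast
  have T: "?T \<subseteq> carrier Q" by (auto simp: S_in)
  have "pcls [(i, g)] \<in> generate Q ?T" if i: "i \<in> I" and g: "g \<in> generate (G i) (S i)" for i g
    using g
  proof (induction rule: generate.induct)
    case one then show ?case using i by (simp add: pcls_unit generate.one)
  next
    case (incl h) then show ?case using i by (intro generate.incl) blast
  next
    case (inv h)
    then have "pcls [(i, inv\<^bsub>G i\<^esub> h)] = inv\<^bsub>Q\<^esub> pcls [(i, h)]"
      using i by (intro pcls_inv S_in)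
    moreover have "inv\<^bsub>Q\<^esub> pcls [(i, h)] \<in> generate Q ?T"
      using i inv by (intro generate.inv) blast
    ultimately show ?case by simp
  next
    case (eng h1 h2)
    then have "pcls [(i, h1 \<otimes>\<^bsub>G i\<^esub> h2)] = pcls [(i, h1)] \<otimes>\<^bsub>Q\<^esub> pcls [(i, h2)]"
      using i S_carrier(3)[OF i] by (intro pcls_mult) auto
    then show ?case using eng.IH by (simp only: generate.eng)
  qed
  then have syl: "pcls [s] \<in> generate Q ?T" if "[s] \<in> W" for s
    using that S_carrier(3)[of "fst s"] by (cases s) auto
  have "pcls w \<in> generate Q ?T" if "w \<in> W" for w
    using that
  proof (induction w)
    case (Cons s w)
    then have "pcls (s # w) = pcls [s] \<otimes>\<^bsub>Q\<^esub> pcls w" by (intro pcls_Cons)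
    moreover have "pcls [s] \<in> generate Q ?T" using Cons.prems by (intro syl) simp
    moreover have "pcls w \<in> generate Q ?T" using Cons by simp
    ultimately show ?case by (simp only: generate.eng)
  qed (simp add: pcls_Nil generate.one)
  then have "generate Q ?T = carrier Q"
    using Q.generate_incl[OF T] unfolding carrier_Q by blast
  then have "finite_generating_set Q ?T"
    using T assms(1) S_carrier(2) by (simp add: finite_generating_set_def)
  then show ?thesis
    using Q.is_group unfolding finitely_generated_group_def by blast
qed

end

section \<open>Normal forms in graph products\<close>

locale graph_groups =
  fixes \<Gamma> :: "'v sgraph" and G :: "'v \<Rightarrow> ('a, 'b) monoid_scheme"
  assumes simplicial: "simplicial_graph \<Gamma>"
    and finite_vertices: "finite (vertices \<Gamma>)"
    and group_vertex: "v \<in> vertices \<Gamma> \<Longrightarrow> group (G v)"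
begin

abbreviation "V \<equiv> vertices \<Gamma>"

sublocale group_family V G
  by (rule group_family.intro) (rule group_vertex)

lemma edgeD: "{u, v} \<in> edges \<Gamma> \<Longrightarrow> u \<noteq> v \<and> u \<in> V \<and> v \<in> V"
  using simplicial by (fastforce simp: simplicial_graph_def doubleton_eq_iff)

lemma edge_sym: "{u, v} \<in> edges \<Gamma> \<longleftrightarrow> {v, u} \<in> edges \<Gamma>"
  by (simp add: insert_commute)

lemma no_loop: "{v} \<notin> edges \<Gamma>"
  using edgeD[of v v] by auto

lemma inv_wcls_syllable:
  assumes "u \<in> V" "g \<in> carrier (G u)"
  shows "inv\<^bsub>F\<^esub> wcls [(u, g)] = wcls [(u, inv\<^bsub>G u\<^esub> g)]"
proof -
  interpret F: group F by (rule group_free_product)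
  have "wcls [(u, inv\<^bsub>G u\<^esub> g)] \<otimes>\<^bsub>F\<^esub> wcls [(u, g)] = \<one>\<^bsub>F\<^esub>"
    using word_eq_inv[of "[(u, g)]"] assms group.inv_closed[OF group_vertex[OF assms(1)]]
    by (simp add: word_inv_def mult_free_product one_free_product wcls_eq_iff)
  then show ?thesis
    using assms group.inv_closed[OF group_vertex[OF assms(1)]]
    by (intro F.inv_equality) (auto simp: carrier_free_product)
qed

lemma commutator_wcls:
  assumes "u \<in> V" "w \<in> V" "g \<in> carrier (G u)" "h \<in> carrier (G w)"
  shows "commutator F (free_incl V G u g) (free_incl V G w h) =
     wcls [(u, g), (w, h), (u, inv\<^bsub>G u\<^esub> g), (w, inv\<^bsub>G w\<^esub> h)]"
  using assms group.inv_closed[OF group_vertex]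
  by (simp add: commutator_def free_incl_def inv_wcls_syllable mult_free_product)

lemma graph_relators_eq:
  "graph_relators \<Gamma> G =
     {wcls [(u, g), (w, h), (u, inv\<^bsub>G u\<^esub> g), (w, inv\<^bsub>G w\<^esub> h)] | u w g h.
        {u, w} \<in> edges \<Gamma> \<and> g \<in> carrier (G u) \<and> h \<in> carrier (G w)}"
  unfolding graph_relators_def using commutator_wcls edgeD
  by (intro Collect_cong ex_cong1) metis

lemma commutator_word:
  assumes "{u, w} \<in> edges \<Gamma>" "g \<in> carrier (G u)" "h \<in> carrier (G w)"
  shows "[(u, g), (w, h), (u, inv\<^bsub>G u\<^esub> g), (w, inv\<^bsub>G w\<^esub> h)] \<in> W"
  using assms edgeD[OF assms(1)] group.inv_closed[OF group_vertex] by simp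

sublocale presented_group V G "graph_relators \<Gamma> G"
proof
  show "graph_relators \<Gamma> G \<subseteq> carrier F"
    unfolding graph_relators_eq carrier_free_product using commutator_word by blast
qed

lemma graph_product_eq: "graph_product \<Gamma> G = Q"
  by (simp add: graph_product_def Let_def)

lemma gp_class_eq: "gp_class \<Gamma> G = pcls"
  by (rule ext) (simp add: gp_class_def pcls_def Let_def)

text \<open>The bracketing to the right is the one that evaluating a commutator word from its end
  produces.\<close>

lemma (in group) commutator_eq_one_iff:
  assumes "x \<in> carrier G" "y \<in> carrier G"
  shows "x \<otimes> (y \<otimes> (inv x \<otimes> inv y)) = \<one> \<longleftrightarrow> x \<otimes> y = y \<otimes> x"
proof -
  have "x \<otimes> (y \<otimes> (inv x \<otimes> inv y)) = (x \<otimes> y) \<otimes> inv (y \<otimes> x)"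
    using assms by (simp add: m_assoc inv_mult_group)
  then show ?thesis using assms by (metis m_closed r_inv inv_closed inv_equality inv_inv)
qed

lemma pcls_commute:
  assumes "{u, w} \<in> edges \<Gamma>" "g \<in> carrier (G u)" "h \<in> carrier (G w)"
  shows "pcls [(u, g)] \<otimes>\<^bsub>Q\<^esub> pcls [(w, h)] = pcls [(w, h)] \<otimes>\<^bsub>Q\<^esub> pcls [(u, g)]"
proof -
  note uw = edgeD[OF assms(1)]
  have "pcls [(u, g), (w, h), (u, inv\<^bsub>G u\<^esub> g), (w, inv\<^bsub>G w\<^esub> h)] = \<one>\<^bsub>Q\<^esub>"
    using assms by (intro pcls_relator commutator_word) (auto simp: graph_relators_eq)
  then have "pcls [(u, g)] \<otimes>\<^bsub>Q\<^esub> (pcls [(w, h)] \<otimes>\<^bsub>Q\<^esub>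
      (inv\<^bsub>Q\<^esub> pcls [(u, g)] \<otimes>\<^bsub>Q\<^esub> inv\<^bsub>Q\<^esub> pcls [(w, h)])) = \<one>\<^bsub>Q\<^esub>"
    using commutator_word[OF assms] uw assms group.inv_closed[OF group_vertex]
    by (simp add: pcls_inv[symmetric] pcls_append[symmetric])
  then show ?thesis
    using uw assms by (subst (asm) Q.commutator_eq_one_iff) auto
qed

lemma graph_product_universal:
  assumes H: "group H" and f: "\<And>v. v \<in> V \<Longrightarrow> f v \<in> hom (G v) H"
    and comm: "\<And>u w g h. {u, w} \<in> edges \<Gamma> \<Longrightarrow> g \<in> carrier (G u) \<Longrightarrow> h \<in> carrier (G w) \<Longrightarrow>
      f u g \<otimes>\<^bsub>H\<^esub> f w h = f w h \<otimes>\<^bsub>H\<^esub> f u g"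
  obtains h where "h \<in> hom Q H" "\<And>w. w \<in> W \<Longrightarrow> h (pcls w) = word_eval H f w"
proof (rule universal[OF H f])
  interpret H: group H by fact
  fix w assume w: "w \<in> W" "wcls w \<in> graph_relators \<Gamma> G"
  then obtain u v g h where e: "{u, v} \<in> edges \<Gamma>" "g \<in> carrier (G u)" "h \<in> carrier (G v)"
    and wc: "wcls w = wcls [(u, g), (v, h), (u, inv\<^bsub>G u\<^esub> g), (v, inv\<^bsub>G v\<^esub> h)]"
    by (auto simp: graph_relators_eq)
  have uv: "u \<in> V" "v \<in> V" using edgeD[OF e(1)] by auto
  have fc: "f u g \<in> carrier H" "f v h \<in> carrier H"
    using hom_in_carrier[OF f] uv e by auto
  have finv: "f u (inv\<^bsub>G u\<^esub> g) = inv\<^bsub>H\<^esub> f u g" "f v (inv\<^bsub>G v\<^esub> h) = inv\<^bsub>H\<^esub> f v h"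
    using uv e f H group_vertex
    by (auto intro!: group_hom.hom_inv simp: group_hom_def group_hom_axioms_def)
  have "(w, [(u, g), (v, h), (u, inv\<^bsub>G u\<^esub> g), (v, inv\<^bsub>G v\<^esub> h)]) \<in> word_eq V G"
    using wc w commutator_word[OF e] wcls_eq_iff by blast
  then have "word_eval H f w =
      word_eval H f [(u, g), (v, h), (u, inv\<^bsub>G u\<^esub> g), (v, inv\<^bsub>G v\<^esub> h)]"
    by (intro word_eval_word_eq[OF H] f)
  also have "\<dots> = f u g \<otimes>\<^bsub>H\<^esub> (f v h \<otimes>\<^bsub>H\<^esub> (inv\<^bsub>H\<^esub> f u g \<otimes>\<^bsub>H\<^esub> inv\<^bsub>H\<^esub> f v h))"
    using fc finv by simp
  also have "\<dots> = \<one>\<^bsub>H\<^esub>"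
    using H.commutator_eq_one_iff[OF fc] comm[OF e] by simp
  finally show "word_eval H f w = \<one>\<^bsub>H\<^esub>" .
qed (use that in auto)

text \<open>A reduced word is encoded by its projections to the pairs of vertices that are not joined by
  an edge: \<open>\<phi> x y\<close> lists the syllables at \<open>x\<close> and \<open>y\<close> in their order of appearance. Words that differ
  by swapping adjacent commuting syllables have the same encoding.\<close>

definition touch :: "'v \<Rightarrow> 'v \<Rightarrow> 'v \<Rightarrow> bool" where
  "touch v x y \<longleftrightarrow> (x = v \<or> y = v) \<and> {x, y} \<notin> edges \<Gamma>"

text \<open>In every projection that involves \<open>v\<close> the first syllable is at
  \<open>v\<close>: nothing that fails to commute with it stands before it, so it can be moved to
  the front. The pair of \<open>v\<close> with itself guarantees that there is such a
  syllable.\<close>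

definition init :: "'v \<Rightarrow> ('v \<Rightarrow> 'v \<Rightarrow> ('v \<times> 'a) list) \<Rightarrow> bool" where
  "init v \<phi> \<longleftrightarrow> (\<forall>x y. touch v x y \<longrightarrow> \<phi> x y \<noteq> [] \<and> fst (hd (\<phi> x y)) = v)"

definition push :: "'v \<Rightarrow> 'a \<Rightarrow> ('v \<Rightarrow> 'v \<Rightarrow> ('v \<times> 'a) list) \<Rightarrow> 'v \<Rightarrow> 'v \<Rightarrow> ('v \<times> 'a) list" where
  "push v a \<phi> = (\<lambda>x y. if touch v x y then (v, a) # \<phi> x y else \<phi> x y)"

definition pop :: "'v \<Rightarrow> ('v \<Rightarrow> 'v \<Rightarrow> ('v \<times> 'a) list) \<Rightarrow> 'v \<Rightarrow> 'v \<Rightarrow> ('v \<times> 'a) list" where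
  "pop v \<phi> = (\<lambda>x y. if touch v x y then tl (\<phi> x y) else \<phi> x y)"

text \<open>\<open>coeff\<close> and \<open>base\<close> are coordinates with respect to the cosets
  of a vertex group: the vertex group part in front, and the shortest element of the coset.
  \<open>mk\<close> puts them together again, dropping a trivial syllable, and \<open>act\<close> is
  left multiplication in these coordinates.\<close>

definition coeff :: "'v \<Rightarrow> ('v \<Rightarrow> 'v \<Rightarrow> ('v \<times> 'a) list) \<Rightarrow> 'a" where
  "coeff v \<phi> = (if init v \<phi> then snd (hd (\<phi> v v)) else \<one>\<^bsub>G v\<^esub>)"

definition base :: "'v \<Rightarrow> ('v \<Rightarrow> 'v \<Rightarrow> ('v \<times> 'a) list) \<Rightarrow> 'v \<Rightarrow> 'v \<Rightarrow> ('v \<times> 'a) list" where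
  "base v \<phi> = (if init v \<phi> then pop v \<phi> else \<phi>)"

definition mk :: "'v \<Rightarrow> 'a \<Rightarrow> ('v \<Rightarrow> 'v \<Rightarrow> ('v \<times> 'a) list) \<Rightarrow> 'v \<Rightarrow> 'v \<Rightarrow> ('v \<times> 'a) list" where
  "mk v a \<phi> = (if a = \<one>\<^bsub>G v\<^esub> then \<phi> else push v a \<phi>)"

definition act :: "'v \<Rightarrow> 'a \<Rightarrow> ('v \<Rightarrow> 'v \<Rightarrow> ('v \<times> 'a) list) \<Rightarrow> 'v \<Rightarrow> 'v \<Rightarrow> ('v \<times> 'a) list" where
  "act v a \<phi> = mk v (a \<otimes>\<^bsub>G v\<^esub> coeff v \<phi>) (base v \<phi>)"

abbreviation void :: "'v \<Rightarrow> 'v \<Rightarrow> ('v \<times> 'a) list" where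
  "void \<equiv> \<lambda>_ _. []"

text \<open>The encodings of reduced words, built from the last syllable to the first. The new
  syllable may not merge with an earlier one, which is exactly the condition that its vertex is not
  initial.\<close>

inductive_set X :: "('v \<Rightarrow> 'v \<Rightarrow> ('v \<times> 'a) list) set" where
  void: "void \<in> X"
| push: "\<phi> \<in> X \<Longrightarrow> v \<in> V \<Longrightarrow> a \<in> carrier (G v) \<Longrightarrow> a \<noteq> \<one>\<^bsub>G v\<^esub> \<Longrightarrow> \<not> init v \<phi> \<Longrightarrow> push v a \<phi> \<in> X"

lemma touch_self [simp]: "touch v v v"
  by (simp add: touch_def no_loop)

text \<open>A pair that meets both ends of an edge is that edge, and edges are excluded. Hence
  operations at adjacent vertices change disjoint sets of projections; all the commutation rules
  below rest on this.\<close>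

lemma touch_adj: "{u, v} \<in> edges \<Gamma> \<Longrightarrow> touch u x y \<Longrightarrow> \<not> touch v x y"
  using edgeD by (auto simp: touch_def insert_commute)

lemma not_init_void [simp]: "\<not> init v void"
  unfolding init_def using touch_self[of v] by blast

lemma init_push_same [simp]: "init v (push v a \<phi>)"
  by (simp add: init_def push_def)

lemma init_push_nonadj: "u \<noteq> v \<Longrightarrow> {u, v} \<notin> edges \<Gamma> \<Longrightarrow> \<not> init v (push u a \<phi>)"
proof
  assume "u \<noteq> v" "{u, v} \<notin> edges \<Gamma>" and i: "init v (push u a \<phi>)"
  then have t: "touch v u v" "touch u u v" by (simp_all add: touch_def)
  then have "fst (hd (push u a \<phi> u v)) = v" using i by (simp only: init_def)
  then show False using t \<open>u \<noteq> v\<close> by (simp add: push_def)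
qed

lemma init_push_adj: "{u, v} \<in> edges \<Gamma> \<Longrightarrow> init v (push u a \<phi>) \<longleftrightarrow> init v \<phi>"
  using touch_adj[of v u] edge_sym[of u v] by (auto simp: init_def push_def)

lemma init_pop_adj: "{u, v} \<in> edges \<Gamma> \<Longrightarrow> init v (pop u \<phi>) \<longleftrightarrow> init v \<phi>"
  using touch_adj[of v u] edge_sym[of u v] by (auto simp: init_def pop_def)

lemma pop_push [simp]: "pop v (push v a \<phi>) = \<phi>"
  by (intro ext) (simp add: push_def pop_def)

lemma push_push_adj: "{u, v} \<in> edges \<Gamma> \<Longrightarrow> push u a (push v b \<phi>) = push v b (push u a \<phi>)"
  using touch_adj by (intro ext) (auto simp: push_def)

lemma pop_push_adj: "{u, v} \<in> edges \<Gamma> \<Longrightarrow> pop u (push v b \<phi>) = push v b (pop u \<phi>)"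
  using touch_adj by (intro ext) (auto simp: push_def pop_def)

lemma hd_push [simp]: "hd (push v a \<phi> v v) = (v, a)"
  by (simp add: push_def)

lemma hd_adj: "{u, v} \<in> edges \<Gamma> \<Longrightarrow> push u a \<phi> v v = \<phi> v v" "{u, v} \<in> edges \<Gamma> \<Longrightarrow> pop u \<phi> v v = \<phi> v v"
  using touch_adj[of u v v v] by (auto simp: push_def pop_def)

text \<open>Every syllable pushed after the initial one at \<open>v\<close> sits at a neighbour of
  \<open>v\<close>, since a push at a non-neighbour would destroy \<open>init v\<close>. So the
  syllable at \<open>v\<close> can be pulled to the front through all of them.\<close>

lemma init_cases:
  "\<phi> \<in> X \<Longrightarrow> init v \<phi> \<Longrightarrow>
     \<exists>a \<psi>. \<psi> \<in> X \<and> v \<in> V \<and> a \<in> carrier (G v) \<and> a \<noteq> \<one>\<^bsub>G v\<^esub> \<and> \<not> init v \<psi> \<and> \<phi> = push v a \<psi>"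
proof (induction arbitrary: v rule: X.induct)
  case (push \<phi> u b)
  show ?case
  proof (cases "u = v")
    case False
    then have e: "{u, v} \<in> edges \<Gamma>" using push.prems init_push_nonadj by blast
    then have "init v \<phi>" using push.prems init_push_adj by blast
    then obtain a \<psi> where \<psi>: "\<psi> \<in> X" "v \<in> V" "a \<in> carrier (G v)" "a \<noteq> \<one>\<^bsub>G v\<^esub>" "\<not> init v \<psi>"
      "\<phi> = push v a \<psi>"
      using push.IH by blast
    have "\<not> init u \<psi>" using push.hyps \<psi> init_push_adj[of v u] e by (simp add: insert_commute)
    then have "push u b \<psi> \<in> X" using \<psi> push.hyps by (intro X.push)
    moreover have "\<not> init v (push u b \<psi>)" using \<psi> init_push_adj[OF e] by simp
    ultimately show ?thesis using \<psi> push_push_adj[OF e] by blast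
  qed (use push in blast)
qed simp

section \<open>Coset coordinates and the actions of the vertex groups\<close>

lemma mk_one [simp]: "mk v \<one>\<^bsub>G v\<^esub> \<phi> = \<phi>"
  by (simp add: mk_def)

lemma mk_closed [intro]:
  "\<phi> \<in> X \<Longrightarrow> v \<in> V \<Longrightarrow> a \<in> carrier (G v) \<Longrightarrow> \<not> init v \<phi> \<Longrightarrow> mk v a \<phi> \<in> X"
  by (auto simp: mk_def intro: X.push)

lemma base_mk [simp]: "\<not> init v \<phi> \<Longrightarrow> base v (mk v a \<phi>) = \<phi>"
  by (auto simp: mk_def base_def)

lemma coeff_mk [simp]: "\<not> init v \<phi> \<Longrightarrow> coeff v (mk v a \<phi>) = a"
  by (auto simp: mk_def coeff_def)

lemma base_coeff:
  assumes "\<phi> \<in> X" "v \<in> V"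
  shows "base v \<phi> \<in> X" "\<not> init v (base v \<phi>)" "coeff v \<phi> \<in> carrier (G v)"
    "mk v (coeff v \<phi>) (base v \<phi>) = \<phi>"
proof -
  have "base v \<phi> \<in> X \<and> \<not> init v (base v \<phi>) \<and> coeff v \<phi> \<in> carrier (G v) \<and>
      mk v (coeff v \<phi>) (base v \<phi>) = \<phi>"
  proof (cases "init v \<phi>")
    case True
    then show ?thesis using init_cases[OF assms(1) True] by (auto simp: base_def coeff_def mk_def)
  next
    case False
    then show ?thesis
      using assms group.is_monoid[OF group_vertex] by (simp add: base_def coeff_def monoid.one_closed)
  qed
  then show "base v \<phi> \<in> X" "\<not> init v (base v \<phi>)" "coeff v \<phi> \<in> carrier (G v)"
    "mk v (coeff v \<phi>) (base v \<phi>) = \<phi>" by auto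
qed

lemma act_mk: "\<not> init v \<phi> \<Longrightarrow> act v a (mk v b \<phi>) = mk v (a \<otimes>\<^bsub>G v\<^esub> b) \<phi>"
  by (simp add: act_def)

lemma act_closed [intro]:
  assumes "\<phi> \<in> X" "v \<in> V" "a \<in> carrier (G v)" shows "act v a \<phi> \<in> X"
  unfolding act_def using base_coeff[OF assms(1,2)] assms group.is_monoid[OF group_vertex]
  by (intro mk_closed) (auto intro: monoid.m_closed)

lemma act_not_init:
  assumes "\<phi> \<in> X" "v \<in> V" "a \<in> carrier (G v)" "\<not> init v \<phi>" shows "act v a \<phi> = mk v a \<phi>"
  using act_mk[OF assms(4), of a "\<one>\<^bsub>G v\<^esub>"] assms group.is_monoid[OF group_vertex]
  by (simp add: monoid.r_one)

lemma act_one: "\<phi> \<in> X \<Longrightarrow> v \<in> V \<Longrightarrow> act v \<one>\<^bsub>G v\<^esub> \<phi> = \<phi>"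
  using base_coeff[of \<phi> v] group.is_monoid[OF group_vertex] by (simp add: act_def monoid.l_one)

lemma act_act:
  assumes "\<phi> \<in> X" "v \<in> V" "a \<in> carrier (G v)" "b \<in> carrier (G v)"
  shows "act v a (act v b \<phi>) = act v (a \<otimes>\<^bsub>G v\<^esub> b) \<phi>"
  using base_coeff[OF assms(1,2)] act_mk[of v "base v \<phi>" a "b \<otimes>\<^bsub>G v\<^esub> coeff v \<phi>"] assms
    group.is_monoid[OF group_vertex]
  by (simp add: act_def[of v b] act_def[of v "a \<otimes>\<^bsub>G v\<^esub> b"] monoid.m_assoc)

lemma init_mk_adj: "{u, v} \<in> edges \<Gamma> \<Longrightarrow> init v (mk u a \<phi>) \<longleftrightarrow> init v \<phi>"
  by (simp add: mk_def init_push_adj)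

lemma init_act_adj: "{u, v} \<in> edges \<Gamma> \<Longrightarrow> init v (act u a \<phi>) \<longleftrightarrow> init v \<phi>"
  by (simp add: act_def init_mk_adj base_def init_pop_adj)

lemma mk_mk_adj: "{u, v} \<in> edges \<Gamma> \<Longrightarrow> mk u a (mk v b \<phi>) = mk v b (mk u a \<phi>)"
  using push_push_adj[of u v a b \<phi>] by (simp add: mk_def)

lemma coeff_mk_adj: "{u, v} \<in> edges \<Gamma> \<Longrightarrow> coeff u (mk v b \<phi>) = coeff u \<phi>"
  using edge_sym[of u v] hd_adj(1)[of v u b \<phi>] init_mk_adj[of v u b \<phi>] by (simp add: coeff_def mk_def)

lemma base_mk_adj: "{u, v} \<in> edges \<Gamma> \<Longrightarrow> base u (mk v b \<phi>) = mk v b (base u \<phi>)"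
  using edge_sym[of u v] init_mk_adj[of v u b \<phi>] by (auto simp: base_def mk_def pop_push_adj)

lemma coeff_act_adj: "{u, v} \<in> edges \<Gamma> \<Longrightarrow> coeff u (act v b \<phi>) = coeff u \<phi>"
  using edge_sym[of u v] hd_adj(2)[of v u \<phi>] init_pop_adj[of v u \<phi>]
  by (simp add: act_def coeff_mk_adj) (simp add: coeff_def base_def)

lemma act_mk_adj: "{u, v} \<in> edges \<Gamma> \<Longrightarrow> act u a (mk v b \<phi>) = mk v b (act u a \<phi>)"
  using mk_mk_adj[of u v _ b "base u \<phi>"] by (simp add: act_def coeff_mk_adj base_mk_adj)

text \<open>In the coordinates at \<open>v\<close>, the map \<open>act u a\<close> changes only the
  base and keeps \<open>v\<close> non-initial there, while \<open>act v b\<close> changes only the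
  coefficient.\<close>

lemma act_act_adj:
  assumes "{u, v} \<in> edges \<Gamma>" "\<phi> \<in> X"
  shows "act u a (act v b \<phi>) = act v b (act u a \<phi>)"
proof -
  have v: "v \<in> V" using edgeD[OF assms(1)] by simp
  let ?\<psi> = "base v \<phi>"
  have \<psi>: "\<not> init v ?\<psi>" "\<phi> = mk v (coeff v \<phi>) ?\<psi>" using base_coeff[OF assms(2) v] by simp_all
  have i: "\<not> init v (act u a ?\<psi>)" using init_act_adj[OF assms(1)] \<psi> by simp
  have "act v b (act u a \<phi>) = act v b (mk v (coeff v \<phi>) (act u a ?\<psi>))"
    using act_mk_adj[OF assms(1), of a "coeff v \<phi>" ?\<psi>] \<psi>(2) by simp
  also have "\<dots> = mk v (b \<otimes>\<^bsub>G v\<^esub> coeff v \<phi>) (act u a ?\<psi>)"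
    by (rule act_mk[OF i])
  also have "\<dots> = act u a (act v b \<phi>)"
    using act_mk_adj[OF assms(1)] by (simp add: act_def[of v b])
  finally show ?thesis by simp
qed

section \<open>The permutation action and the normal form theorem\<close>

definition wact :: "('v \<times> 'a) list \<Rightarrow> ('v \<Rightarrow> 'v \<Rightarrow> ('v \<times> 'a) list) \<Rightarrow> 'v \<Rightarrow> 'v \<Rightarrow> ('v \<times> 'a) list" where
  "wact w \<phi> = foldr (\<lambda>s. act (fst s) (snd s)) w \<phi>"

lemma wact_Nil [simp]: "wact [] \<phi> = \<phi>"
  and wact_Cons [simp]: "wact (s # w) \<phi> = act (fst s) (snd s) (wact w \<phi>)"
  and wact_append [simp]: "wact (u @ w) \<phi> = wact u (wact w \<phi>)"
  by (simp_all add: wact_def)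

lemma wact_closed [intro]: "w \<in> W \<Longrightarrow> \<phi> \<in> X \<Longrightarrow> wact w \<phi> \<in> X"
  by (induction w) auto

text \<open>Elements of \<open>Bij X\<close> are extensional, hence the restriction to
  \<open>X\<close>.\<close>

definition perm :: "'v \<Rightarrow> 'a \<Rightarrow> ('v \<Rightarrow> 'v \<Rightarrow> ('v \<times> 'a) list) \<Rightarrow> 'v \<Rightarrow> 'v \<Rightarrow> ('v \<times> 'a) list" where
  "perm v a = restrict (act v a) X"

lemma perm_Bij:
  assumes "v \<in> V" "a \<in> carrier (G v)" shows "perm v a \<in> Bij X"
proof -
  interpret Gv: group "G v" using group_vertex assms by simp
  have "bij_betw (act v a) X X"
    by (rule bij_betw_byWitness[where f' = "act v (inv\<^bsub>G v\<^esub> a)"])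
      (use assms in \<open>auto simp: act_act act_one\<close>)
  then show ?thesis by (simp add: Bij_def perm_def)
qed

lemma perm_hom:
  assumes "v \<in> V" shows "perm v \<in> hom (G v) (BijGroup X)"
proof (rule homI)
  interpret Gv: group "G v" using group_vertex assms by simp
  show "perm v a \<in> carrier (BijGroup X)" if "a \<in> carrier (G v)" for a
    using that assms perm_Bij by (simp add: BijGroup_def)
  show "perm v (a \<otimes>\<^bsub>G v\<^esub> b) = perm v a \<otimes>\<^bsub>BijGroup X\<^esub> perm v b"
    if "a \<in> carrier (G v)" "b \<in> carrier (G v)" for a b
    using that assms perm_Bij
    by (auto simp: BijGroup_def compose_def perm_def act_act act_closed intro!: restrict_ext)
qed

lemma perm_commute:
  assumes "{u, w} \<in> edges \<Gamma>" "g \<in> carrier (G u)" "h \<in> carrier (G w)"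
  shows "perm u g \<otimes>\<^bsub>BijGroup X\<^esub> perm w h = perm w h \<otimes>\<^bsub>BijGroup X\<^esub> perm u g"
  using edgeD[OF assms(1)] assms perm_Bij act_act_adj[OF assms(1)]
  by (auto simp: BijGroup_def compose_def perm_def act_closed intro!: restrict_ext)

lemma word_eval_perm: "w \<in> W \<Longrightarrow> word_eval (BijGroup X) perm w = restrict (wact w) X"
proof (induction w)
  case Nil then show ?case by (simp add: BijGroup_def restrict_def)
next
  case (Cons s w)
  have "perm (fst s) (snd s) \<in> carrier (BijGroup X)"
    using Cons perm_Bij by (simp add: BijGroup_def)
  moreover have "word_eval (BijGroup X) perm w \<in> carrier (BijGroup X)"
    using Cons perm_hom by (intro word_eval_closed group_BijGroup) auto
  ultimately have "word_eval (BijGroup X) perm (s # w) =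
      compose X (perm (fst s) (snd s)) (word_eval (BijGroup X) perm w)"
    by (simp add: BijGroup_def)
  also have "\<dots> = restrict (wact (s # w)) X"
  proof -
    have "word_eval (BijGroup X) perm w = restrict (wact w) X" and w: "w \<in> W" using Cons by auto
    then show ?thesis
      by (intro ext) (simp add: compose_def perm_def restrict_def wact_closed[OF w])
  qed
  finally show ?case .
qed

text \<open>This is van der Waerden's argument: the vertex groups act by permutations of the
  encodings and satisfy the commutation relations, so the graph product acts, and the action of a
  word depends only on its class.\<close>

lemma wact_eq:
  assumes "w \<in> W" "w' \<in> W" "pcls w = pcls w'" "\<phi> \<in> X" shows "wact w \<phi> = wact w' \<phi>"
proof -
  obtain h where "\<And>w. w \<in> W \<Longrightarrow> h (pcls w) = word_eval (BijGroup X) perm w"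
    using graph_product_universal[OF group_BijGroup perm_hom perm_commute] by blast
  then have "restrict (wact w) X = restrict (wact w') X"
    using assms by (metis word_eval_perm)
  then show ?thesis using assms by (metis restrict_apply')
qed

primrec reduced :: "('v \<times> 'a) list \<Rightarrow> bool" where
  "reduced [] \<longleftrightarrow> True"
| "reduced (s # w) \<longleftrightarrow> fst s \<in> V \<and> snd s \<in> carrier (G (fst s)) \<and> snd s \<noteq> \<one>\<^bsub>G (fst s)\<^esub> \<and>
     \<not> init (fst s) (wact w void) \<and> reduced w"

lemma reduced_words: "reduced w \<Longrightarrow> w \<in> W"
  by (induction w) auto

lemma wact_void_closed [simp]: "w \<in> W \<Longrightarrow> wact w void \<in> X"
  by (intro wact_closed X.void)

lemma wact_reduced:
  "reduced (s # w) \<Longrightarrow> wact (s # w) void = push (fst s) (snd s) (wact w void)"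
  using act_not_init[of "wact w void" "fst s" "snd s"] reduced_words by (simp add: mk_def)

text \<open>The counterpart of \<open>init_cases\<close> for words: the syllable at \<open>v\<close>
  is commuted past the neighbouring syllables in front of it, which changes the word but neither its
  class nor its being reduced.\<close>

lemma reduced_init:
  "reduced w \<Longrightarrow> init v (wact w void) \<Longrightarrow>
     \<exists>b w'. reduced ((v, b) # w') \<and> pcls w = pcls ((v, b) # w')"
proof (induction w)
  case (Cons s w)
  obtain u c where s: "s = (u, c)" by (cases s)
  show ?case
  proof (cases "u = v")
    case False
    have w: "wact (s # w) void = push u c (wact w void)" using wact_reduced[OF Cons.prems(1)] s by simp
    then have e: "{u, v} \<in> edges \<Gamma>" using Cons.prems False init_push_nonadj by metis
    then have "init v (wact w void)" using Cons.prems w init_push_adj by simp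
    then obtain b w' where w': "reduced ((v, b) # w')" "pcls w = pcls ((v, b) # w')"
      using Cons by auto
    have W: "w \<in> W" "w' \<in> W" "(v, b) # w' \<in> W" "v \<in> V" "b \<in> carrier (G v)"
      "u \<in> V" "c \<in> carrier (G u)"
      using reduced_words[OF w'(1)] reduced_words[OF Cons.prems(1)] s by auto
    have "wact w void = push v b (wact w' void)"
      using wact_eq[OF W(1,3) w'(2) X.void] wact_reduced[OF w'(1)] by simp
    then have "\<not> init u (wact w' void)"
      using Cons.prems s init_push_adj[of v u] e by (simp add: insert_commute)
    then have r: "reduced ((u, c) # w')" using Cons.prems s w' by simp
    moreover have "\<not> init v (wact ((u, c) # w') void)"
      using wact_reduced[OF r] init_push_adj[OF e] w' by simp
    ultimately have r: "reduced ((v, b) # (u, c) # w')" using w' by simp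
    have "pcls (s # w) = pcls [(u, c)] \<otimes>\<^bsub>Q\<^esub> (pcls [(v, b)] \<otimes>\<^bsub>Q\<^esub> pcls w')"
      using W w'(2) pcls_Cons[of "(u, c)" w] pcls_Cons[of "(v, b)" w'] s by simp
    also have "\<dots> = pcls [(v, b)] \<otimes>\<^bsub>Q\<^esub> (pcls [(u, c)] \<otimes>\<^bsub>Q\<^esub> pcls w')"
      using W pcls_commute[OF e] by (simp add: Q.m_assoc[symmetric])
    also have "\<dots> = pcls ((v, b) # (u, c) # w')"
      using W pcls_Cons[of "(v, b)" "(u, c) # w'"] pcls_Cons[of "(u, c)" w'] by simp
    finally show ?thesis using r by blast
  qed (use Cons s in auto)
qed simp

lemma reduced_exists: "w \<in> W \<Longrightarrow> \<exists>w'. reduced w' \<and> pcls w' = pcls w"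
proof (induction w)
  case Nil
  have "reduced []" by simp
  then show ?case by blast
next
  case (Cons s w)
  obtain v a where s: "s = (v, a)" by (cases s)
  have va: "v \<in> V" "a \<in> carrier (G v)" "w \<in> W" using Cons s by auto
  interpret Gv: group "G v" using group_vertex va by simp
  obtain w' where w': "reduced w'" "pcls w' = pcls w" using Cons by auto
  have W': "w' \<in> W" using reduced_words w' by simp
  have eq: "pcls (s # w) = pcls ((v, a) # w')"
    using va W' w' s pcls_Cons[of s w] pcls_Cons[of s w'] by simp
  show ?case
  proof (cases "init v (wact w' void)")
    case False
    show ?thesis
    proof (cases "a = \<one>\<^bsub>G v\<^esub>")
      case True
      then have "pcls (s # w) = pcls w'"
        using eq va W' pcls_Cons[of "(v, a)" w'] by (simp add: pcls_unit)
      then show ?thesis using w' by auto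
    next
      case a: False
      then have "reduced ((v, a) # w')" using False w' va by simp
      then show ?thesis using eq by metis
    qed
  next
    case True
    then obtain b w'' where r: "reduced ((v, b) # w'')" "pcls w' = pcls ((v, b) # w'')"
      using reduced_init w' by blast
    then have b: "b \<in> carrier (G v)" "w'' \<in> W" using reduced_words[OF r(1)] by auto
    have "pcls (s # w) = pcls [(v, a)] \<otimes>\<^bsub>Q\<^esub> (pcls [(v, b)] \<otimes>\<^bsub>Q\<^esub> pcls w'')"
      using eq va W' b r pcls_Cons[of "(v, a)" w'] pcls_Cons[of "(v, b)" w''] by simp
    also have "\<dots> = pcls [(v, a \<otimes>\<^bsub>G v\<^esub> b)] \<otimes>\<^bsub>Q\<^esub> pcls w''"
      using va b by (simp add: pcls_mult Q.m_assoc[symmetric])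
    finally have eq': "pcls (s # w) = pcls [(v, a \<otimes>\<^bsub>G v\<^esub> b)] \<otimes>\<^bsub>Q\<^esub> pcls w''" .
    show ?thesis
    proof (cases "a \<otimes>\<^bsub>G v\<^esub> b = \<one>\<^bsub>G v\<^esub>")
      case True
      then have "pcls w'' = pcls (s # w)" using eq' va b by (simp add: pcls_unit)
      then show ?thesis using r by auto
    next
      case False
      then have "reduced ((v, a \<otimes>\<^bsub>G v\<^esub> b) # w'')" using r va b by simp
      moreover have "pcls ((v, a \<otimes>\<^bsub>G v\<^esub> b) # w'') = pcls (s # w)"
        using eq' va b pcls_Cons[of "(v, a \<otimes>\<^bsub>G v\<^esub> b)" w''] by simp
      ultimately show ?thesis by metis
    qed
  qed
qed

text \<open>If \<open>w\<close> and \<open>w'\<close> have the same encoding, then a reduced word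
  for the quotient of the two elements acts trivially on \<open>void\<close>. A non-empty reduced
  word would leave its front syllable there, so the quotient is trivial.\<close>

lemma pcls_eq_iff:
  assumes "w \<in> W" "w' \<in> W" shows "pcls w = pcls w' \<longleftrightarrow> wact w void = wact w' void"
proof
  assume eq: "wact w void = wact w' void"
  let ?u = "word_inv w"
  have u: "?u \<in> W" using word_inv_words assms by simp
  have one: "pcls (?u @ w) = pcls []" using word_eq_inv[OF assms(1)] pcls_word_eq by blast
  obtain r where r: "reduced r" "pcls r = pcls (?u @ w')"
    using reduced_exists[of "?u @ w'"] u assms by auto
  have "wact r void = wact (?u @ w) void"
    using wact_eq[OF reduced_words[OF r(1)] _ r(2) X.void] u assms eq by simp
  also have "\<dots> = void"
    using wact_eq[OF _ _ one X.void] u assms by simp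
  finally have "wact r void = void" .
  have "r = []"
  proof (cases r)
    case (Cons s r')
    then have "push (fst s) (snd s) (wact r' void) = void"
      using wact_reduced[of s r'] r \<open>wact r void = void\<close> by simp
    then have "push (fst s) (snd s) (wact r' void) (fst s) (fst s) = []" by simp
    then show ?thesis by (simp add: push_def)
  qed
  then have "pcls (?u @ w') = pcls (?u @ w)" using r one by simp
  then have "pcls ?u \<otimes>\<^bsub>Q\<^esub> pcls w' = pcls ?u \<otimes>\<^bsub>Q\<^esub> pcls w"
    using u assms by (simp add: pcls_append)
  then show "pcls w = pcls w'" using Q.Units_l_cancel[of "pcls ?u"] u assms by simp
qed (use assms wact_eq X.void in blast)

lemma X_wact: "\<phi> \<in> X \<Longrightarrow> \<exists>w\<in>W. \<phi> = wact w void"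
proof (induction rule: X.induct)
  case void
  have "[] \<in> W" by simp
  then show ?case by (metis wact_Nil)
next
  case (push \<phi> v a)
  then obtain w where "w \<in> W" "\<phi> = wact w void" by auto
  then show ?case
    using push act_not_init[of \<phi> v a] by (intro bexI[of _ "(v, a) # w"]) (auto simp: mk_def)
qed

definition nf :: "('v \<times> 'a) list set set \<Rightarrow> 'v \<Rightarrow> 'v \<Rightarrow> ('v \<times> 'a) list" where
  "nf q = wact (SOME w. w \<in> W \<and> pcls w = q) void"

lemma nf_pcls: "w \<in> W \<Longrightarrow> nf (pcls w) = wact w void"
proof -
  assume w: "w \<in> W"
  let ?w = "SOME w'. w' \<in> W \<and> pcls w' = pcls w"
  have "?w \<in> W \<and> pcls ?w = pcls w"
    using someI[of "\<lambda>w'. w' \<in> W \<and> pcls w' = pcls w" w] w by simp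
  then show ?thesis using w wact_eq[of ?w w] X.void by (simp add: nf_def)
qed

lemma bij_nf: "bij_betw nf (carrier Q) X"
  unfolding bij_betw_def
proof
  show "inj_on nf (carrier Q)"
    by (auto simp: inj_on_def carrier_Q nf_pcls pcls_eq_iff)
  show "nf ` carrier Q = X"
  proof
    show "X \<subseteq> nf ` carrier Q"
    proof
      fix \<phi> assume "\<phi> \<in> X"
      then obtain w where "w \<in> W" "\<phi> = wact w void" using X_wact by blast
      then show "\<phi> \<in> nf ` carrier Q" by (intro image_eqI[of _ _ "pcls w"]) (auto simp: nf_pcls)
    qed
  qed (auto simp: carrier_Q nf_pcls)
qed

lemma nf_mult:
  assumes "v \<in> V" "a \<in> carrier (G v)" "q \<in> carrier Q"
  shows "nf (pcls [(v, a)] \<otimes>\<^bsub>Q\<^esub> q) = act v a (nf q)"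
proof -
  obtain w where "w \<in> W" "q = pcls w" using assms unfolding carrier_Q by blast
  then show ?thesis using assms pcls_Cons[of "(v, a)" w] by (simp add: nf_pcls flip: pcls_Cons)
qed

section \<open>Almost invariant sets of normal forms\<close>

definition almost_invariant :: "('v \<Rightarrow> 'v \<Rightarrow> ('v \<times> 'a) list) set \<Rightarrow> bool" where
  "almost_invariant A \<longleftrightarrow>
     A \<subseteq> X \<and> (\<forall>v\<in>V. \<forall>a\<in>carrier (G v). finite {\<phi> \<in> A. act v a \<phi> \<notin> A})"

text \<open>Sets are transported along the bijection \<open>nf\<close>. Almost invariance is tested
  only on vertex groups, which suffices because these generate the graph product.\<close>

lemma splits_at_infinity_iff:
  "splits_at_infinity Q \<longleftrightarrow> (\<exists>A. almost_invariant A \<and> infinite A \<and> infinite (X - A))"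
proof
  assume "splits_at_infinity Q"
  then obtain A where A: "A \<subseteq> carrier Q" "infinite A" "infinite (carrier Q - A)"
    and ai: "\<And>g. g \<in> carrier Q \<Longrightarrow> finite {x \<in> A. g \<otimes>\<^bsub>Q\<^esub> x \<notin> A}"
    unfolding splits_at_infinity_def by blast
  have inj: "inj_on nf (carrier Q)" and surj: "nf ` carrier Q = X"
    using bij_nf by (auto simp: bij_betw_def)
  have "nf ` (carrier Q - A) = X - nf ` A"
    using inj_on_image_set_diff[OF inj Diff_subset A(1)] surj A(1) inj
    by (simp add: inj_on_image_set_diff)
  then have "infinite (X - nf ` A)"
    using A(3) finite_image_iff[OF inj_on_subset[OF inj Diff_subset], of A] by metis
  moreover have "infinite (nf ` A)" using A finite_image_iff[OF inj_on_subset[OF inj]] by simp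
  moreover have "finite {\<phi> \<in> nf ` A. act v a \<phi> \<notin> nf ` A}" if va: "v \<in> V" "a \<in> carrier (G v)" for v a
  proof -
    let ?g = "pcls [(v, a)]"
    have g: "?g \<in> carrier Q" using va by simp
    have "{\<phi> \<in> nf ` A. act v a \<phi> \<notin> nf ` A} \<subseteq> nf ` {x \<in> A. ?g \<otimes>\<^bsub>Q\<^esub> x \<notin> A}"
    proof
      fix \<phi> assume "\<phi> \<in> {\<phi> \<in> nf ` A. act v a \<phi> \<notin> nf ` A}"
      then obtain x where x: "x \<in> A" "\<phi> = nf x" "act v a (nf x) \<notin> nf ` A" by blast
      have "nf (?g \<otimes>\<^bsub>Q\<^esub> x) = act v a (nf x)" using va x A(1) by (intro nf_mult) auto
      then have "?g \<otimes>\<^bsub>Q\<^esub> x \<notin> A" using x by (metis imageI)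
      then show "\<phi> \<in> nf ` {x \<in> A. ?g \<otimes>\<^bsub>Q\<^esub> x \<notin> A}" using x by blast
    qed
    then show ?thesis using ai[OF g] by (meson finite_imageI finite_subset)
  qed
  moreover have "nf ` A \<subseteq> X" using A(1) surj by blast
  ultimately show "\<exists>A. almost_invariant A \<and> infinite A \<and> infinite (X - A)"
    unfolding almost_invariant_def by (intro exI[of _ "nf ` A"]) blast
next
  assume "\<exists>A. almost_invariant A \<and> infinite A \<and> infinite (X - A)"
  then obtain A where A: "A \<subseteq> X" "infinite A" "infinite (X - A)"
    and ai: "\<And>v a. v \<in> V \<Longrightarrow> a \<in> carrier (G v) \<Longrightarrow> finite {\<phi> \<in> A. act v a \<phi> \<notin> A}"
    unfolding almost_invariant_def by blast
  have inj: "inj_on nf (carrier Q)" and surj: "nf ` carrier Q = X"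
    using bij_nf by (auto simp: bij_betw_def)
  define B where "B = {q \<in> carrier Q. nf q \<in> A}"
  have B: "B \<subseteq> carrier Q" and nfB: "nf ` B = A" and nfB': "nf ` (carrier Q - B) = X - A"
    using A(1) surj by (auto simp: B_def)
  \<comment> \<open>If \<open>x\<close> leaves \<open>B\<close> under \<open>s # w\<close>, it
    leaves under \<open>w\<close>, or \<open>w\<close> moves it to one of the finitely many elements
    that leave under \<open>s\<close>. The latter leaves finitely many \<open>x\<close>, since
    translation is injective.\<close>
  have "finite {x \<in> B. pcls w \<otimes>\<^bsub>Q\<^esub> x \<notin> B}" if "w \<in> W" for w
    using that
  proof (induction w)
    case Nil
    have "{x \<in> B. pcls [] \<otimes>\<^bsub>Q\<^esub> x \<notin> B} = {}" using B by (auto simp: pcls_Nil)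
    then show ?case by (metis finite.emptyI)
  next
    case (Cons s w)
    have va: "fst s \<in> V" "snd s \<in> carrier (G (fst s))" and w: "w \<in> W" using Cons by auto
    let ?C = "{\<phi> \<in> A. act (fst s) (snd s) \<phi> \<notin> A}"
    have "{x \<in> B. pcls (s # w) \<otimes>\<^bsub>Q\<^esub> x \<notin> B} \<subseteq>
      {x \<in> B. pcls w \<otimes>\<^bsub>Q\<^esub> x \<notin> B} \<union> {x \<in> carrier Q. nf (pcls w \<otimes>\<^bsub>Q\<^esub> x) \<in> ?C}"
    proof
      fix x assume x: "x \<in> {x \<in> B. pcls (s # w) \<otimes>\<^bsub>Q\<^esub> x \<notin> B}"
      then have xc: "x \<in> carrier Q" using B by blast
      have "pcls (s # w) \<otimes>\<^bsub>Q\<^esub> x = pcls [(fst s, snd s)] \<otimes>\<^bsub>Q\<^esub> (pcls w \<otimes>\<^bsub>Q\<^esub> x)"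
        using pcls_Cons[OF Cons.prems] va w xc by (simp add: Q.m_assoc)
      then have "nf (pcls (s # w) \<otimes>\<^bsub>Q\<^esub> x) = act (fst s) (snd s) (nf (pcls w \<otimes>\<^bsub>Q\<^esub> x))"
        using va w xc by (simp add: nf_mult del: prod.collapse)
      moreover have "pcls (s # w) \<otimes>\<^bsub>Q\<^esub> x \<in> carrier Q" using Cons.prems xc by (intro Q.m_closed) auto
      ultimately show "x \<in> {x \<in> B. pcls w \<otimes>\<^bsub>Q\<^esub> x \<notin> B} \<union> {x \<in> carrier Q. nf (pcls w \<otimes>\<^bsub>Q\<^esub> x) \<in> ?C}"
        using x xc by (simp add: B_def)
    qed
    moreover have "finite {x \<in> carrier Q. nf (pcls w \<otimes>\<^bsub>Q\<^esub> x) \<in> ?C}"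
    proof (rule finite_imageD)
      show "finite ((\<lambda>x. nf (pcls w \<otimes>\<^bsub>Q\<^esub> x)) ` {x \<in> carrier Q. nf (pcls w \<otimes>\<^bsub>Q\<^esub> x) \<in> ?C})"
        using ai[OF va] by (rule rev_finite_subset) blast
      show "inj_on (\<lambda>x. nf (pcls w \<otimes>\<^bsub>Q\<^esub> x)) {x \<in> carrier Q. nf (pcls w \<otimes>\<^bsub>Q\<^esub> x) \<in> ?C}"
        using w by (intro inj_onI) (auto dest!: inj_onD[OF inj])
    qed
    ultimately show ?case using Cons.IH[OF w] by (meson finite_UnI finite_subset)
  qed
  then have "\<forall>g\<in>carrier Q. finite {x \<in> B. g \<otimes>\<^bsub>Q\<^esub> x \<notin> B}" unfolding carrier_Q by blast
  moreover have "infinite B" "infinite (carrier Q - B)"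
    using A nfB nfB' by (metis finite_imageI)+
  ultimately show "splits_at_infinity Q" using B unfolding splits_at_infinity_def by blast
qed

end

section \<open>Amalgams of graph products\<close>

context graph_groups
begin

lemma group_graph_product: "group (graph_product \<Gamma> G)"
  unfolding graph_product_eq by (rule Q.is_group)

lemma carrier_graph_product: "carrier (graph_product \<Gamma> G) = gp_class \<Gamma> G ` W"
  unfolding graph_product_eq gp_class_eq by (rule carrier_Q)

lemma gp_class_hom: "v \<in> V \<Longrightarrow> (\<lambda>g. gp_class \<Gamma> G [(v, g)]) \<in> hom (G v) (graph_product \<Gamma> G)"
  unfolding graph_product_eq gp_class_eq by (rule pcls_hom)

lemma gp_class_commute:
  "{u, w} \<in> edges \<Gamma> \<Longrightarrow> g \<in> carrier (G u) \<Longrightarrow> h \<in> carrier (G w) \<Longrightarrow>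
     gp_class \<Gamma> G [(u, g)] \<otimes>\<^bsub>graph_product \<Gamma> G\<^esub> gp_class \<Gamma> G [(w, h)] =
     gp_class \<Gamma> G [(w, h)] \<otimes>\<^bsub>graph_product \<Gamma> G\<^esub> gp_class \<Gamma> G [(u, g)]"
  unfolding graph_product_eq gp_class_eq by (rule pcls_commute)

lemma gp_class_syllable: "v \<in> V \<Longrightarrow> g \<in> carrier (G v) \<Longrightarrow> gp_class \<Gamma> G [(v, g)] \<in> carrier (graph_product \<Gamma> G)"
  unfolding carrier_graph_product by (rule imageI) simp

end

lemma gp_hom_eq:
  assumes "graph_groups \<Gamma> G" "group H" "h \<in> hom (graph_product \<Gamma> G) H" "k \<in> hom (graph_product \<Gamma> G) H"
    and "\<And>v g. v \<in> vertices \<Gamma> \<Longrightarrow> g \<in> carrier (G v) \<Longrightarrow> h (gp_class \<Gamma> G [(v, g)]) = k (gp_class \<Gamma> G [(v, g)])"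
    and "x \<in> carrier (graph_product \<Gamma> G)"
  shows "h x = k x"
proof -
  interpret graph_groups \<Gamma> G by fact
  show ?thesis
    using assms(2-) unfolding graph_product_eq gp_class_eq by (rule hom_eq_on_generators)
qed

lemma gp_class_subgraph:
  assumes "graph_groups \<Delta> G" "graph_groups \<Gamma> G"
    and sub: "vertices \<Delta> \<subseteq> vertices \<Gamma>" "edges \<Delta> \<subseteq> edges \<Gamma>"
  obtains h where "h \<in> hom (graph_product \<Delta> G) (graph_product \<Gamma> G)"
    and "\<And>w. w \<in> words (vertices \<Delta>) G \<Longrightarrow> h (gp_class \<Delta> G w) = gp_class \<Gamma> G w"
proof -
  interpret D: graph_groups \<Delta> G by fact
  interpret graph_groups \<Gamma> G by fact
  have sub_words: "w \<in> W" if "w \<in> D.W" for w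
    using that sub(1) by (auto simp: words_def)
  have syllable: "(\<lambda>g. pcls [(v, g)]) \<in> hom (G v) Q" if "v \<in> D.V" for v
    using that sub(1) by (intro pcls_hom) auto
  have commute: "pcls [(u, g)] \<otimes>\<^bsub>Q\<^esub> pcls [(w, h)] = pcls [(w, h)] \<otimes>\<^bsub>Q\<^esub> pcls [(u, g)]"
    if "{u, w} \<in> edges \<Delta>" "g \<in> carrier (G u)" "h \<in> carrier (G w)" for u w g h
    using that sub(2) by (intro pcls_commute) auto
  obtain h where h: "h \<in> hom D.Q Q"
    and hw: "\<And>w. w \<in> D.W \<Longrightarrow> h (D.pcls w) = word_eval Q (\<lambda>v g. pcls [(v, g)]) w"
    using D.graph_product_universal[OF Q.is_group syllable commute] by blast
  show ?thesis
  proof (rule that)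
    show "h \<in> hom (graph_product \<Delta> G) (graph_product \<Gamma> G)"
      using h unfolding graph_product_eq D.graph_product_eq .
    show "h (gp_class \<Delta> G w) = gp_class \<Gamma> G w" if "w \<in> D.W" for w
      using hw[OF that] pcls_word_eval[OF sub_words[OF that]]
      unfolding gp_class_eq D.gp_class_eq by simp
  qed
qed

lemma gp_embed_gp_class:
  assumes "graph_groups \<Delta> G" "graph_groups \<Gamma> G"
    and "vertices \<Delta> \<subseteq> vertices \<Gamma>" "edges \<Delta> \<subseteq> edges \<Gamma>" and w: "w \<in> words (vertices \<Delta>) G"
  shows "gp_embed \<Delta> \<Gamma> G (gp_class \<Delta> G w) = gp_class \<Gamma> G w"
proof -
  obtain h where h: "\<And>w. w \<in> words (vertices \<Delta>) G \<Longrightarrow> h (gp_class \<Delta> G w) = gp_class \<Gamma> G w"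
    using gp_class_subgraph[OF assms(1-4)] by blast
  let ?w = "SOME w'. w' \<in> words (vertices \<Delta>) G \<and> gp_class \<Delta> G w' = gp_class \<Delta> G w"
  have "?w \<in> words (vertices \<Delta>) G \<and> gp_class \<Delta> G ?w = gp_class \<Delta> G w"
    using someI[of "\<lambda>w'. w' \<in> words (vertices \<Delta>) G \<and> gp_class \<Delta> G w' = gp_class \<Delta> G w" w] w
    by simp
  then have "gp_class \<Gamma> G ?w = gp_class \<Gamma> G w"
    using h[of ?w] h[OF w] by simp
  then show ?thesis by (simp add: gp_embed_def)
qed

text \<open>This can differ from the ambient graph in (ii), which may have edges between the two
  sides or vertices outside both.\<close>

definition graph_union :: "'v sgraph \<Rightarrow> 'v sgraph \<Rightarrow> 'v sgraph" where
  "graph_union \<Gamma>1 \<Gamma>2 =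
     \<lparr>vertices = vertices \<Gamma>1 \<union> vertices \<Gamma>2, edges = edges \<Gamma>1 \<union> edges \<Gamma>2\<rparr>"

lemma graph_groups_union:
  assumes "graph_groups \<Gamma>1 G" "graph_groups \<Gamma>2 G" shows "graph_groups (graph_union \<Gamma>1 \<Gamma>2) G"
  using assms by (fastforce simp: graph_groups_def graph_union_def simplicial_graph_def)

lemma graph_groups_inter:
  assumes "graph_groups \<Gamma>1 G" "graph_groups \<Gamma>2 G" shows "graph_groups (graph_inter \<Gamma>1 \<Gamma>2) G"
proof -
  interpret G1: graph_groups \<Gamma>1 G by fact
  interpret G2: graph_groups \<Gamma>2 G by fact
  have "\<exists>u\<in>vertices \<Gamma>1 \<inter> vertices \<Gamma>2. \<exists>w\<in>vertices \<Gamma>1 \<inter> vertices \<Gamma>2. u \<noteq> w \<and> e = {u, w}"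
    if e: "e \<in> edges \<Gamma>1" "e \<in> edges \<Gamma>2" for e
  proof -
    obtain u w where uw: "e = {u, w}" using e G1.simplicial by (auto simp: simplicial_graph_def)
    then show ?thesis using e G1.edgeD[of u w] G2.edgeD[of u w] by auto
  qed
  then show ?thesis
    using G1.finite_vertices G1.group_vertex
    by (auto simp: graph_groups_def graph_inter_def simplicial_graph_def)
qed

section \<open>The amalgam of two graph products as the graph product over the union\<close>

locale graph_amalgam = G1: graph_groups \<Gamma>1 G + G2: graph_groups \<Gamma>2 G
  for \<Gamma>1 \<Gamma>2 :: "'v sgraph" and G :: "'v \<Rightarrow> ('a, 'b) monoid_scheme"
begin

abbreviation "\<Delta> \<equiv> graph_inter \<Gamma>1 \<Gamma>2"
abbreviation "A \<equiv> graph_product \<Gamma>1 G"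
abbreviation "B \<equiv> graph_product \<Gamma>2 G"
abbreviation "C \<equiv> graph_product \<Delta> G"
abbreviation "\<alpha> \<equiv> gp_embed \<Delta> \<Gamma>1 G"
abbreviation "\<beta> \<equiv> gp_embed \<Delta> \<Gamma>2 G"
abbreviation "AB \<equiv> case_bool A B"
abbreviation "\<Upsilon> \<equiv> graph_union \<Gamma>1 \<Gamma>2"
abbreviation "rels \<equiv>
  {free_incl UNIV AB True (\<alpha> c) \<otimes>\<^bsub>free_product UNIV AB\<^esub>
     inv\<^bsub>free_product UNIV AB\<^esub> (free_incl UNIV AB False (\<beta> c)) | c. c \<in> carrier C}"

sublocale D: graph_groups \<Delta> G
  by (rule graph_groups_inter) unfold_locales

sublocale U: graph_groups \<Upsilon> G
  by (rule graph_groups_union) unfold_locales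

lemma \<alpha>_eq: "w \<in> D.W \<Longrightarrow> \<alpha> (gp_class \<Delta> G w) = gp_class \<Gamma>1 G w"
  by (rule gp_embed_gp_class[OF D.graph_groups_axioms G1.graph_groups_axioms])
    (auto simp: graph_inter_def)

lemma \<beta>_eq: "w \<in> D.W \<Longrightarrow> \<beta> (gp_class \<Delta> G w) = gp_class \<Gamma>2 G w"
  by (rule gp_embed_gp_class[OF D.graph_groups_axioms G2.graph_groups_axioms])
    (auto simp: graph_inter_def)

lemma \<alpha>_closed: "c \<in> carrier C \<Longrightarrow> \<alpha> c \<in> carrier A"
  and \<beta>_closed: "c \<in> carrier C \<Longrightarrow> \<beta> c \<in> carrier B"
  unfolding D.carrier_graph_product G1.carrier_graph_product G2.carrier_graph_product
  by (auto simp: \<alpha>_eq \<beta>_eq) (auto simp: graph_inter_def words_def)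

interpretation P: group_family UNIV AB
  by (rule group_family.intro)
    (simp add: G1.group_graph_product G2.group_graph_product split: bool.split)

lemma rels_eq: "c \<in> carrier C \<Longrightarrow>
  free_incl UNIV AB True (\<alpha> c) \<otimes>\<^bsub>P.F\<^esub> inv\<^bsub>P.F\<^esub> (free_incl UNIV AB False (\<beta> c)) =
  P.wcls [(True, \<alpha> c), (False, inv\<^bsub>B\<^esub> \<beta> c)]"
proof -
  assume c: "c \<in> carrier C"
  interpret F: group P.F by (rule P.group_free_product)
  have i: "inv\<^bsub>B\<^esub> \<beta> c \<in> carrier B"
    using c \<beta>_closed G2.group_graph_product by (simp add: group.inv_closed)
  have "P.wcls [(False, inv\<^bsub>B\<^esub> \<beta> c)] \<otimes>\<^bsub>P.F\<^esub> P.wcls [(False, \<beta> c)] = \<one>\<^bsub>P.F\<^esub>"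
    using P.word_eq_inv[of "[(False, \<beta> c)]"] c \<beta>_closed i
    by (simp add: P.word_inv_def P.mult_free_product P.one_free_product P.wcls_eq_iff)
  then have "inv\<^bsub>P.F\<^esub> P.wcls [(False, \<beta> c)] = P.wcls [(False, inv\<^bsub>B\<^esub> \<beta> c)]"
    using c \<beta>_closed i by (intro F.inv_equality) (auto simp: P.carrier_free_product)
  then show ?thesis
    using c \<alpha>_closed i by (simp add: free_incl_def P.mult_free_product)
qed

sublocale P: presented_group UNIV AB rels
proof (rule presented_group.intro[OF P.group_family_axioms presented_group_axioms.intro])
  show "rels \<subseteq> carrier P.F"
  proof
    fix r assume "r \<in> rels"
    then obtain c where c: "c \<in> carrier C" "r = P.wcls [(True, \<alpha> c), (False, inv\<^bsub>B\<^esub> \<beta> c)]"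
      using rels_eq by blast
    then have "[(True, \<alpha> c), (False, inv\<^bsub>B\<^esub> \<beta> c)] \<in> P.W"
      using \<alpha>_closed \<beta>_closed G2.group_graph_product by (simp add: group.inv_closed)
    then show "r \<in> carrier P.F" using c by (simp add: P.carrier_free_product)
  qed
qed

lemma amalgamated_product_eq: "amalgamated_product A B C \<alpha> \<beta> = P.Q"
  by (simp add: amalgamated_product_def Let_def)

lemma pcls_amalgam:
  assumes "c \<in> carrier C" shows "P.pcls [(True, \<alpha> c)] = P.pcls [(False, \<beta> c)]"
proof -
  have cl: "\<alpha> c \<in> carrier A" "\<beta> c \<in> carrier B" using assms \<alpha>_closed \<beta>_closed by auto
  have i: "inv\<^bsub>B\<^esub> \<beta> c \<in> carrier B" using cl G2.group_graph_product by (simp add: group.inv_closed)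
  have "P.pcls [(True, \<alpha> c), (False, inv\<^bsub>B\<^esub> \<beta> c)] = \<one>\<^bsub>P.Q\<^esub>"
    using assms cl i rels_eq[symmetric] by (intro P.pcls_relator) auto
  then have "P.pcls [(True, \<alpha> c)] \<otimes>\<^bsub>P.Q\<^esub> inv\<^bsub>P.Q\<^esub> P.pcls [(False, \<beta> c)] = \<one>\<^bsub>P.Q\<^esub>"
    using cl i P.pcls_Cons[of "(True, \<alpha> c)" "[(False, inv\<^bsub>B\<^esub> \<beta> c)]"] P.pcls_inv[of False "\<beta> c"] by simp
  then show ?thesis
    using cl P.Q.inv_solve_right[of "\<one>\<^bsub>P.Q\<^esub>" "P.pcls [(True, \<alpha> c)]" "P.pcls [(False, \<beta> c)]"] by simp
qed

text \<open>The image of a syllable in the amalgam. At a common vertex the first factor is chosen;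
  by the amalgamation relations the second gives the same element, as \<open>syl_2\<close>
  records.\<close>

definition syl :: "'v \<Rightarrow> 'a \<Rightarrow> (bool \<times> ('v \<times> 'a) list set set) list set set" where
  "syl v g = (if v \<in> vertices \<Gamma>1 then P.pcls [(True, gp_class \<Gamma>1 G [(v, g)])]
              else P.pcls [(False, gp_class \<Gamma>2 G [(v, g)])])"

lemma syl_2:
  assumes "v \<in> vertices \<Gamma>2" "g \<in> carrier (G v)"
  shows "syl v g = P.pcls [(False, gp_class \<Gamma>2 G [(v, g)])]"
proof (cases "v \<in> vertices \<Gamma>1")
  case True
  then have "v \<in> D.V" using assms by (simp add: graph_inter_def)
  then have w: "[(v, g)] \<in> D.W" using assms by simp
  then have "gp_class \<Delta> G [(v, g)] \<in> carrier C" unfolding D.carrier_graph_product by (rule imageI)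
  then show ?thesis using pcls_amalgam[of "gp_class \<Delta> G [(v, g)]"] True w by (simp add: \<alpha>_eq \<beta>_eq syl_def)
qed (simp add: syl_def)

lemma incl1_hom: "(\<lambda>x. P.pcls [(True, x)]) \<in> hom A P.Q"
  using P.pcls_hom[of True] by simp

lemma incl2_hom: "(\<lambda>x. P.pcls [(False, x)]) \<in> hom B P.Q"
  using P.pcls_hom[of False] by simp

lemma syl_hom: assumes "v \<in> U.V" shows "syl v \<in> hom (G v) P.Q"
proof (cases "v \<in> vertices \<Gamma>1")
  case True
  then have "syl v = (\<lambda>x. P.pcls [(True, x)]) \<circ> (\<lambda>g. gp_class \<Gamma>1 G [(v, g)])"
    by (simp add: fun_eq_iff syl_def)
  then show ?thesis using hom_compose[OF G1.gp_class_hom[OF True] incl1_hom] by simp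
next
  case False
  then have v: "v \<in> vertices \<Gamma>2" using assms by (simp add: graph_union_def)
  have "syl v = (\<lambda>x. P.pcls [(False, x)]) \<circ> (\<lambda>g. gp_class \<Gamma>2 G [(v, g)])"
    using False by (simp add: fun_eq_iff syl_def)
  then show ?thesis using hom_compose[OF G2.gp_class_hom[OF v] incl2_hom] by simp
qed

lemma syl_commute:
  assumes "{u, w} \<in> edges \<Upsilon>" "g \<in> carrier (G u)" "h \<in> carrier (G w)"
  shows "syl u g \<otimes>\<^bsub>P.Q\<^esub> syl w h = syl w h \<otimes>\<^bsub>P.Q\<^esub> syl u g"
proof -
  consider "{u, w} \<in> edges \<Gamma>1" | "{u, w} \<in> edges \<Gamma>2" using assms by (auto simp: graph_union_def)
  then show ?thesis
  proof cases
    case 1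
    note uw = G1.edgeD[OF 1]
    then show ?thesis
      using assms hom_mult[OF incl1_hom, symmetric] G1.gp_class_commute[OF 1] G1.gp_class_syllable
      by (simp add: syl_def)
  next
    case 2
    note uw = G2.edgeD[OF 2]
    then show ?thesis
      using assms hom_mult[OF incl2_hom, symmetric] G2.gp_class_commute[OF 2] G2.gp_class_syllable
      by (simp add: syl_2)
  qed
qed

text \<open>A homomorphism out of either group amounts to maps on the vertex groups that commute
  along the edges of \<Gamma>1 and of \<Gamma>2. The two universal properties give maps in both
  directions, and these are inverse to each other because they are on syllables.\<close>

lemma amalgamated_product_iso: "amalgamated_product A B C \<alpha> \<beta> \<cong> graph_product \<Upsilon> G"
proof -
  let ?U = "graph_product \<Upsilon> G"
  note gU = U.group_graph_product
  obtain \<epsilon>1 where \<epsilon>1: "\<epsilon>1 \<in> hom A ?U" "\<And>w. w \<in> G1.W \<Longrightarrow> \<epsilon>1 (gp_class \<Gamma>1 G w) = gp_class \<Upsilon> G w"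
    by (rule gp_class_subgraph[OF G1.graph_groups_axioms U.graph_groups_axioms])
      (auto simp: graph_union_def)
  obtain \<epsilon>2 where \<epsilon>2: "\<epsilon>2 \<in> hom B ?U" "\<And>w. w \<in> G2.W \<Longrightarrow> \<epsilon>2 (gp_class \<Gamma>2 G w) = gp_class \<Upsilon> G w"
    by (rule gp_class_subgraph[OF G2.graph_groups_axioms U.graph_groups_axioms])
      (auto simp: graph_union_def)
  let ?f = "case_bool \<epsilon>1 \<epsilon>2"
  have f: "?f b \<in> hom (AB b) ?U" for b using \<epsilon>1 \<epsilon>2 by (simp split: bool.split)
  have rel: "word_eval ?U ?f w = \<one>\<^bsub>?U\<^esub>" if w: "w \<in> P.W" "P.wcls w \<in> rels" for w
  proof -
    obtain c where c: "c \<in> carrier C" "P.wcls w = P.wcls [(True, \<alpha> c), (False, inv\<^bsub>B\<^esub> \<beta> c)]"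
      using w rels_eq by auto
    have cl: "\<alpha> c \<in> carrier A" "\<beta> c \<in> carrier B" "inv\<^bsub>B\<^esub> \<beta> c \<in> carrier B"
      using c(1) \<alpha>_closed \<beta>_closed G2.group_graph_product by (auto simp: group.inv_closed)
    obtain w0 where w0: "w0 \<in> D.W" "c = gp_class \<Delta> G w0" using c(1) unfolding D.carrier_graph_product by blast
    then have w012: "w0 \<in> G1.W" "w0 \<in> G2.W" by (auto simp: graph_inter_def words_def)
    have e: "\<epsilon>1 (\<alpha> c) = \<epsilon>2 (\<beta> c)" using w0 w012 by (simp add: \<alpha>_eq \<beta>_eq \<epsilon>1 \<epsilon>2)
    have i: "\<epsilon>2 (inv\<^bsub>B\<^esub> \<beta> c) = inv\<^bsub>?U\<^esub> \<epsilon>2 (\<beta> c)"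
      using cl \<epsilon>2(1) gU G2.group_graph_product
      by (intro group_hom.hom_inv) (auto simp: group_hom_def group_hom_axioms_def)
    have "(w, [(True, \<alpha> c), (False, inv\<^bsub>B\<^esub> \<beta> c)]) \<in> word_eq UNIV AB"
      using w c cl P.wcls_eq_iff[of w "[(True, \<alpha> c), (False, inv\<^bsub>B\<^esub> \<beta> c)]"] by simp
    then have "word_eval ?U ?f w = word_eval ?U ?f [(True, \<alpha> c), (False, inv\<^bsub>B\<^esub> \<beta> c)]"
      by (intro P.word_eval_word_eq[OF gU] f)
    also have "\<dots> = \<epsilon>2 (\<beta> c) \<otimes>\<^bsub>?U\<^esub> inv\<^bsub>?U\<^esub> \<epsilon>2 (\<beta> c)"
    proof -
      have "\<epsilon>2 (\<beta> c) \<in> carrier ?U" using hom_in_carrier[OF \<epsilon>2(1)] cl by simp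
      then show ?thesis using e i gU by (simp add: group.inv_closed monoid.r_one group.is_monoid)
    qed
    also have "\<dots> = \<one>\<^bsub>?U\<^esub>"
      using hom_in_carrier[OF \<epsilon>2(1)] cl gU by (simp add: group.r_inv)
    finally show ?thesis .
  qed
  obtain \<Phi> where \<Phi>: "\<Phi> \<in> hom P.Q ?U" "\<And>w. w \<in> P.W \<Longrightarrow> \<Phi> (P.pcls w) = word_eval ?U ?f w"
    using P.universal[OF gU f rel] by blast
  have \<Phi>1: "\<Phi> (P.pcls [(True, x)]) = \<epsilon>1 x" if "x \<in> carrier A" for x
    using that \<Phi>(2)[of "[(True, x)]"] hom_in_carrier[OF \<epsilon>1(1)] gU by (simp add: monoid.r_one group.is_monoid)
  have \<Phi>2: "\<Phi> (P.pcls [(False, x)]) = \<epsilon>2 x" if "x \<in> carrier B" for x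
    using that \<Phi>(2)[of "[(False, x)]"] hom_in_carrier[OF \<epsilon>2(1)] gU by (simp add: monoid.r_one group.is_monoid)
  obtain \<Psi> where \<Psi>': "\<Psi> \<in> hom U.Q P.Q" "\<And>w. w \<in> U.W \<Longrightarrow> \<Psi> (U.pcls w) = word_eval P.Q syl w"
    using U.graph_product_universal[OF P.Q.is_group syl_hom syl_commute] by blast
  have \<Psi>: "\<Psi> \<in> hom ?U P.Q" using \<Psi>'(1) unfolding U.graph_product_eq .
  have \<Psi>s: "\<Psi> (gp_class \<Upsilon> G [(v, g)]) = syl v g" if "v \<in> U.V" "g \<in> carrier (G v)" for v g
    using that \<Psi>'(2)[of "[(v, g)]"] hom_in_carrier[OF syl_hom] unfolding U.gp_class_eq by simp
  have V12: "vertices \<Gamma>1 \<subseteq> U.V" "vertices \<Gamma>2 \<subseteq> U.V" by (auto simp: graph_union_def)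
  have \<Phi>syl: "\<Phi> (syl v g) = gp_class \<Upsilon> G [(v, g)]" if v: "v \<in> U.V" and g: "g \<in> carrier (G v)" for v g
  proof (cases "v \<in> vertices \<Gamma>1")
    case True
    then show ?thesis using g G1.gp_class_syllable[OF True g] by (simp add: syl_def \<Phi>1 \<epsilon>1)
  next
    case False
    then have v2: "v \<in> vertices \<Gamma>2" using v by (simp add: graph_union_def)
    then show ?thesis using g G2.gp_class_syllable[OF v2 g] by (simp add: syl_2 \<Phi>2 \<epsilon>2)
  qed
  have \<Phi>\<Psi>: "\<Phi> (\<Psi> x) = x" if x: "x \<in> carrier ?U" for x
  proof -
    have "(\<Phi> \<circ> \<Psi>) x = id x"
    proof (rule gp_hom_eq[OF U.graph_groups_axioms gU _ _ _ x])
      show "\<Phi> \<circ> \<Psi> \<in> hom ?U ?U" by (rule hom_compose[OF \<Psi> \<Phi>(1)])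
      show "id \<in> hom ?U ?U" by (simp add: hom_def)
    qed (simp add: \<Psi>s \<Phi>syl)
    then show ?thesis by simp
  qed
  have \<Psi>\<epsilon>1: "\<Psi> (\<epsilon>1 x) = P.pcls [(True, x)]" if x: "x \<in> carrier A" for x
  proof -
    have "(\<Psi> \<circ> \<epsilon>1) x = (\<lambda>x. P.pcls [(True, x)]) x"
    proof (rule gp_hom_eq[OF G1.graph_groups_axioms P.Q.is_group _ _ _ x])
      show "\<Psi> \<circ> \<epsilon>1 \<in> hom A P.Q" by (rule hom_compose[OF \<epsilon>1(1) \<Psi>])
      show "(\<Psi> \<circ> \<epsilon>1) (gp_class \<Gamma>1 G [(v, g)]) = P.pcls [(True, gp_class \<Gamma>1 G [(v, g)])]"
        if "v \<in> vertices \<Gamma>1" "g \<in> carrier (G v)" for v g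
        using that V12 \<Psi>s[of v g] by (auto simp: \<epsilon>1 syl_def)
    qed (rule incl1_hom)
    then show ?thesis by simp
  qed
  have \<Psi>\<epsilon>2: "\<Psi> (\<epsilon>2 x) = P.pcls [(False, x)]" if x: "x \<in> carrier B" for x
  proof -
    have "(\<Psi> \<circ> \<epsilon>2) x = (\<lambda>x. P.pcls [(False, x)]) x"
    proof (rule gp_hom_eq[OF G2.graph_groups_axioms P.Q.is_group _ _ _ x])
      show "\<Psi> \<circ> \<epsilon>2 \<in> hom B P.Q" by (rule hom_compose[OF \<epsilon>2(1) \<Psi>])
      show "(\<Psi> \<circ> \<epsilon>2) (gp_class \<Gamma>2 G [(v, g)]) = P.pcls [(False, gp_class \<Gamma>2 G [(v, g)])]"
        if "v \<in> vertices \<Gamma>2" "g \<in> carrier (G v)" for v g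
        using that V12 \<Psi>s[of v g] by (auto simp: \<epsilon>2 syl_2)
    qed (rule incl2_hom)
    then show ?thesis by simp
  qed
  have \<Psi>\<Phi>: "\<Psi> (\<Phi> x) = x" if x: "x \<in> carrier P.Q" for x
  proof -
    have "(\<Psi> \<circ> \<Phi>) x = id x"
    proof (rule P.hom_eq_on_generators[OF P.Q.is_group _ _ _ x])
      show "\<Psi> \<circ> \<Phi> \<in> hom P.Q P.Q" by (rule hom_compose[OF \<Phi>(1) \<Psi>])
      show "id \<in> hom P.Q P.Q" by (simp add: hom_def)
      show "(\<Psi> \<circ> \<Phi>) (P.pcls [(b, y)]) = id (P.pcls [(b, y)])" if "y \<in> carrier (AB b)" for b y
        using that by (cases b) (simp_all add: \<Phi>1 \<Phi>2 \<Psi>\<epsilon>1 \<Psi>\<epsilon>2)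
    qed
    then show ?thesis by simp
  qed
  have "bij_betw \<Phi> (carrier P.Q) (carrier ?U)"
    by (rule bij_betw_byWitness[where f' = \<Psi>])
      (use \<Phi>\<Psi> \<Psi>\<Phi> hom_carrier[OF \<Phi>(1)] hom_carrier[OF \<Psi>] in auto)
  then have "\<Phi> \<in> iso P.Q ?U" using \<Phi>(1) by (simp add: iso_def)
  then show ?thesis unfolding amalgamated_product_eq by (auto simp: is_iso_def)
qed

end

section \<open>Almost invariant sets from splittings\<close>

context graph_groups
begin

text \<open>For non-adjacent \<open>x\<close> and \<open>y\<close> the projection interleaves
  \<open>\<phi> x x\<close> and \<open>\<phi> y y\<close>. In particular it is empty only if both
  are, and its last entry tells which of the two vertices occurs last.\<close>

lemma X_projection:
  assumes "\<phi> \<in> X" "{x, y} \<notin> edges \<Gamma>"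
  shows "filter (\<lambda>s. fst s = x) (\<phi> x y) = \<phi> x x \<and> filter (\<lambda>s. fst s = y) (\<phi> x y) = \<phi> y y \<and>
     (\<forall>s\<in>set (\<phi> x y). fst s = x \<or> fst s = y)"
  using assms by (induction rule: X.induct) (auto simp: push_def touch_def no_loop)

text \<open>Adding syllables in front does not move the last syllable outside the separating part,
  so \<open>E\<close> can be left only within one syllable of \<open>K\<close>, the elements without
  any syllable over \<open>Y \<union> Z\<close>, and \<open>K\<close> is finite. Alternating
  syllables at \<open>y\<close> and \<open>z\<close> yield infinitely many elements on either
  side.\<close>

lemma splits_at_infinity_separated:
  assumes Y: "Y \<subseteq> V" and Z: "Z \<subseteq> V" and disj: "Y \<inter> Z = {}"
    and no_edge: "\<And>u w. u \<in> Y \<Longrightarrow> w \<in> Z \<Longrightarrow> {u, w} \<notin> edges \<Gamma>"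
    and y: "y \<in> Y" "a \<in> carrier (G y)" "a \<noteq> \<one>\<^bsub>G y\<^esub>"
    and z: "z \<in> Z" "b \<in> carrier (G z)" "b \<noteq> \<one>\<^bsub>G z\<^esub>"
    and fin: "finite {\<phi> \<in> X. \<forall>v\<in>Y \<union> Z. \<phi> v v = []}"
  shows "splits_at_infinity Q"
proof -
  define K where "K = {\<phi> \<in> X. \<forall>v\<in>Y \<union> Z. \<phi> v v = []}"
  \<comment> \<open>Syllables over \<open>Y\<close> and over \<open>Z\<close> never commute, so among the syllables outside the separating
    subgraph the last one lies on a well-defined side.\<close>
  define E where "E = {\<phi> \<in> X. \<exists>u\<in>Y. \<phi> u u \<noteq> [] \<and> (\<forall>w\<in>Z. fst (last (\<phi> u w)) = u)}"
  have ne: "\<phi> u w \<noteq> []" if "\<phi> \<in> X" "u \<in> Y" "w \<in> Z" "\<phi> u u \<noteq> []" for \<phi> u w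
    using X_projection[OF that(1) no_edge[OF that(2,3)]] that(4) by auto
  have push_E: "push v c \<psi> \<in> E \<longleftrightarrow> \<psi> \<in> E"
    if \<psi>: "\<psi> \<in> X" "\<psi> \<notin> K" and v: "v \<in> V" "c \<in> carrier (G v)" "c \<noteq> \<one>\<^bsub>G v\<^esub>" "\<not> init v \<psi>" for \<psi> v c
  proof
    have X: "push v c \<psi> \<in> X" using \<psi> v by (intro X.push)
    assume "\<psi> \<in> E"
    then obtain u where u: "u \<in> Y" "\<psi> u u \<noteq> []" "\<And>w. w \<in> Z \<Longrightarrow> fst (last (\<psi> u w)) = u"
      by (auto simp: E_def)
    have "fst (last (push v c \<psi> u w)) = u" if "w \<in> Z" for w
      using u ne[OF \<psi>(1) u(1) that u(2)] that by (simp add: push_def)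
    moreover have "push v c \<psi> u u \<noteq> []" using u by (simp add: push_def)
    ultimately show "push v c \<psi> \<in> E" using X u(1) by (auto simp: E_def)
  next
    assume "push v c \<psi> \<in> E"
    then obtain u where u: "u \<in> Y" "push v c \<psi> u u \<noteq> []"
      "\<And>w. w \<in> Z \<Longrightarrow> fst (last (push v c \<psi> u w)) = u"
      by (auto simp: E_def)
    show "\<psi> \<in> E"
    proof (cases "\<psi> u u = []")
      case False
      have "fst (last (\<psi> u w)) = u" if "w \<in> Z" for w
        using u(3)[OF that] ne[OF \<psi>(1) u(1) that False] by (simp add: push_def split: if_splits)
      then show ?thesis using u(1) False \<psi>(1) by (auto simp: E_def)
    next
      case True
      \<comment> \<open>Here \<open>u\<close> occurs only as the new front syllable, and yet last
        against every vertex of \<open>Z\<close>. So \<open>\<psi>\<close> has no syllable over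
        \<open>Z\<close>, and as it lies outside \<open>K\<close> it has one over
        \<open>Y\<close>.\<close>
      have "\<psi> u w = []" if w: "w \<in> Z" for w
      proof (rule ccontr)
        assume n: "\<psi> u w \<noteq> []"
        then have "fst (last (\<psi> u w)) = u"
          using u(3)[OF w] by (simp add: push_def split: if_splits)
        then have "last (\<psi> u w) \<in> set (filter (\<lambda>s. fst s = u) (\<psi> u w))" using n by simp
        then show False using X_projection[OF \<psi>(1) no_edge[OF u(1) w]] True by simp
      qed
      then have Z0: "\<psi> w w = []" if "w \<in> Z" for w
        using X_projection[OF \<psi>(1) no_edge[OF u(1) that]] that by auto
      then obtain u' where u': "u' \<in> Y" "\<psi> u' u' \<noteq> []"
        using \<psi> by (auto simp: K_def)
      have "fst (last (\<psi> u' w)) = u'" if w: "w \<in> Z" for w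
      proof -
        have p: "filter (\<lambda>s. fst s = w) (\<psi> u' w) = []" "\<forall>s\<in>set (\<psi> u' w). fst s = u' \<or> fst s = w"
          using X_projection[OF \<psi>(1) no_edge[OF u'(1) w]] Z0[OF w] by auto
        have "last (\<psi> u' w) \<in> set (\<psi> u' w)" using ne[OF \<psi>(1) u'(1) w u'(2)] by simp
        then show ?thesis using p by (auto simp: filter_empty_conv)
      qed
      then show ?thesis using u' \<psi>(1) by (auto simp: E_def)
    qed
  qed
  have push_label: "push v c \<psi> \<in> E \<longleftrightarrow> push v d \<psi> \<in> E"
    if "\<psi> \<in> X" "v \<in> V" "\<not> init v \<psi>" "c \<in> carrier (G v)" "c \<noteq> \<one>\<^bsub>G v\<^esub>" "d \<in> carrier (G v)" "d \<noteq> \<one>\<^bsub>G v\<^esub>"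
    for v c d \<psi>
  proof -
    have "push v c \<psi> \<in> X" "push v d \<psi> \<in> X" using that by (auto intro: X.push)
    moreover have "fst (last (push v c \<psi> u w)) = fst (last (push v d \<psi> u w))" for u w
      by (simp add: push_def)
    moreover have "push v c \<psi> u u = [] \<longleftrightarrow> push v d \<psi> u u = []" for u by (simp add: push_def)
    ultimately show ?thesis by (simp add: E_def)
  qed
  have ai: "almost_invariant E"
    unfolding almost_invariant_def
  proof (intro conjI ballI)
    show "E \<subseteq> X" by (auto simp: E_def)
    fix v c assume v: "v \<in> V" and c: "c \<in> carrier (G v)"
    interpret Gv: group "G v" using group_vertex[OF v] .
    have "{\<phi> \<in> E. act v c \<phi> \<notin> E} \<subseteq> K \<union> act v (inv\<^bsub>G v\<^esub> c) ` K"
    proof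
      fix \<phi> assume \<phi>: "\<phi> \<in> {\<phi> \<in> E. act v c \<phi> \<notin> E}"
      then have X: "\<phi> \<in> X" by (simp add: E_def)
      let ?\<psi> = "base v \<phi>" and ?d = "coeff v \<phi>"
      note bc = base_coeff[OF X v]
      have act: "act v c \<phi> = mk v (c \<otimes>\<^bsub>G v\<^esub> ?d) ?\<psi>" by (simp add: act_def)
      have phi_eq: "\<phi> = act v (inv\<^bsub>G v\<^esub> c) (act v c \<phi>)"
        using X v c by (simp add: act_act act_one)
      have cd: "c \<otimes>\<^bsub>G v\<^esub> ?d \<in> carrier (G v)" using c bc by simp
      have "?\<psi> \<in> K"
      proof (rule ccontr)
        assume "?\<psi> \<notin> K"
        then have mk_E: "mk v e ?\<psi> \<in> E \<longleftrightarrow> ?\<psi> \<in> E" if "e \<in> carrier (G v)" for e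
          using push_E[OF bc(1) _ v that _ bc(2)] by (simp add: mk_def)
        show False
          using mk_E[OF bc(3)] mk_E[OF cd] \<phi> unfolding bc(4) act[symmetric] by simp
      qed
      \<comment> \<open>Two different non-trivial syllables in front of the same base give the same
        side by \<open>push_label\<close>. So at a crossing either \<open>\<phi>\<close> or its
        image is the base itself, which lies in \<open>K\<close>.\<close>
      moreover have "?d = \<one>\<^bsub>G v\<^esub> \<or> c \<otimes>\<^bsub>G v\<^esub> ?d = \<one>\<^bsub>G v\<^esub>"
      proof (rule ccontr)
        assume n: "\<not> ?thesis"
        have "\<phi> = push v ?d ?\<psi>" using bc(4) n by (simp add: mk_def)
        moreover have "act v c \<phi> = push v (c \<otimes>\<^bsub>G v\<^esub> ?d) ?\<psi>" using act n by (simp add: mk_def)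
        ultimately show False
          using push_label[OF bc(1) v bc(2), of ?d "c \<otimes>\<^bsub>G v\<^esub> ?d"] \<phi> n bc(3) cd by auto
      qed
      ultimately consider "\<phi> \<in> K" | "act v c \<phi> \<in> K"
        using bc(4) act mk_one[of v ?\<psi>] by fastforce
      then show "\<phi> \<in> K \<union> act v (inv\<^bsub>G v\<^esub> c) ` K"
        using phi_eq by cases auto
    qed
    then show "finite {\<phi> \<in> E. act v c \<phi> \<notin> E}"
      using fin unfolding K_def by (meson finite_UnI finite_imageI finite_subset)
  qed
  have not_K: "\<phi> \<notin> K" if "v \<in> Y \<union> Z" "\<phi> v v \<noteq> []" for v \<phi>
    using that unfolding K_def by blast
  \<comment> \<open>As \<open>y\<close> and \<open>z\<close> are not adjacent, the new syllables can
    neither merge nor commute. Each step makes the projection to \<open>y\<close> longer by one,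
    which tells the iterates apart, and outside \<open>K\<close> it keeps the side.\<close>
  define step where "step \<phi> = push y a (push z b \<phi>)" for \<phi>
  have yz: "y \<in> V" "z \<in> V" "{y, z} \<notin> edges \<Gamma>" "y \<noteq> z" using y z Y Z disj no_edge by auto
  have step: "step \<phi> \<in> X \<and> \<not> init z (step \<phi>) \<and> step \<phi> y y = (y, a) # \<phi> y y \<and> step \<phi> \<notin> K \<and>
      push z b \<phi> \<in> X \<and> push z b \<phi> \<notin> K \<and> (step \<phi> \<in> E \<longleftrightarrow> push z b \<phi> \<in> E)"
    if \<phi>: "\<phi> \<in> X" "\<not> init z \<phi>" for \<phi>
  proof -
    have 1: "push z b \<phi> \<in> X" using \<phi> yz z by (intro X.push)
    have 2: "\<not> init y (push z b \<phi>)" using init_push_nonadj[of z y] yz by (simp add: insert_commute)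
    have 3: "push z b \<phi> \<notin> K" using z by (intro not_K[of z]) (auto simp: push_def)
    have 4: "step \<phi> \<in> X" unfolding step_def by (rule X.push[OF 1 yz(1) y(2,3) 2])
    have 5: "step \<phi> y y = (y, a) # \<phi> y y" using yz no_loop by (simp add: step_def push_def touch_def)
    then have "step \<phi> \<notin> K" using y by (intro not_K[of y]) auto
    moreover have "\<not> init z (step \<phi>)"
      unfolding step_def using init_push_nonadj[of y z] yz by simp
    moreover have "step \<phi> \<in> E \<longleftrightarrow> push z b \<phi> \<in> E"
      unfolding step_def using push_E[OF 1 3 yz(1) y(2,3) 2] .
    ultimately show ?thesis using 1 3 4 5 by blast
  qed
  have pow: "(step ^^ n) \<phi> \<in> X \<and> \<not> init z ((step ^^ n) \<phi>) \<and> (step ^^ n) \<phi> \<notin> K \<and>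
      length ((step ^^ n) \<phi> y y) = n + length (\<phi> y y) \<and> ((step ^^ n) \<phi> \<in> E \<longleftrightarrow> \<phi> \<in> E)"
    if \<phi>: "\<phi> \<in> X" "\<not> init z \<phi>" "\<phi> \<notin> K" for \<phi> n
  proof (induction n)
    case (Suc n)
    have "push z b ((step ^^ n) \<phi>) \<in> E \<longleftrightarrow> (step ^^ n) \<phi> \<in> E"
      using push_E[of "(step ^^ n) \<phi>" z b] Suc yz z by blast
    then show ?case using step[of "(step ^^ n) \<phi>"] Suc by simp
  qed (use \<phi> in simp)
  have inf: "infinite (range (\<lambda>n. (step ^^ n) \<phi>))" if \<phi>: "\<phi> \<in> X" "\<not> init z \<phi>" "\<phi> \<notin> K" for \<phi>
  proof -
    have "inj (\<lambda>n. (step ^^ n) \<phi>)"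
    proof (rule injI)
      fix m n assume "(step ^^ m) \<phi> = (step ^^ n) \<phi>"
      then have "m + length (\<phi> y y) = n + length (\<phi> y y)" using pow[OF \<phi>] by metis
      then show "m = n" by simp
    qed
    then show ?thesis by (rule range_inj_infinite)
  qed
  moreover have "infinite E"
  proof -
    let ?\<phi> = "push y a void"
    have \<phi>: "?\<phi> \<in> X" "\<not> init z ?\<phi>"
      using yz y init_push_nonadj[of y z] not_init_void by (auto intro!: X.intros)
    have K: "?\<phi> \<notin> K" using y by (intro not_K[of y]) (auto simp: push_def)
    have "?\<phi> u u \<noteq> [] \<longleftrightarrow> u = y" for u by (auto simp: push_def touch_def no_loop)
    moreover have "fst (last (?\<phi> y w)) = y" if "w \<in> Z" for w
      using no_edge[OF y(1) that] by (simp add: push_def touch_def)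
    ultimately have "?\<phi> \<in> E" using \<phi>(1) y(1) by (auto simp: E_def)
    then have "range (\<lambda>n. (step ^^ n) ?\<phi>) \<subseteq> E" using pow[OF \<phi> K] by blast
    then show ?thesis using inf[OF \<phi> K] by (meson finite_subset)
  qed
  moreover have "infinite (X - E)"
  proof -
    \<comment> \<open>The iteration needs a starting point where \<open>z\<close> is not initial, so
      the syllable at \<open>z\<close> that decides the side is covered by one at
      \<open>y\<close>.\<close>
    let ?\<phi> = "step void"
    have s: "?\<phi> \<in> X" "\<not> init z ?\<phi>" "?\<phi> \<notin> K" and e: "?\<phi> \<in> E \<longleftrightarrow> push z b void \<in> E"
      using step[OF X.void] by auto
    have "push z b void u u = []" if "u \<in> Y" for u
      using that disj z by (auto simp: push_def touch_def)
    then have "?\<phi> \<notin> E" using e by (auto simp: E_def)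
    then have "range (\<lambda>n. (step ^^ n) ?\<phi>) \<subseteq> X - E" using pow[OF s] by blast
    then show ?thesis using inf[OF s] by (meson finite_subset)
  qed
  ultimately show ?thesis using ai unfolding splits_at_infinity_iff by blast
qed

section \<open>Direct products over complete graphs\<close>

lemma coeff_push_adj:
  assumes "{u, v} \<in> edges \<Gamma>" shows "coeff u (push v b \<phi>) = coeff u \<phi>"
  using init_push_adj[of v u b \<phi>] hd_adj(1)[of v u b \<phi>] assms edge_sym[of u v] by (simp add: coeff_def)

text \<open>Over a complete graph all syllables commute and \<open>coeff u\<close> is the coordinate
  of a direct product; the coordinates determine the element.\<close>

lemma coeff_inj:
  assumes complete: "complete_graph \<Gamma>"
  shows "\<phi> \<in> X \<Longrightarrow> \<phi>' \<in> X \<Longrightarrow> (\<And>u. u \<in> V \<Longrightarrow> coeff u \<phi> = coeff u \<phi>') \<Longrightarrow> \<phi> = \<phi>'"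
proof (induction arbitrary: \<phi>' rule: X.induct)
  case void
  show ?case
    using void.prems(1)
  proof (cases rule: X.cases)
    case (push \<psi> u a)
    then show ?thesis using void.prems(2)[of u] by (simp add: coeff_def)
  qed simp
next
  case (push \<phi> u a)
  have a: "coeff u \<phi>' = a" using push.prems(2)[of u] push.hyps by (simp add: coeff_def)
  then have "init u \<phi>'" using push.hyps by (simp add: coeff_def split: if_splits)
  then obtain a' \<psi> where \<psi>: "\<psi> \<in> X" "\<not> init u \<psi>" "\<phi>' = push u a' \<psi>"
    using init_cases push.prems(1) by blast
  then have "a' = a" using a by (simp add: coeff_def)
  moreover have "\<phi> = \<psi>"
  proof (rule push.IH[OF \<psi>(1)])
    fix w assume w: "w \<in> V"
    show "coeff w \<phi> = coeff w \<psi>"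
    proof (cases "w = u")
      case True then show ?thesis using push.hyps \<psi> by (simp add: coeff_def)
    next
      case False
      then have "{w, u} \<in> edges \<Gamma>" using complete w push.hyps by (simp add: complete_graph_def)
      then show ?thesis using push.prems(2)[OF w] \<psi> by (simp add: coeff_push_adj)
    qed
  qed
  ultimately show ?case using \<psi> by simp
qed

lemma finite_coeff:
  assumes "complete_graph \<Gamma>" and T: "\<And>u. u \<in> V \<Longrightarrow> finite (T u)"
  shows "finite {\<phi> \<in> X. \<forall>u\<in>V. coeff u \<phi> \<in> T u}"
proof (rule finite_imageD)
  let ?f = "\<lambda>\<phi>. restrict (\<lambda>u. coeff u \<phi>) V"
  show "finite (?f ` {\<phi> \<in> X. \<forall>u\<in>V. coeff u \<phi> \<in> T u})"
    by (rule finite_subset[OF _ finite_PiE[OF finite_vertices T]]) auto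
  show "inj_on ?f {\<phi> \<in> X. \<forall>u\<in>V. coeff u \<phi> \<in> T u}"
  proof (rule inj_onI)
    fix \<phi> \<psi> assume *: "\<phi> \<in> {\<phi> \<in> X. \<forall>u\<in>V. coeff u \<phi> \<in> T u}" "\<psi> \<in> {\<phi> \<in> X. \<forall>u\<in>V. coeff u \<phi> \<in> T u}"
      and eq: "?f \<phi> = ?f \<psi>"
    have "coeff u \<phi> = coeff u \<psi>" if "u \<in> V" for u using fun_cong[OF eq, of u] that by simp
    then show "\<phi> = \<psi>" using * by (intro coeff_inj[OF assms(1)]) auto
  qed
qed

lemma finite_X:
  assumes "complete_graph \<Gamma>" "\<And>u. u \<in> V \<Longrightarrow> finite (carrier (G u))" shows "finite X"
proof -
  have "X = {\<phi> \<in> X. \<forall>u\<in>V. coeff u \<phi> \<in> carrier (G u)}" using base_coeff(3) by auto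
  then show ?thesis using finite_coeff[OF assms(1), of "\<lambda>u. carrier (G u)"] assms(2) by simp
qed

lemma finite_Q_iff: "finite (carrier Q) \<longleftrightarrow> finite X"
  using bij_betw_finite[OF bij_nf] .

lemma inj_mk_void: "inj (\<lambda>b. mk v b void)"
  by (rule inj_on_inverseI[where g = "coeff v"]) simp

text \<open>The set is pulled back along the projection to \<open>G v\<close>. Its fibres are finite
  because the other factors are, so finite crossing sets stay finite; the other factors do not
  change the coordinate at \<open>v\<close>.\<close>

lemma splits_at_infinity_complete:
  assumes complete: "complete_graph \<Gamma>" and v: "v \<in> V" and "splits_at_infinity (G v)"
    and fin: "\<And>w. w \<in> V - {v} \<Longrightarrow> finite (carrier (G w))"
  shows "splits_at_infinity Q"
proof -
  obtain B where B: "B \<subseteq> carrier (G v)" "infinite B" "infinite (carrier (G v) - B)"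
    and ai: "\<And>g. g \<in> carrier (G v) \<Longrightarrow> finite {x \<in> B. g \<otimes>\<^bsub>G v\<^esub> x \<notin> B}"
    using assms(3) unfolding splits_at_infinity_def by blast
  interpret Gv: group "G v" using group_vertex[OF v] .
  define E where "E = {\<phi> \<in> X. coeff v \<phi> \<in> B}"
  have "almost_invariant E"
    unfolding almost_invariant_def
  proof (intro conjI ballI)
    show "E \<subseteq> X" by (auto simp: E_def)
    fix u a assume u: "u \<in> V" and a: "a \<in> carrier (G u)"
    show "finite {\<phi> \<in> E. act u a \<phi> \<notin> E}"
    proof (cases "u = v")
      case True
      let ?T = "\<lambda>w. if w = v then {x \<in> B. a \<otimes>\<^bsub>G v\<^esub> x \<notin> B} else carrier (G w)"
      have "{\<phi> \<in> E. act u a \<phi> \<notin> E} \<subseteq> {\<phi> \<in> X. \<forall>w\<in>V. coeff w \<phi> \<in> ?T w}"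
      proof
        fix \<phi> assume \<phi>: "\<phi> \<in> {\<phi> \<in> E. act u a \<phi> \<notin> E}"
        then have X: "\<phi> \<in> X" by (simp add: E_def)
        then have "coeff v (act v a \<phi>) = a \<otimes>\<^bsub>G v\<^esub> coeff v \<phi>"
          using base_coeff[OF X v] by (simp add: act_def)
        moreover have "act v a \<phi> \<in> X" using X u a True by auto
        ultimately show "\<phi> \<in> {\<phi> \<in> X. \<forall>w\<in>V. coeff w \<phi> \<in> ?T w}"
          using \<phi> True base_coeff(3)[OF X] by (auto simp: E_def)
      qed
      moreover have "finite {\<phi> \<in> X. \<forall>w\<in>V. coeff w \<phi> \<in> ?T w}"
        using ai a True fin by (intro finite_coeff complete) auto
      ultimately show ?thesis by (rule finite_subset)
    next
      case False
      then have "{v, u} \<in> edges \<Gamma>" using complete v u by (simp add: complete_graph_def)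
      then have "{\<phi> \<in> E. act u a \<phi> \<notin> E} = {}"
        using u a by (auto simp: E_def coeff_act_adj)
      then show ?thesis by (metis finite.emptyI)
    qed
  qed
  moreover have sub: "(\<lambda>b. mk v b void) ` B \<subseteq> E" "(\<lambda>b. mk v b void) ` (carrier (G v) - B) \<subseteq> X - E"
    using B(1) v by (auto simp: E_def intro!: mk_closed X.void)
  have "infinite ((\<lambda>b. mk v b void) ` T)" if "infinite T" for T
    using that finite_imageD[OF _ inj_on_subset[OF inj_mk_void]] by blast
  then have "infinite E" "infinite (X - E)"
    using B sub by (meson finite_subset)+
  ultimately show ?thesis unfolding splits_at_infinity_iff by blast
qed

end

section \<open>Complete graphs\<close>

locale fg_graph_groups = graph_groups \<Gamma> G
  for \<Gamma> :: "'v sgraph" and G :: "'v \<Rightarrow> ('a, 'b) monoid_scheme" +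
  assumes fg_vertex: "v \<in> vertices \<Gamma> \<Longrightarrow> finitely_generated_group (G v)"
    and nontrivial_vertex: "v \<in> vertices \<Gamma> \<Longrightarrow> carrier (G v) \<noteq> {\<one>\<^bsub>G v\<^esub>}"
begin

lemma ex_nontrivial: assumes "v \<in> V" shows "\<exists>a\<in>carrier (G v). a \<noteq> \<one>\<^bsub>G v\<^esub>"
proof -
  have "\<one>\<^bsub>G v\<^esub> \<in> carrier (G v)"
    using group_vertex[OF assms] by (simp add: group.is_monoid monoid.one_closed)
  then show ?thesis using nontrivial_vertex[OF assms] by auto
qed

text \<open>If \<open>\<not> init v \<psi>\<close>, the elements \<open>mk v a \<psi>\<close> form the coset of the vertex group \<open>G v\<close> with shortest
  element \<open>\<psi>\<close>.\<close>

definition bad :: "('v \<Rightarrow> 'v \<Rightarrow> ('v \<times> 'a) list) set \<Rightarrow> 'v \<Rightarrow> ('v \<Rightarrow> 'v \<Rightarrow> ('v \<times> 'a) list) set" where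
  "bad A v = {\<psi> \<in> X. \<not> init v \<psi> \<and>
     (\<exists>a\<in>carrier (G v). \<exists>b\<in>carrier (G v). (mk v a \<psi> \<in> A) \<noteq> (mk v b \<psi> \<in> A))}"

text \<open>For a finite vertex group both values qualify; the notion carries information only along
  infinite cosets, where \<open>almost_unique\<close> makes the value unique.\<close>

definition almost :: "('v \<Rightarrow> 'v \<Rightarrow> ('v \<times> 'a) list) set \<Rightarrow> 'v \<Rightarrow> ('v \<Rightarrow> 'v \<Rightarrow> ('v \<times> 'a) list) \<Rightarrow> bool \<Rightarrow> bool" where
  "almost A v \<psi> \<kappa> \<longleftrightarrow> finite {a \<in> carrier (G v). (mk v a \<psi> \<in> A) \<noteq> \<kappa>}"

lemma not_bad:
  "\<psi> \<notin> bad A v \<Longrightarrow> \<psi> \<in> X \<Longrightarrow> \<not> init v \<psi> \<Longrightarrow> a \<in> carrier (G v) \<Longrightarrow> b \<in> carrier (G v) \<Longrightarrow>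
     mk v a \<psi> \<in> A \<longleftrightarrow> mk v b \<psi> \<in> A"
  unfolding bad_def by blast

text \<open>A coset on which \<open>A\<close> is not constant contains an element that leaves
  \<open>A\<close> under one of finitely many generators or their inverses. There are finitely many
  such elements, and each determines its coset through \<open>base v\<close>.\<close>

lemma finite_bad:
  assumes A: "almost_invariant A" and v: "v \<in> V"
  shows "finite (bad A v)"
proof -
  interpret Gv: group "G v" using group_vertex[OF v] .
  obtain S where S: "finite S" "S \<subseteq> carrier (G v)" "generate (G v) S = carrier (G v)"
    using fg_vertex[OF v] unfolding finitely_generated_group_def finite_generating_set_def by blast
  define D where "D = (\<Union>s\<in>S. {\<phi> \<in> A. act v s \<phi> \<notin> A} \<union> {\<phi> \<in> A. act v (inv\<^bsub>G v\<^esub> s) \<phi> \<notin> A})"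
  have "finite {\<phi> \<in> A. act v s \<phi> \<notin> A}" if "s \<in> carrier (G v)" for s
    using A v that unfolding almost_invariant_def by blast
  then have "finite D" unfolding D_def using S by auto
  moreover have "bad A v \<subseteq> base v ` D"
  proof (rule subsetI, rule ccontr)
    fix \<psi> assume \<psi>: "\<psi> \<in> bad A v" and n: "\<psi> \<notin> base v ` D"
    then have i: "\<not> init v \<psi>" by (simp add: bad_def)
    have nD: "mk v a \<psi> \<notin> D" for a
      using n base_mk[OF i, of a] by (metis imageI)
    have gen: "mk v a \<psi> \<in> A \<Longrightarrow> mk v (h \<otimes>\<^bsub>G v\<^esub> a) \<psi> \<in> A"
      if "h \<in> generate (G v) S" "a \<in> carrier (G v)" for h a
      using that
    proof (induction arbitrary: a rule: generate.induct)
      case (incl h) then show ?case using nD[of a] act_mk[OF i, of h a] by (auto simp: D_def)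
    next
      case (inv h) then show ?case using nD[of a] act_mk[OF i, of "inv\<^bsub>G v\<^esub> h" a] by (auto simp: D_def)
    next
      case (eng h1 h2)
      have h: "h1 \<in> carrier (G v)" "h2 \<in> carrier (G v)" using eng.hyps S(3) by auto
      have "mk v (h1 \<otimes>\<^bsub>G v\<^esub> (h2 \<otimes>\<^bsub>G v\<^esub> a)) \<psi> \<in> A"
        using eng h by (intro eng.IH(1)) auto
      then show ?case using h eng.prems by (simp add: Gv.m_assoc)
    qed simp
    have imp: "mk v b \<psi> \<in> A"
      if "mk v a \<psi> \<in> A" and ab: "a \<in> carrier (G v)" "b \<in> carrier (G v)" for a b
      using gen[of "b \<otimes>\<^bsub>G v\<^esub> inv\<^bsub>G v\<^esub> a" a] that S(3) by (simp add: Gv.m_assoc)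
    obtain a b where "a \<in> carrier (G v)" "b \<in> carrier (G v)" "(mk v a \<psi> \<in> A) \<noteq> (mk v b \<psi> \<in> A)"
      using \<psi> unfolding bad_def by blast
    then show False using imp[of a b] imp[of b a] by blast
  qed
  ultimately show ?thesis by (meson finite_imageI finite_subset)
qed

lemma inj_mk: "\<not> init v \<psi> \<Longrightarrow> inj (\<lambda>a. mk v a \<psi>)"
  by (rule inj_on_inverseI[where g = "coeff v"]) simp

lemma finite_mk: "\<not> init v \<psi> \<Longrightarrow> finite T \<Longrightarrow> finite {a \<in> carrier (G v). mk v a \<psi> \<in> T}"
  using finite_vimageI[OF _ inj_mk, of T v \<psi>] by (rule rev_finite_subset) auto

lemma almost_unique:
  assumes "infinite (carrier (G v))" "almost A v \<psi> \<kappa>" "almost A v \<psi> \<kappa>'" shows "\<kappa> = \<kappa>'"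
proof (rule ccontr)
  assume "\<kappa> \<noteq> \<kappa>'"
  then have "carrier (G v) \<subseteq>
      {a \<in> carrier (G v). (mk v a \<psi> \<in> A) \<noteq> \<kappa>} \<union> {a \<in> carrier (G v). (mk v a \<psi> \<in> A) \<noteq> \<kappa>'}"
    by auto
  then show False using assms unfolding almost_def by (meson finite_UnI finite_subset)
qed

lemma almost_pick:
  assumes "infinite (carrier (G v))" "almost A v \<psi> \<kappa>" "finite T"
  obtains a where "a \<in> carrier (G v)" "(mk v a \<psi> \<in> A) = \<kappa>" "a \<notin> T"
proof -
  have "infinite (carrier (G v) - ({a \<in> carrier (G v). (mk v a \<psi> \<in> A) \<noteq> \<kappa>} \<union> T))"
    using assms by (simp add: almost_def)
  from infinite_imp_nonempty[OF this] show ?thesis using that by blast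
qed

text \<open>The coset of \<open>G u\<close> times \<open>G v\<close> is a grid, and all but finitely
  many rows and columns are constant. Choose a constant column \<open>x\<close> with value
  \<open>\<kappa>\<close> in row \<open>b\<close>, and a constant row \<open>y\<close> with value
  \<open>\<kappa>'\<close> in column \<open>a\<close>; the point where they meet has both
  values.\<close>

lemma almost_grid:
  assumes A: "almost_invariant A" and e: "{u, v} \<in> edges \<Gamma>"
    and inf: "infinite (carrier (G u))" "infinite (carrier (G v))"
    and \<psi>: "\<psi> \<in> X" "\<not> init u \<psi>" "\<not> init v \<psi>"
    and a: "a \<in> carrier (G u)" "b \<in> carrier (G v)"
    and \<kappa>: "almost A u (mk v b \<psi>) \<kappa>" "almost A v (mk u a \<psi>) \<kappa>'"
  shows "\<kappa> = \<kappa>'"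
proof -
  have uv: "u \<in> V" "v \<in> V" using edgeD[OF e] by auto
  have fin: "finite {x \<in> carrier (G u). mk u x \<psi> \<in> bad A v}" "finite {y \<in> carrier (G v). mk v y \<psi> \<in> bad A u}"
    using finite_mk \<psi> finite_bad[OF A] uv by blast+
  obtain x where x: "x \<in> carrier (G u)" "(mk u x (mk v b \<psi>) \<in> A) = \<kappa>" "mk u x \<psi> \<notin> bad A v"
    using almost_pick[OF inf(1) \<kappa>(1) fin(1)] by blast
  obtain y where y: "y \<in> carrier (G v)" "(mk v y (mk u a \<psi>) \<in> A) = \<kappa>'" "mk v y \<psi> \<notin> bad A u"
    using almost_pick[OF inf(2) \<kappa>(2) fin(2)] by blast
  have e': "{v, u} \<in> edges \<Gamma>" using e edge_sym by simp
  have "mk v y (mk u x \<psi>) \<in> A \<longleftrightarrow> mk v b (mk u x \<psi>) \<in> A"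
    using x y a \<psi> uv init_mk_adj[OF e] by (intro not_bad) auto
  moreover have "mk u x (mk v y \<psi>) \<in> A \<longleftrightarrow> mk u a (mk v y \<psi>) \<in> A"
    using x y a \<psi> uv init_mk_adj[OF e'] by (intro not_bad) auto
  ultimately show ?thesis
    using x(2) y(2) by (simp only: mk_mk_adj[OF e])
qed

text \<open>In the grid of \<open>G u\<close> and \<open>G v\<close>, infinitely many choices in
  \<open>G u\<close> leave room for a constant coset of \<open>G v\<close>, at \<open>x\<close>.
  Wherever the coset of \<open>\<psi>\<close> deviates from that constant, the crossing coset of
  \<open>G u\<close> takes two values, hence is one of the finitely many bad ones.\<close>

lemma ex_almost_two_infinite:
  assumes A: "almost_invariant A" and e: "{u, v} \<in> edges \<Gamma>"
    and inf: "infinite (carrier (G u))"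
    and \<psi>: "\<psi> \<in> X" "\<not> init v \<psi>"
  shows "\<exists>\<kappa>. almost A v \<psi> \<kappa>"
proof -
  have uv: "u \<in> V" "v \<in> V" using edgeD[OF e] by auto
  have e': "{v, u} \<in> edges \<Gamma>" using e edge_sym by simp
  let ?\<psi> = "base u \<psi>" and ?a = "coeff u \<psi>"
  note bc = base_coeff[OF \<psi>(1) uv(1)]
  have i: "\<not> init v ?\<psi>" using \<psi>(2) init_mk_adj[OF e, of ?a ?\<psi>] bc(4) by simp
  have "finite {x \<in> carrier (G u). mk u x ?\<psi> \<in> bad A v}"
    using finite_mk[OF bc(2)] finite_bad[OF A uv(2)] by blast
  then have "infinite (carrier (G u) - {x \<in> carrier (G u). mk u x ?\<psi> \<in> bad A v})" using inf by simp
  from infinite_imp_nonempty[OF this] obtain x where x: "x \<in> carrier (G u)" "mk u x ?\<psi> \<notin> bad A v"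
    by blast
  have one: "\<one>\<^bsub>G v\<^esub> \<in> carrier (G v)"
    using group_vertex[OF uv(2)] by (simp add: group.is_monoid monoid.one_closed)
  have "mk v y ?\<psi> \<in> bad A u"
    if y: "y \<in> carrier (G v)" "(mk v y \<psi> \<in> A) \<noteq> (mk u x ?\<psi> \<in> A)" for y
  proof (rule ccontr)
    assume "mk v y ?\<psi> \<notin> bad A u"
    then have "mk u ?a (mk v y ?\<psi>) \<in> A \<longleftrightarrow> mk u x (mk v y ?\<psi>) \<in> A"
      using x y bc i uv init_mk_adj[OF e'] by (intro not_bad) auto
    moreover have "mk v y (mk u x ?\<psi>) \<in> A \<longleftrightarrow> mk v \<one>\<^bsub>G v\<^esub> (mk u x ?\<psi>) \<in> A"
      using x y bc i uv one init_mk_adj[OF e] by (intro not_bad) auto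
    ultimately show False using y(2) bc(4) by (simp add: mk_mk_adj[OF e])
  qed
  then have "{y \<in> carrier (G v). (mk v y \<psi> \<in> A) \<noteq> (mk u x ?\<psi> \<in> A)} \<subseteq>
      {y \<in> carrier (G v). mk v y ?\<psi> \<in> bad A u}" by blast
  moreover have "finite {y \<in> carrier (G v). mk v y ?\<psi> \<in> bad A u}"
    using finite_mk[OF i] finite_bad[OF A uv(1)] by blast
  ultimately show ?thesis unfolding almost_def by (meson finite_subset)
qed

text \<open>Almost invariance speaks of elements that leave \<open>A\<close>. Those that enter it
  under \<open>a\<close> are the translates of those that leave it under the inverse of
  \<open>a\<close>.\<close>

lemma almost_invariant_act:
  assumes A: "almost_invariant A" and v: "v \<in> V" and a: "a \<in> carrier (G v)"
  shows "finite {\<phi> \<in> X. (\<phi> \<in> A) \<noteq> (act v a \<phi> \<in> A)}"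
proof -
  interpret Gv: group "G v" using group_vertex[OF v] .
  have fin: "finite {\<phi> \<in> A. act v b \<phi> \<notin> A}" if "b \<in> carrier (G v)" for b
    using A v that unfolding almost_invariant_def by blast
  have "{\<phi> \<in> X. (\<phi> \<in> A) \<noteq> (act v a \<phi> \<in> A)} \<subseteq>
      {\<phi> \<in> A. act v a \<phi> \<notin> A} \<union> act v (inv\<^bsub>G v\<^esub> a) ` {\<phi> \<in> A. act v (inv\<^bsub>G v\<^esub> a) \<phi> \<notin> A}"
  proof
    fix \<phi> assume \<phi>: "\<phi> \<in> {\<phi> \<in> X. (\<phi> \<in> A) \<noteq> (act v a \<phi> \<in> A)}"
    then have "act v (inv\<^bsub>G v\<^esub> a) (act v a \<phi>) = \<phi>" using v a by (simp add: act_act act_one)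
    then show "\<phi> \<in> {\<phi> \<in> A. act v a \<phi> \<notin> A} \<union>
        act v (inv\<^bsub>G v\<^esub> a) ` {\<phi> \<in> A. act v (inv\<^bsub>G v\<^esub> a) \<phi> \<notin> A}"
      using \<phi> by (cases "\<phi> \<in> A") (auto intro!: rev_image_eqI[of "act v a \<phi>"])
  qed
  then show ?thesis using fin[OF a] fin[OF Gv.inv_closed[OF a]] by (meson finite_UnI finite_imageI finite_subset)
qed

text \<open>A syllable at another vertex commutes with \<open>G v\<close> and maps one coset of it
  pointwise to another, changing membership in \<open>A\<close> finitely often; so all cosets have
  the same value \<open>\<kappa>\<close>. Exceptions to \<open>\<kappa>\<close> occur only in the
  finitely many bad cosets, finitely many in each.\<close>

lemma finite_or_cofinite_complete:
  assumes A: "almost_invariant A" and complete: "complete_graph \<Gamma>"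
    and v: "v \<in> V" "infinite (carrier (G v))"
    and ex: "\<And>\<psi>. \<psi> \<in> X \<Longrightarrow> \<not> init v \<psi> \<Longrightarrow> \<exists>\<kappa>. almost A v \<psi> \<kappa>"
  shows "finite A \<or> finite (X - A)"
proof -
  obtain \<kappa> where \<kappa>: "almost A v void \<kappa>" using ex[OF X.void] by auto
  have const: "almost A v \<psi> \<kappa>" if "\<psi> \<in> X" "\<not> init v \<psi>" for \<psi>
    using that
  proof (induction rule: X.induct)
    case (push \<psi> w d)
    have "w \<noteq> v" using push.prems by auto
    then have e: "{w, v} \<in> edges \<Gamma>" using complete push.hyps v by (simp add: complete_graph_def)
    then have i: "\<not> init v \<psi>" using push.prems init_push_adj by simp
    have X: "push w d \<psi> \<in> X" using push.hyps by (intro X.push)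
    obtain \<kappa>' where \<kappa>': "almost A v (push w d \<psi>) \<kappa>'" using ex[OF X push.prems] by auto
    have "\<kappa>' = \<kappa>"
    proof (rule ccontr)
      assume ne: "\<kappa>' \<noteq> \<kappa>"
      have act: "act w d (mk v a \<psi>) = mk v a (push w d \<psi>)" for a
        using act_mk_adj[OF e] act_not_init[of \<psi> w d] push.hyps by (simp add: mk_def)
      let ?T = "{\<phi> \<in> X. (\<phi> \<in> A) \<noteq> (act w d \<phi> \<in> A)}"
      have "carrier (G v) \<subseteq> {a \<in> carrier (G v). (mk v a \<psi> \<in> A) \<noteq> \<kappa>} \<union>
          {a \<in> carrier (G v). (mk v a (push w d \<psi>) \<in> A) \<noteq> \<kappa>'} \<union>
          {a \<in> carrier (G v). mk v a \<psi> \<in> ?T}"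
        using ne push.hyps(1) v(1) i by (auto simp: act)
      moreover have "finite {a \<in> carrier (G v). mk v a \<psi> \<in> ?T}"
        using push.hyps by (intro finite_mk[OF i] almost_invariant_act[OF A])
      ultimately show False
        using v(2) push.IH[OF i] \<kappa>' unfolding almost_def by (meson finite_UnI finite_subset)
    qed
    then show ?case using \<kappa>' by simp
  qed (rule \<kappa>)
  have "{\<phi> \<in> X. (\<phi> \<in> A) \<noteq> \<kappa>} \<subseteq>
      (\<Union>\<psi>\<in>bad A v. (\<lambda>a. mk v a \<psi>) ` {a \<in> carrier (G v). (mk v a \<psi> \<in> A) \<noteq> \<kappa>})"
  proof
    fix \<phi> assume \<phi>: "\<phi> \<in> {\<phi> \<in> X. (\<phi> \<in> A) \<noteq> \<kappa>}"
    then have X: "\<phi> \<in> X" by simp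
    note bc = base_coeff[OF X v(1)]
    have "base v \<phi> \<in> bad A v"
    proof (rule ccontr)
      assume "base v \<phi> \<notin> bad A v"
      then have "(mk v a (base v \<phi>) \<in> A) \<noteq> \<kappa>" if "a \<in> carrier (G v)" for a
        using not_bad[OF _ bc(1,2) that bc(3)] bc(4) \<phi> by simp
      then have "carrier (G v) \<subseteq> {a \<in> carrier (G v). (mk v a (base v \<phi>) \<in> A) \<noteq> \<kappa>}" by blast
      then show False using const[OF bc(1,2)] v(2) unfolding almost_def by (meson finite_subset)
    qed
    moreover have "\<phi> \<in> (\<lambda>a. mk v a (base v \<phi>)) ` {a \<in> carrier (G v). (mk v a (base v \<phi>) \<in> A) \<noteq> \<kappa>}"
      using bc \<phi> by (intro image_eqI[of _ _ "coeff v \<phi>"]) auto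
    ultimately show "\<phi> \<in> (\<Union>\<psi>\<in>bad A v. (\<lambda>a. mk v a \<psi>) ` {a \<in> carrier (G v). (mk v a \<psi> \<in> A) \<noteq> \<kappa>})"
      by blast
  qed
  moreover have "finite (\<Union>\<psi>\<in>bad A v. (\<lambda>a. mk v a \<psi>) ` {a \<in> carrier (G v). (mk v a \<psi> \<in> A) \<noteq> \<kappa>})"
  proof (intro finite_UN_I finite_bad[OF A v(1)] finite_imageI)
    fix \<psi> assume "\<psi> \<in> bad A v"
    then show "finite {a \<in> carrier (G v). (mk v a \<psi> \<in> A) \<noteq> \<kappa>}"
      using const unfolding almost_def bad_def by blast
  qed
  ultimately have fin: "finite {\<phi> \<in> X. (\<phi> \<in> A) \<noteq> \<kappa>}" by (rule finite_subset)
  have "A \<subseteq> X" using A by (simp add: almost_invariant_def)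
  show ?thesis
  proof (cases \<kappa>)
    case True
    then have eq: "{\<phi> \<in> X. (\<phi> \<in> A) \<noteq> \<kappa>} = X - A" by auto
    show ?thesis using fin unfolding eq by simp
  next
    case False
    then have eq: "{\<phi> \<in> X. (\<phi> \<in> A) \<noteq> \<kappa>} = A" using \<open>A \<subseteq> X\<close> by auto
    show ?thesis using fin unfolding eq by simp
  qed
qed

text \<open>Some vertex group is infinite, for otherwise \<open>X\<close> would be finite. If
  another one were infinite too, or if \<open>G v\<close> did not split, \<open>A\<close> would be
  almost constant on every coset of \<open>G v\<close>, contradicting
  \<open>finite_or_cofinite_complete\<close>.\<close>

lemma splits_complete_imp:
  assumes splits: "splits_at_infinity Q" and complete: "complete_graph \<Gamma>"
  shows "\<exists>v\<in>V. splits_at_infinity (G v) \<and> (\<forall>w\<in>V - {v}. finite (carrier (G w)))"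
proof -
  obtain A where A: "almost_invariant A" "infinite A" "infinite (X - A)"
    using splits unfolding splits_at_infinity_iff by blast
  have "A \<subseteq> X" using A by (simp add: almost_invariant_def)
  then have "infinite X" using A by (meson finite_subset)
  then obtain v where v: "v \<in> V" "infinite (carrier (G v))" using finite_X[OF complete] by blast
  have others: "finite (carrier (G w))" if w: "w \<in> V - {v}" for w
  proof (rule ccontr)
    assume inf: "infinite (carrier (G w))"
    have e: "{w, v} \<in> edges \<Gamma>" using complete w v by (simp add: complete_graph_def)
    show False
      using finite_or_cofinite_complete[OF A(1) complete v ex_almost_two_infinite[OF A(1) e inf]] A by blast
  qed
  interpret Gv: group "G v" using group_vertex[OF v(1)] .
  have "splits_at_infinity (G v)"
  proof (rule ccontr)
    assume ns: "\<not> splits_at_infinity (G v)"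
    have "\<exists>\<kappa>. almost A v \<psi> \<kappa>" if \<psi>: "\<psi> \<in> X" "\<not> init v \<psi>" for \<psi>
    proof -
      let ?B = "{a \<in> carrier (G v). mk v a \<psi> \<in> A}"
      have inv: "finite {a \<in> ?B. g \<otimes>\<^bsub>G v\<^esub> a \<notin> ?B}" if g: "g \<in> carrier (G v)" for g
      proof -
        have "{a \<in> ?B. g \<otimes>\<^bsub>G v\<^esub> a \<notin> ?B} \<subseteq>
            {a \<in> carrier (G v). mk v a \<psi> \<in> {\<phi> \<in> A. act v g \<phi> \<notin> A}}"
          using g by (auto simp: act_mk[OF \<psi>(2)])
        moreover have "finite {\<phi> \<in> A. act v g \<phi> \<notin> A}"
          using A(1) v(1) g unfolding almost_invariant_def by blast
        ultimately show ?thesis using finite_mk[OF \<psi>(2)] by (meson finite_subset)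
      qed
      have "finite ?B \<or> finite (carrier (G v) - ?B)"
      proof (rule ccontr)
        assume n: "\<not> ?thesis"
        have "splits_at_infinity (G v)"
          unfolding splits_at_infinity_def
        proof (intro exI[of _ ?B] conjI ballI)
          show "infinite ?B" "infinite (carrier (G v) - ?B)" using n by blast+
        qed (use inv in blast)+
        with ns show False by blast
      qed
      moreover have "?B = {a \<in> carrier (G v). (mk v a \<psi> \<in> A) \<noteq> False}" by simp
      moreover have "carrier (G v) - ?B = {a \<in> carrier (G v). (mk v a \<psi> \<in> A) \<noteq> True}" by auto
      ultimately have "almost A v \<psi> False \<or> almost A v \<psi> True"
        unfolding almost_def by (simp only:)
      then show ?thesis by blast
    qed
    then show False using finite_or_cofinite_complete[OF A(1) complete v] A by blast
  qed
  then show ?thesis using v others by blast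
qed

end

section \<open>Graphs that are not complete\<close>

context fg_graph_groups
begin

text \<open>For empty \<open>\<sigma>\<close> this is connectedness of \<Gamma>. Partitions without
  edges between the parts stand in for connected components, because the parts arise as level sets
  of a two-valued function.\<close>

definition unseparated :: bool where
  "unseparated \<longleftrightarrow>
     (\<forall>\<sigma> Y Z. \<sigma> \<subseteq> V \<longrightarrow> (\<forall>u\<in>\<sigma>. \<forall>w\<in>\<sigma>. u \<noteq> w \<longrightarrow> {u, w} \<in> edges \<Gamma>) \<longrightarrow>
        (\<forall>v\<in>\<sigma>. finite (carrier (G v))) \<longrightarrow> Y \<union> Z = V - \<sigma> \<longrightarrow> Y \<inter> Z = {} \<longrightarrow>
        (\<forall>u\<in>Y. \<forall>w\<in>Z. {u, w} \<notin> edges \<Gamma>) \<longrightarrow> Y = {} \<or> Z = {})"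

lemma unseparatedD:
  assumes "unseparated" "\<sigma> \<subseteq> V" "\<And>u w. u \<in> \<sigma> \<Longrightarrow> w \<in> \<sigma> \<Longrightarrow> u \<noteq> w \<Longrightarrow> {u, w} \<in> edges \<Gamma>"
    and "\<And>v. v \<in> \<sigma> \<Longrightarrow> finite (carrier (G v))" "Y \<union> Z = V - \<sigma>" "Y \<inter> Z = {}"
    and "\<And>u w. u \<in> Y \<Longrightarrow> w \<in> Z \<Longrightarrow> {u, w} \<notin> edges \<Gamma>"
  shows "Y = {} \<or> Z = {}"
  using spec[OF spec[OF spec[OF assms(1)[unfolded unseparated_def], of \<sigma>], of Y], of Z] assms(2-)
  by simp

definition level :: "('v \<Rightarrow> 'v \<Rightarrow> ('v \<times> 'a) list) \<Rightarrow> nat" where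
  "level \<phi> = (\<Sum>v\<in>V. length (\<phi> v v))"

text \<open>In a coset the shortest element has some level \<open>k\<close> and all others have
  level \<open>k + 1\<close>. So the condition covers the whole coset if \<open>m \<le> k\<close>,
  all but the shortest element if \<open>m = k + 1\<close>, and nothing otherwise.\<close>

definition flat :: "nat \<Rightarrow> ('v \<Rightarrow> 'v \<Rightarrow> ('v \<times> 'a) list) set \<Rightarrow> bool" where
  "flat m A \<longleftrightarrow>
     (\<forall>v\<in>V. \<forall>\<psi>\<in>X. \<forall>a\<in>carrier (G v). \<forall>b\<in>carrier (G v). \<not> init v \<psi> \<longrightarrow>
        m \<le> level (mk v a \<psi>) \<longrightarrow> m \<le> level (mk v b \<psi>) \<longrightarrow> (mk v a \<psi> \<in> A \<longleftrightarrow> mk v b \<psi> \<in> A))"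

lemma level_push: assumes "v \<in> V" shows "level (push v a \<phi>) = Suc (level \<phi>)"
proof -
  have "length (push v a \<phi> u u) = length (\<phi> u u) + (if u = v then 1 else 0)" for u
    by (auto simp: push_def touch_def no_loop)
  then show ?thesis using assms finite_vertices by (simp add: level_def sum.distrib)
qed

lemma init_clique:
  assumes "init u \<phi>" "init v \<phi>" "u \<noteq> v" shows "{u, v} \<in> edges \<Gamma>"
proof (rule ccontr)
  assume "{u, v} \<notin> edges \<Gamma>"
  then have "touch u u v" "touch v u v" by (simp_all add: touch_def)
  then have "fst (hd (\<phi> u v)) = u" "fst (hd (\<phi> u v)) = v" using assms unfolding init_def by blast+
  then show False using assms by simp
qed

text \<open>Otherwise the vertices of \<open>\<sigma>\<close> with infinite groups could be added to
  \<open>Z\<close> without creating an edge to \<open>Y\<close>, and the rest of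
  \<open>\<sigma>\<close> would be a separating clique of finite groups.\<close>

lemma infinite_neighbour:
  assumes "unseparated" "\<sigma> \<subseteq> V" and clique: "\<And>u w. u \<in> \<sigma> \<Longrightarrow> w \<in> \<sigma> \<Longrightarrow> u \<noteq> w \<Longrightarrow> {u, w} \<in> edges \<Gamma>"
    and YZ: "Y \<union> Z = V - \<sigma>" "Y \<inter> Z = {}" "\<And>u w. u \<in> Y \<Longrightarrow> w \<in> Z \<Longrightarrow> {u, w} \<notin> edges \<Gamma>"
    and ne: "Y \<noteq> {}" "Z \<noteq> {} \<or> (\<exists>v\<in>\<sigma>. infinite (carrier (G v)))"
  shows "\<exists>v\<in>\<sigma>. infinite (carrier (G v)) \<and> (\<exists>x\<in>Y. {v, x} \<in> edges \<Gamma>)"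
proof (rule ccontr)
  assume n: "\<not> ?thesis"
  let ?\<tau> = "{v \<in> \<sigma>. finite (carrier (G v))}" and ?Z = "Z \<union> {v \<in> \<sigma>. infinite (carrier (G v))}"
  have "Y \<union> ?Z = V - ?\<tau>" "Y \<inter> ?Z = {}" "?\<tau> \<subseteq> V" using YZ assms(2) by auto
  moreover have "{u, w} \<notin> edges \<Gamma>" if "u \<in> Y" "w \<in> ?Z" for u w
    using that n YZ(3)[of u w] edge_sym[of u w] by blast
  ultimately have "Y = {} \<or> ?Z = {}"
    using clique by (intro unseparatedD[OF assms(1), of ?\<tau>]) auto
  then show False using ne by blast
qed

section \<open>Flat sets and the values of extensions\<close>

lemma flatD:
  "flat m A \<Longrightarrow> v \<in> V \<Longrightarrow> \<psi> \<in> X \<Longrightarrow> \<not> init v \<psi> \<Longrightarrow> a \<in> carrier (G v) \<Longrightarrow> b \<in> carrier (G v) \<Longrightarrow>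
     m \<le> level (mk v a \<psi>) \<Longrightarrow> m \<le> level (mk v b \<psi>) \<Longrightarrow> mk v a \<psi> \<in> A \<longleftrightarrow> mk v b \<psi> \<in> A"
  unfolding flat_def by blast

lemma flat_push_push:
  assumes "flat (Suc m) A" "v \<in> V" "\<psi> \<in> X" "\<not> init v \<psi>" "m \<le> level \<psi>"
    and "a \<in> carrier (G v)" "a \<noteq> \<one>\<^bsub>G v\<^esub>" "b \<in> carrier (G v)" "b \<noteq> \<one>\<^bsub>G v\<^esub>"
  shows "push v a \<psi> \<in> A \<longleftrightarrow> push v b \<psi> \<in> A"
  using flatD[OF assms(1-4,6,8)] assms by (simp add: mk_def level_push)

lemma flat_push:
  assumes "flat (Suc m) A" "v \<in> V" "\<psi> \<in> X" "\<not> init v \<psi>" "Suc m \<le> level \<psi>"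
    and "a \<in> carrier (G v)" "a \<noteq> \<one>\<^bsub>G v\<^esub>"
  shows "push v a \<psi> \<in> A \<longleftrightarrow> \<psi> \<in> A"
proof -
  have "\<one>\<^bsub>G v\<^esub> \<in> carrier (G v)"
    using group_vertex[OF assms(2)] by (simp add: group.is_monoid monoid.one_closed)
  from flatD[OF assms(1-4,6) this] show ?thesis using assms by (simp add: mk_def level_push)
qed

text \<open>For almost every element of the coset at \<open>v\<close>, its coset at \<open>x\<close>
  is not bad, so its value does not change when the syllable at \<open>x\<close> is added. The
  elements so extended lie one level higher in a single coset at \<open>v\<close>, where flatness
  gives them all the value of \<open>push x b \<phi>\<close>.\<close>

lemma almost_flat:
  assumes A: "almost_invariant A" "flat (Suc m) A"
    and \<phi>: "\<phi> \<in> X" "level \<phi> = m" "init v \<phi>"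
    and x: "{v, x} \<in> edges \<Gamma>" "\<not> init x \<phi>" "b \<in> carrier (G x)" "b \<noteq> \<one>\<^bsub>G x\<^esub>"
  shows "almost A v (base v \<phi>) (push x b \<phi> \<in> A)"
proof -
  have v: "v \<in> V" and xV: "x \<in> V" using edgeD[OF x(1)] by auto
  have e': "{x, v} \<in> edges \<Gamma>" using x(1) edge_sym by simp
  obtain a \<psi> where \<psi>: "\<psi> \<in> X" "a \<in> carrier (G v)" "a \<noteq> \<one>\<^bsub>G v\<^esub>" "\<not> init v \<psi>" "\<phi> = push v a \<psi>"
    using init_cases[OF \<phi>(1,3)] by blast
  have base: "base v \<phi> = \<psi>" using \<psi> by (simp add: base_def)
  have ix: "\<not> init x \<psi>" using x(2) \<psi>(5) init_push_adj[OF x(1)] by simp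
  have iv: "\<not> init v (push x b \<psi>)" using \<psi>(4) init_push_adj[OF e'] by simp
  have lev: "Suc (level \<psi>) = m" using \<phi>(2) \<psi>(5) level_push[OF v] by simp
  have X: "push x b \<psi> \<in> X" using \<psi>(1) xV x ix by (intro X.push)
  have one: "\<one>\<^bsub>G x\<^esub> \<in> carrier (G x)"
    using group_vertex[OF xV] by (simp add: group.is_monoid monoid.one_closed)
  have "a' = \<one>\<^bsub>G v\<^esub> \<or> mk v a' \<psi> \<in> bad A x"
    if a': "a' \<in> carrier (G v)" "(mk v a' \<psi> \<in> A) \<noteq> (push x b \<phi> \<in> A)" for a'
  proof (rule ccontr)
    assume n: "\<not> ?thesis"
    then have ne: "a' \<noteq> \<one>\<^bsub>G v\<^esub>" and nb: "mk v a' \<psi> \<notin> bad A x" by auto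
    have "mk x \<one>\<^bsub>G x\<^esub> (mk v a' \<psi>) \<in> A \<longleftrightarrow> mk x b (mk v a' \<psi>) \<in> A"
      using a' \<psi> v x ix one init_mk_adj[OF x(1)] by (intro not_bad[OF nb]) auto
    also have "mk x b (mk v a' \<psi>) = push v a' (push x b \<psi>)"
      using ne x(4) push_push_adj[OF e'] by (simp add: mk_def)
    also have "push v a' (push x b \<psi>) \<in> A \<longleftrightarrow> push v a (push x b \<psi>) \<in> A"
      using lev a' ne \<psi> by (intro flat_push_push[OF A(2) v X iv]) (auto simp: level_push[OF xV])
    also have "push v a (push x b \<psi>) = push x b \<phi>"
      using push_push_adj[OF e'] \<psi>(5) by simp
    finally show False using a'(2) by simp
  qed
  then have "{a' \<in> carrier (G v). (mk v a' \<psi> \<in> A) \<noteq> (push x b \<phi> \<in> A)} \<subseteq>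
      insert \<one>\<^bsub>G v\<^esub> {a' \<in> carrier (G v). mk v a' \<psi> \<in> bad A x}" by blast
  moreover have "finite (insert \<one>\<^bsub>G v\<^esub> {a' \<in> carrier (G v). mk v a' \<psi> \<in> bad A x})"
    using finite_mk[OF \<psi>(4) finite_bad[OF A(1) xV]] by simp
  ultimately show ?thesis unfolding almost_def base by (rule finite_subset)
qed

text \<open>Both extensions have the common extension by the two commuting syllables. It lies over
  each of them in a coset with shortest element of level \<open>Suc m\<close>, where flatness covers
  the whole coset.\<close>

lemma outward_adj:
  assumes A: "flat (Suc m) A" and \<phi>: "\<phi> \<in> X" "level \<phi> = m" and e: "{s, t} \<in> edges \<Gamma>"
    and s: "\<not> init s \<phi>" "b \<in> carrier (G s)" "b \<noteq> \<one>\<^bsub>G s\<^esub>"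
    and t: "\<not> init t \<phi>" "d \<in> carrier (G t)" "d \<noteq> \<one>\<^bsub>G t\<^esub>"
  shows "push s b \<phi> \<in> A \<longleftrightarrow> push t d \<phi> \<in> A"
proof -
  have st: "s \<in> V" "t \<in> V" using edgeD[OF e] by auto
  have e': "{t, s} \<in> edges \<Gamma>" using e edge_sym by simp
  have X: "push s b \<phi> \<in> X" "push t d \<phi> \<in> X" using \<phi> s t st by (auto intro: X.push)
  have "push t d (push s b \<phi>) \<in> A \<longleftrightarrow> push s b \<phi> \<in> A"
    using t s \<phi> init_push_adj[OF e] by (intro flat_push[OF A st(2) X(1)]) (auto simp: level_push[OF st(1)])
  moreover have "push s b (push t d \<phi>) \<in> A \<longleftrightarrow> push t d \<phi> \<in> A"
    using t s \<phi> init_push_adj[OF e'] by (intro flat_push[OF A st(1) X(2)]) (auto simp: level_push[OF st(2)])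
  ultimately show ?thesis by (simp add: push_push_adj[OF e])
qed

text \<open>If two extensions differ, their values split the complement of the initial clique into
  parts \<open>Y\<close> and \<open>Z\<close> without edges between them. Each part has a neighbour
  in the clique with infinite group, along whose coset \<open>A\<close> almost has the value of that
  part. Uniqueness of the value, or the grid of two such cosets, makes the two values equal.\<close>

lemma outward:
  assumes A: "almost_invariant A" "flat (Suc m) A" and un: "unseparated"
    and \<phi>: "\<phi> \<in> X" "level \<phi> = m"
    and s: "s \<in> V" "\<not> init s \<phi>" "b \<in> carrier (G s)" "b \<noteq> \<one>\<^bsub>G s\<^esub>"
    and t: "t \<in> V" "\<not> init t \<phi>" "d \<in> carrier (G t)" "d \<noteq> \<one>\<^bsub>G t\<^esub>"
  shows "push s b \<phi> \<in> A \<longleftrightarrow> push t d \<phi> \<in> A"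
proof (rule ccontr)
  assume ne: "(push s b \<phi> \<in> A) \<noteq> (push t d \<phi> \<in> A)"
  define \<sigma> where "\<sigma> = {v \<in> V. init v \<phi>}"
  have "\<forall>x\<in>V. \<exists>e. e \<in> carrier (G x) \<and> e \<noteq> \<one>\<^bsub>G x\<^esub>" using ex_nontrivial by blast
  then obtain e where e: "\<And>x. x \<in> V \<Longrightarrow> e x \<in> carrier (G x) \<and> e x \<noteq> \<one>\<^bsub>G x\<^esub>" by metis
  \<comment> \<open>One test syllable per vertex is enough: by flatness the value of an extension
    does not depend on which non-trivial group element is used.\<close>
  define k where "k x \<longleftrightarrow> push x (e x) \<phi> \<in> A" for x
  have ks: "k s \<longleftrightarrow> push s b \<phi> \<in> A"
    unfolding k_def using e[OF s(1)] s \<phi> by (intro flat_push_push[OF A(2)]) auto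
  have kt: "k t \<longleftrightarrow> push t d \<phi> \<in> A"
    unfolding k_def using e[OF t(1)] t \<phi> by (intro flat_push_push[OF A(2)]) auto
  define Y Z where "Y = {x \<in> V - \<sigma>. k x = k s}" and "Z = {x \<in> V - \<sigma>. k x \<noteq> k s}"
  have sub: "\<sigma> \<subseteq> V" by (auto simp: \<sigma>_def)
  have clique: "{u, w} \<in> edges \<Gamma>" if "u \<in> \<sigma>" "w \<in> \<sigma>" "u \<noteq> w" for u w
    using that init_clique by (auto simp: \<sigma>_def)
  have YZ: "Y \<union> Z = V - \<sigma>" "Y \<inter> Z = {}" "s \<in> Y" "t \<in> Z"
    using s t ne ks kt by (auto simp: Y_def Z_def \<sigma>_def)
  have no_edge: "{u, w} \<notin> edges \<Gamma>" if "u \<in> Y" "w \<in> Z" for u w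
  proof
    assume uw: "{u, w} \<in> edges \<Gamma>"
    have "u \<in> V" "\<not> init u \<phi>" "w \<in> V" "\<not> init w \<phi>" using that by (auto simp: Y_def Z_def \<sigma>_def)
    then have "k u = k w"
      unfolding k_def using e by (intro outward_adj[OF A(2) \<phi> uw]) auto
    then show False using that by (auto simp: Y_def Z_def)
  qed
  have no_edge': "{w, u} \<notin> edges \<Gamma>" if "u \<in> Y" "w \<in> Z" for u w
    using no_edge[OF that] edge_sym by simp
  obtain v1 x1 where 1: "v1 \<in> \<sigma>" "infinite (carrier (G v1))" "x1 \<in> Y" "{v1, x1} \<in> edges \<Gamma>"
    using infinite_neighbour[OF un sub clique YZ(1,2) no_edge] YZ(3,4) by blast
  have ZY: "Z \<union> Y = V - \<sigma>" "Z \<inter> Y = {}" using YZ by auto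
  obtain v2 x2 where 2: "v2 \<in> \<sigma>" "infinite (carrier (G v2))" "x2 \<in> Z" "{v2, x2} \<in> edges \<Gamma>"
    using infinite_neighbour[OF un sub clique ZY no_edge'] YZ(3,4) by blast
  have v12: "init v1 \<phi>" "init v2 \<phi>" "v1 \<in> V" "v2 \<in> V" using 1 2 by (auto simp: \<sigma>_def)
  have x12: "x1 \<in> V" "\<not> init x1 \<phi>" "x2 \<in> V" "\<not> init x2 \<phi>" using 1 2 by (auto simp: \<sigma>_def Y_def Z_def)
  have al1: "almost A v1 (base v1 \<phi>) (k x1)"
    unfolding k_def using e[OF x12(1)] by (intro almost_flat[OF A \<phi> v12(1) 1(4) x12(2)]) auto
  have al2: "almost A v2 (base v2 \<phi>) (k x2)"
    unfolding k_def using e[OF x12(3)] by (intro almost_flat[OF A \<phi> v12(2) 2(4) x12(4)]) auto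
  have "k x1 = k x2"
  proof (cases "v1 = v2")
    case True
    then show ?thesis using almost_unique[OF 1(2) al1] al2 by simp
  next
    case False
    then have ed: "{v1, v2} \<in> edges \<Gamma>" using init_clique v12 by blast
    then have ed': "{v2, v1} \<in> edges \<Gamma>" using edge_sym by simp
    \<comment> \<open>\<open>\<psi>\<close> is the corner of the grid of \<open>G v1\<close> and
      \<open>G v2\<close> through \<open>\<phi>\<close>; the two cosets considered are the row and
      the column that meet at \<open>\<phi>\<close>.\<close>
    define \<phi>1 \<psi> where "\<phi>1 = base v1 \<phi>" and "\<psi> = base v2 \<phi>1"
    let ?a1 = "coeff v1 \<phi>" and ?a2 = "coeff v2 \<phi>1"
    note b1 = base_coeff[OF \<phi>(1) v12(3), folded \<phi>1_def]
    note b2 = base_coeff[OF b1(1) v12(4), folded \<psi>_def]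
    have i1: "\<not> init v1 \<psi>" using b1(2) b2(4) init_mk_adj[OF ed', of ?a2 \<psi>] by simp
    have "\<phi> = mk v2 ?a2 (mk v1 ?a1 \<psi>)"
      using b1(4) b2(4) mk_mk_adj[OF ed, of ?a1 ?a2 \<psi>] by simp
    moreover have "\<not> init v2 (mk v1 ?a1 \<psi>)" using b2(2) init_mk_adj[OF ed] by simp
    ultimately have "base v2 \<phi> = mk v1 ?a1 \<psi>" by (metis base_mk)
    then have "almost A v2 (mk v1 ?a1 \<psi>) (k x2)" using al2 by simp
    moreover have "almost A v1 (mk v2 ?a2 \<psi>) (k x1)" using al1 b2(4) by (simp add: \<phi>1_def)
    ultimately show ?thesis
      using almost_grid[OF A(1) ed 1(2) 2(2) b2(1) i1 b2(2) b1(3) b2(3)] by blast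
  qed
  then show False using 1(3) 2(3) by (auto simp: Y_def Z_def)
qed

text \<open>By \<open>outward\<close> all these extensions agree, so the existential quantifier acts
  as a universal one; \<open>lower_iff\<close> evaluates the new value at any extension.\<close>

definition lower :: "nat \<Rightarrow> ('v \<Rightarrow> 'v \<Rightarrow> ('v \<times> 'a) list) set \<Rightarrow> ('v \<Rightarrow> 'v \<Rightarrow> ('v \<times> 'a) list) set" where
  "lower m A = {\<phi> \<in> X. if level \<phi> = m
     then \<exists>s\<in>V. \<exists>b\<in>carrier (G s). b \<noteq> \<one>\<^bsub>G s\<^esub> \<and> \<not> init s \<phi> \<and> push s b \<phi> \<in> A
     else \<phi> \<in> A}"

lemma lower_iff:
  assumes "almost_invariant A" "flat (Suc m) A" "unseparated" "\<phi> \<in> X" "level \<phi> = m"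
    and "s \<in> V" "\<not> init s \<phi>" "b \<in> carrier (G s)" "b \<noteq> \<one>\<^bsub>G s\<^esub>"
  shows "\<phi> \<in> lower m A \<longleftrightarrow> push s b \<phi> \<in> A"
proof
  assume "\<phi> \<in> lower m A"
  then obtain t d where "t \<in> V" "d \<in> carrier (G t)" "d \<noteq> \<one>\<^bsub>G t\<^esub>" "\<not> init t \<phi>" "push t d \<phi> \<in> A"
    using assms(5) unfolding lower_def by auto
  then show "push s b \<phi> \<in> A" using outward[OF assms(1-5) assms(6-9), of t d] by blast
next
  assume "push s b \<phi> \<in> A"
  then show "\<phi> \<in> lower m A" using assms unfolding lower_def by auto
qed

lemma ex_not_init:
  assumes "\<not> complete_graph \<Gamma>" shows "\<exists>s\<in>V. \<not> init s \<phi>"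
  using assms init_clique unfolding complete_graph_def by metis

text \<open>An element that changes its value differs from an extension at some vertex
  \<open>s\<close>. It is the shortest element of a coset containing both, and this coset is
  bad.\<close>

lemma finite_lower_diff:
  assumes A: "almost_invariant A" "flat (Suc m) A" "unseparated" and nc: "\<not> complete_graph \<Gamma>"
  shows "finite {\<phi> \<in> X. (\<phi> \<in> lower m A) \<noteq> (\<phi> \<in> A)}"
proof -
  have "{\<phi> \<in> X. (\<phi> \<in> lower m A) \<noteq> (\<phi> \<in> A)} \<subseteq> (\<Union>s\<in>V. bad A s)"
  proof
    fix \<phi> assume \<phi>: "\<phi> \<in> {\<phi> \<in> X. (\<phi> \<in> lower m A) \<noteq> (\<phi> \<in> A)}"
    then have lev: "level \<phi> = m" by (auto simp: lower_def split: if_splits)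
    obtain s where s: "s \<in> V" "\<not> init s \<phi>" using ex_not_init[OF nc] by blast
    obtain b where b: "b \<in> carrier (G s)" "b \<noteq> \<one>\<^bsub>G s\<^esub>" using ex_nontrivial[OF s(1)] by blast
    have one: "\<one>\<^bsub>G s\<^esub> \<in> carrier (G s)"
      using group_vertex[OF s(1)] by (simp add: group.is_monoid monoid.one_closed)
    have X: "\<phi> \<in> X" using \<phi> by simp
    have "(mk s b \<phi> \<in> A) \<noteq> (mk s \<one>\<^bsub>G s\<^esub> \<phi> \<in> A)"
      using \<phi> lower_iff[OF A X lev s b] b by (simp add: mk_def)
    then have "\<phi> \<in> bad A s" using X s b one unfolding bad_def by blast
    then show "\<phi> \<in> (\<Union>s\<in>V. bad A s)" using s by blast
  qed
  then show ?thesis using finite_bad[OF A(1)] finite_vertices by (meson finite_UN_I finite_subset)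
qed

text \<open>In this coset all elements but the shortest have just received new values. If some
  non-initial vertex is adjacent to \<open>v\<close>, extending all of them there moves the
  comparison to a coset one level higher, where \<open>A\<close> is flat. If not, the comparison is
  made along the coset of an infinite group at another initial vertex \<open>u\<close>, which
  commutes with \<open>G v\<close>.\<close>

lemma lower_coset:
  assumes A: "almost_invariant A" "flat (Suc m) A" and un: "unseparated" and nc: "\<not> complete_graph \<Gamma>"
    and \<psi>: "\<psi> \<in> X" "Suc (level \<psi>) = m" and v: "v \<in> V" "\<not> init v \<psi>"
    and a: "a \<in> carrier (G v)" "a \<noteq> \<one>\<^bsub>G v\<^esub>" and b: "b \<in> carrier (G v)" "b \<noteq> \<one>\<^bsub>G v\<^esub>"
  shows "push v a \<psi> \<in> lower m A \<longleftrightarrow> push v b \<psi> \<in> lower m A"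
proof -
  define \<phi> where "\<phi> c = push v c \<psi>" for c
  have X: "\<phi> c \<in> X" if "c \<in> carrier (G v)" "c \<noteq> \<one>\<^bsub>G v\<^esub>" for c
    unfolding \<phi>_def using that \<psi> v by (intro X.push)
  have lev: "level (\<phi> c) = m" for c using \<psi> v by (simp add: \<phi>_def level_push)
  have init_eq: "init w (\<phi> c) = init w (\<phi> a)" for w c
    unfolding \<phi>_def using init_push_same init_push_adj[of v w] init_push_nonadj[of v w] by (cases "w = v") metis+
  show ?thesis
  proof (cases "\<exists>s\<in>V. \<not> init s (\<phi> a) \<and> {v, s} \<in> edges \<Gamma>")
    case True
    then obtain s where s: "s \<in> V" "\<not> init s (\<phi> a)" "{v, s} \<in> edges \<Gamma>" by blast
    obtain d where d: "d \<in> carrier (G s)" "d \<noteq> \<one>\<^bsub>G s\<^esub>" using ex_nontrivial[OF s(1)] by blast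
    have e': "{s, v} \<in> edges \<Gamma>" using s edge_sym by simp
    have nis: "\<not> init s \<psi>" using s(2) init_push_adj[OF s(3)] by (simp add: \<phi>_def)
    have iv: "\<not> init v (push s d \<psi>)" using v init_push_adj[OF e'] by simp
    have Xs: "push s d \<psi> \<in> X" using \<psi>(1) s d nis by (intro X.push)
    have "\<phi> c \<in> lower m A \<longleftrightarrow> push v c (push s d \<psi>) \<in> A"
      if c: "c \<in> carrier (G v)" "c \<noteq> \<one>\<^bsub>G v\<^esub>" for c
    proof -
      have "\<phi> c \<in> lower m A \<longleftrightarrow> push s d (\<phi> c) \<in> A"
        using s init_eq[of s c] d by (intro lower_iff[OF A un X[OF c] lev]) auto
      then show ?thesis unfolding \<phi>_def push_push_adj[OF e'] .
    qed
    moreover have "push v a (push s d \<psi>) \<in> A \<longleftrightarrow> push v b (push s d \<psi>) \<in> A"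
      using \<psi> a b by (intro flat_push_push[OF A(2) v(1) Xs iv]) (auto simp: level_push[OF s(1)])
    ultimately show ?thesis using a b by (simp add: \<phi>_def)
  next
    case False
    define \<sigma> where "\<sigma> = {u \<in> V. init u (\<phi> a)}"
    have sub: "\<sigma> \<subseteq> V" by (auto simp: \<sigma>_def)
    have clique: "{u, w} \<in> edges \<Gamma>" if "u \<in> \<sigma>" "w \<in> \<sigma>" "u \<noteq> w" for u w
      using that init_clique by (auto simp: \<sigma>_def)
    have v\<sigma>: "v \<in> \<sigma>" using v by (simp add: \<sigma>_def \<phi>_def)
    have ne: "V - \<sigma> \<noteq> {}" using ex_not_init[OF nc] by (auto simp: \<sigma>_def)
    have vn: "{v, x} \<notin> edges \<Gamma>" if "x \<in> V - \<sigma>" for x using False that by (auto simp: \<sigma>_def)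
    \<comment> \<open>If all groups in \<open>\<sigma>\<close> were finite, the clique
      \<open>\<sigma> - {v}\<close> would separate \<open>v\<close> from the vertices outside
      \<open>\<sigma>\<close>.\<close>
    have inf: "\<exists>u\<in>\<sigma>. infinite (carrier (G u))"
    proof (rule ccontr)
      assume "\<not> ?thesis"
      then have "{v} = {} \<or> V - \<sigma> = {}"
        using clique v\<sigma> v sub vn by (intro unseparatedD[OF un, of "\<sigma> - {v}"]) auto
      then show False using ne by blast
    qed
    have "\<exists>u\<in>\<sigma>. infinite (carrier (G u)) \<and> (\<exists>x\<in>V - \<sigma>. {u, x} \<in> edges \<Gamma>)"
      using ne inf by (intro infinite_neighbour[OF un sub clique, of "V - \<sigma>" "{}"]) auto
    then obtain u x where u: "u \<in> \<sigma>" "infinite (carrier (G u))" and x: "x \<in> V - \<sigma>" "{u, x} \<in> edges \<Gamma>"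
      by blast
    have "u \<noteq> v" using vn x by blast
    then have e: "{u, v} \<in> edges \<Gamma>" using clique u v\<sigma> by blast
    then have e': "{v, u} \<in> edges \<Gamma>" using edge_sym by simp
    have uV: "u \<in> V" and xV: "x \<in> V" using u x sub by auto
    obtain d where d: "d \<in> carrier (G x)" "d \<noteq> \<one>\<^bsub>G x\<^esub>" using ex_nontrivial[OF xV] by blast
    let ?\<psi> = "base u \<psi>"
    note bc = base_coeff[OF \<psi>(1) uV]
    have iv: "\<not> init v ?\<psi>" using v(2) bc(4) init_mk_adj[OF e, of "coeff u \<psi>" ?\<psi>] by simp
    \<comment> \<open>Along the coset at \<open>u\<close> the set \<open>A\<close> almost has the
      value of the extension at \<open>x\<close>, and this extension also defines the lowered
      value.\<close>
    have al: "almost A u (mk v c ?\<psi>) (\<phi> c \<in> lower m A)"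
      if c: "c \<in> carrier (G v)" "c \<noteq> \<one>\<^bsub>G v\<^esub>" for c
    proof -
      have ix: "\<not> init x (\<phi> c)" using x init_eq[of x c] by (auto simp: \<sigma>_def)
      have iu: "init u (\<phi> c)" using u init_eq[of u c] by (auto simp: \<sigma>_def)
      have "base u (\<phi> c) = mk v c ?\<psi>"
        using base_mk_adj[OF e, of c \<psi>] c by (simp add: \<phi>_def mk_def)
      then show ?thesis
        using almost_flat[OF A X[OF c] lev iu x(2) ix d] lower_iff[OF A un X[OF c] lev xV ix d] by simp
    qed
    \<comment> \<open>Only finitely many \<open>g\<close> are excluded, so some \<open>g\<close>
      shows the lowered values for \<open>a\<close> and for \<open>b\<close> simultaneously, on a
      coset at \<open>v\<close> where \<open>A\<close> is constant.\<close>
    have "finite {g \<in> carrier (G u). mk u g ?\<psi> \<in> bad A v}"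
      using finite_mk[OF bc(2) finite_bad[OF A(1) v(1)]] .
    then have T: "finite ({g \<in> carrier (G u). mk u g ?\<psi> \<in> bad A v} \<union>
        {g \<in> carrier (G u). (mk u g (mk v b ?\<psi>) \<in> A) \<noteq> (\<phi> b \<in> lower m A)})" (is "finite ?T")
      using al[OF b] by (simp add: almost_def)
    obtain g where g: "g \<in> carrier (G u)" "(mk u g (mk v a ?\<psi>) \<in> A) = (\<phi> a \<in> lower m A)"
      and gT: "g \<notin> ?T"
      by (rule almost_pick[OF u(2) al[OF a] T])
    have g': "mk u g ?\<psi> \<notin> bad A v" "(mk u g (mk v b ?\<psi>) \<in> A) = (\<phi> b \<in> lower m A)"
      using gT g(1) by simp_all
    have "mk v a (mk u g ?\<psi>) \<in> A \<longleftrightarrow> mk v b (mk u g ?\<psi>) \<in> A"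
      using g(1) g'(1) a b bc uV iv init_mk_adj[OF e] by (intro not_bad) auto
    then show ?thesis using g(2) g'(2) by (simp add: mk_mk_adj[OF e] \<phi>_def)
  qed
qed

text \<open>Above level \<open>m\<close> nothing has changed. A shortest element of level
  \<open>m\<close> now has the value of its extensions, which are its whole coset. Shortest elements
  of level \<open>m - 1\<close> are the case of \<open>lower_coset\<close>, and below that the
  condition is void.\<close>

lemma flat_lower:
  assumes A: "almost_invariant A" "flat (Suc m) A" and un: "unseparated" and nc: "\<not> complete_graph \<Gamma>"
  shows "flat m (lower m A)"
  unfolding flat_def
proof (intro ballI impI)
  fix v \<psi> a b
  assume v: "v \<in> V" and \<psi>: "\<psi> \<in> X" and a: "a \<in> carrier (G v)" and b: "b \<in> carrier (G v)"
    and i: "\<not> init v \<psi>" and l: "m \<le> level (mk v a \<psi>)" "m \<le> level (mk v b \<psi>)"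
  have X: "mk v c \<psi> \<in> X" if "c \<in> carrier (G v)" for c using that v \<psi> i by (intro mk_closed)
  have lev: "level (mk v c \<psi>) = level \<psi> + (if c = \<one>\<^bsub>G v\<^esub> then 0 else 1)" for c
    by (simp add: mk_def level_push[OF v])
  consider "m < level \<psi>" | "level \<psi> = m" | "level \<psi> < m" by linarith
  then show "mk v a \<psi> \<in> lower m A \<longleftrightarrow> mk v b \<psi> \<in> lower m A"
  proof cases
    case 1
    then have "mk v c \<psi> \<in> lower m A \<longleftrightarrow> mk v c \<psi> \<in> A" if "c \<in> carrier (G v)" for c
      using X[OF that] lev[of c] by (simp add: lower_def)
    then show ?thesis using 1 a b lev flatD[OF A(2) v \<psi> i a b] by simp
  next
    case 2
    have "mk v c \<psi> \<in> lower m A \<longleftrightarrow> \<psi> \<in> lower m A" if c: "c \<in> carrier (G v)" for c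
    proof (cases "c = \<one>\<^bsub>G v\<^esub>")
      case False
      then show ?thesis
        using X[OF c] lev[of c] 2 lower_iff[OF A un \<psi> 2 v i c False] by (simp add: lower_def mk_def)
    qed simp
    then show ?thesis using a b by simp
  next
    case 3
    have "a \<noteq> \<one>\<^bsub>G v\<^esub>" using l(1) 3 by (auto simp: lev)
    moreover have "b \<noteq> \<one>\<^bsub>G v\<^esub>" using l(2) 3 by (auto simp: lev)
    moreover have "Suc (level \<psi>) = m" using l 3 by (auto simp: lev split: if_splits)
    ultimately show ?thesis using lower_coset[OF A un nc \<psi> _ v i a _ b] by (simp add: mk_def)
  qed
qed

lemma almost_invariant_cong:
  assumes A: "almost_invariant A" and B: "B \<subseteq> X" and fin: "finite {\<phi> \<in> X. (\<phi> \<in> B) \<noteq> (\<phi> \<in> A)}"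
  shows "almost_invariant B"
  unfolding almost_invariant_def
proof (intro conjI ballI B)
  fix v a assume v: "v \<in> V" and a: "a \<in> carrier (G v)"
  interpret Gv: group "G v" using group_vertex[OF v] .
  let ?D = "{\<phi> \<in> X. (\<phi> \<in> B) \<noteq> (\<phi> \<in> A)}"
  have "{\<phi> \<in> B. act v a \<phi> \<notin> B} \<subseteq> ?D \<union> {\<phi> \<in> A. act v a \<phi> \<notin> A} \<union> act v (inv\<^bsub>G v\<^esub> a) ` ?D"
  proof
    fix \<phi> assume \<phi>: "\<phi> \<in> {\<phi> \<in> B. act v a \<phi> \<notin> B}"
    then have X: "\<phi> \<in> X" "act v a \<phi> \<in> X" using B v a by auto
    have "\<phi> = act v (inv\<^bsub>G v\<^esub> a) (act v a \<phi>)" using X v a by (simp add: act_act act_one)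
    then show "\<phi> \<in> ?D \<union> {\<phi> \<in> A. act v a \<phi> \<notin> A} \<union> act v (inv\<^bsub>G v\<^esub> a) ` ?D"
      using \<phi> X by blast
  qed
  moreover have "finite {\<phi> \<in> A. act v a \<phi> \<notin> A}" using A v a unfolding almost_invariant_def by blast
  ultimately show "finite {\<phi> \<in> B. act v a \<phi> \<notin> B}"
    using fin by (meson finite_UnI finite_imageI finite_subset)
qed

lemma finite_or_cofinite_flat:
  assumes un: "unseparated" and nc: "\<not> complete_graph \<Gamma>"
  shows "almost_invariant A \<Longrightarrow> flat m A \<Longrightarrow> finite A \<or> finite (X - A)"
proof (induction m arbitrary: A)
  case 0
  have const: "\<phi> \<in> A \<longleftrightarrow> void \<in> A" if "\<phi> \<in> X" for \<phi>
    using that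
  proof (induction rule: X.induct)
    case (push \<phi> v a)
    have "\<one>\<^bsub>G v\<^esub> \<in> carrier (G v)"
      using group_vertex[OF push.hyps(2)] by (simp add: group.is_monoid monoid.one_closed)
    then show ?case
      using flatD[OF 0(2) push.hyps(2,1,5,3)] push by (simp add: mk_def split: if_splits)
  qed simp
  have "A \<subseteq> X" using 0 by (simp add: almost_invariant_def)
  then have "A = {} \<or> X - A = {}" using const by blast
  then show ?case by (metis finite.emptyI)
next
  case (Suc m)
  let ?D = "{\<phi> \<in> X. (\<phi> \<in> lower m A) \<noteq> (\<phi> \<in> A)}"
  have D: "finite ?D" by (rule finite_lower_diff[OF Suc.prems un nc])
  have L: "lower m A \<subseteq> X" by (auto simp: lower_def)
  have A: "A \<subseteq> X" using Suc.prems by (simp add: almost_invariant_def)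
  have "finite (lower m A) \<or> finite (X - lower m A)"
    by (rule Suc.IH[OF almost_invariant_cong[OF Suc.prems(1) L D] flat_lower[OF Suc.prems un nc]])
  moreover have "A \<subseteq> lower m A \<union> ?D" "X - A \<subseteq> (X - lower m A) \<union> ?D" using A by auto
  ultimately show ?case using D by (meson finite_UnI finite_subset)
qed

lemma splits_imp_separated:
  assumes "splits_at_infinity Q" and nc: "\<not> complete_graph \<Gamma>" shows "\<not> unseparated"
proof
  assume un: "unseparated"
  obtain A where A: "almost_invariant A" "infinite A" "infinite (X - A)"
    using assms(1) unfolding splits_at_infinity_iff by blast
  let ?B = "\<Union>v\<in>V. bad A v"
  have "finite (level ` ?B)" using finite_bad[OF A(1)] finite_vertices by blast
  then obtain L where L: "\<And>\<psi>. \<psi> \<in> ?B \<Longrightarrow> level \<psi> < L"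
    unfolding finite_nat_set_iff_bounded by blast
  \<comment> \<open>\<open>L\<close> exceeds the level of the shortest element of every bad coset;
    the successor allows for the one extra syllable of the other elements.\<close>
  have "flat (Suc L) A"
    unfolding flat_def
  proof (intro ballI impI)
    fix v \<psi> a b
    assume v: "v \<in> V" and \<psi>: "\<psi> \<in> X" and a: "a \<in> carrier (G v)" and b: "b \<in> carrier (G v)"
      and i: "\<not> init v \<psi>" and l: "Suc L \<le> level (mk v a \<psi>)"
    have "level (mk v a \<psi>) \<le> Suc (level \<psi>)" by (simp add: mk_def level_push[OF v])
    then have "\<psi> \<notin> bad A v" using L[of \<psi>] l v by auto
    then show "mk v a \<psi> \<in> A \<longleftrightarrow> mk v b \<psi> \<in> A" by (rule not_bad[OF _ \<psi> i a b])
  qed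
  then show False using finite_or_cofinite_flat[OF un nc A(1)] A by blast
qed

end

section \<open>The characterization\<close>

text \<open>A full subgraph is determined by its vertices, so failing to be contained shows already
  in a vertex.\<close>

lemma not_subgraph_vertex:
  assumes "full_subgraph \<Gamma>1 \<Gamma>" "full_subgraph \<Gamma>2 \<Gamma>" "\<not> subgraph \<Gamma>1 \<Gamma>2"
  shows "\<exists>v. v \<in> vertices \<Gamma>1 \<and> v \<notin> vertices \<Gamma>2"
proof (rule ccontr)
  assume "\<not> ?thesis"
  then have sub: "vertices \<Gamma>1 \<subseteq> vertices \<Gamma>2" by blast
  have \<Gamma>1: "simplicial_graph \<Gamma>1" "edges \<Gamma>1 \<subseteq> edges \<Gamma>"
    using assms(1) by (simp_all add: full_subgraph_def subgraph_def)
  have \<Gamma>2: "{u, w} \<in> edges \<Gamma>2"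
    if "u \<in> vertices \<Gamma>2" "w \<in> vertices \<Gamma>2" "{u, w} \<in> edges \<Gamma>" for u w
    using assms(2) that by (simp add: full_subgraph_def)
  have "edges \<Gamma>1 \<subseteq> edges \<Gamma>2"
  proof
    fix e assume e: "e \<in> edges \<Gamma>1"
    then obtain u w where uw: "u \<in> vertices \<Gamma>1" "w \<in> vertices \<Gamma>1" "e = {u, w}"
      using \<Gamma>1(1) by (auto simp: simplicial_graph_def)
    then have "{u, w} \<in> edges \<Gamma>" using e \<Gamma>1(2) by auto
    then show "e \<in> edges \<Gamma>2" using \<Gamma>2[of u w] uw sub by auto
  qed
  then show False using sub \<Gamma>1(1) assms(3) by (simp add: subgraph_def)
qed

lemma full_subgraph_groups:
  assumes "graph_groups \<Gamma> G" "full_subgraph \<Delta> \<Gamma>" shows "graph_groups \<Delta> G"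
proof -
  interpret graph_groups \<Gamma> G by fact
  have \<Delta>: "simplicial_graph \<Delta>" "vertices \<Delta> \<subseteq> V"
    using assms(2) by (simp_all add: full_subgraph_def subgraph_def)
  show ?thesis
    using \<Delta>(1) finite_subset[OF \<Delta>(2) finite_vertices] group_vertex[OF subsetD[OF \<Delta>(2)]]
    by (simp add: graph_groups_def)
qed

text \<open>Condition (ii) in literally the form used in the theorem, so that it can be folded
  there.\<close>

definition finite_splitting ::
    "'v sgraph \<Rightarrow> ('v \<Rightarrow> ('a, 'b) monoid_scheme) \<Rightarrow> 'v sgraph \<Rightarrow> 'v sgraph \<Rightarrow> bool" where
  "finite_splitting \<Gamma> G \<Gamma>1 \<Gamma>2 \<longleftrightarrow>
       full_subgraph \<Gamma>1 \<Gamma> \<and> full_subgraph \<Gamma>2 \<Gamma> \<and>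
       vertices \<Gamma>1 \<noteq> {} \<and> vertices \<Gamma>2 \<noteq> {} \<and>
       \<not> subgraph \<Gamma>1 \<Gamma>2 \<and> \<not> subgraph \<Gamma>2 \<Gamma>1 \<and>
       (let A = graph_product \<Gamma>1 G; B = graph_product \<Gamma>2 G;
            \<Delta> = graph_inter \<Gamma>1 \<Gamma>2; C = graph_product \<Delta> G;
            \<alpha> = gp_embed \<Delta> \<Gamma>1 G; \<beta> = gp_embed \<Delta> \<Gamma>2 G
        in nontrivial_amalgam A B C \<alpha> \<beta> \<and>
           graph_product \<Gamma> G \<cong> amalgamated_product A B C \<alpha> \<beta> \<and>
           finite (carrier C))"

definition induced :: "'v sgraph \<Rightarrow> 'v set \<Rightarrow> 'v sgraph" where
  "induced \<Gamma> S = \<lparr>vertices = S, edges = {e \<in> edges \<Gamma>. e \<subseteq> S}\<rparr>"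

lemma full_subgraph_induced:
  assumes "simplicial_graph \<Gamma>" "S \<subseteq> vertices \<Gamma>" shows "full_subgraph (induced \<Gamma> S) \<Gamma>"
  using assms by (fastforce simp: full_subgraph_def subgraph_def induced_def simplicial_graph_def)

context graph_groups
begin

section \<open>Elements supported on a subgraph\<close>

lemma act_other: "u \<noteq> v \<Longrightarrow> act u a \<phi> v v = \<phi> v v"
  by (simp add: act_def mk_def base_def push_def pop_def touch_def)

lemma wact_other: "v \<notin> fst ` set w \<Longrightarrow> wact w \<phi> v v = \<phi> v v"
  by (induction w) (auto simp: act_other)

lemma X_supported:
  "\<phi> \<in> X \<Longrightarrow> (\<And>v. v \<in> V - S \<Longrightarrow> \<phi> v v = []) \<Longrightarrow> \<exists>w\<in>W. fst ` set w \<subseteq> S \<and> \<phi> = wact w void"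
proof (induction rule: X.induct)
  case void
  have "[] \<in> W \<and> fst ` set [] \<subseteq> S \<and> void = wact [] void" by simp
  then show ?case by blast
next
  case (push \<phi> u a)
  have "u \<in> S" using push.prems[of u] push.hyps by (auto simp: push_def)
  have "\<phi> v v = []" if "v \<in> V - S" for v
    using push.prems[OF that] by (simp add: push_def split: if_splits)
  then obtain w where w: "w \<in> W" "fst ` set w \<subseteq> S" "\<phi> = wact w void" using push.IH by blast
  have "wact ((u, a) # w) void = push u a \<phi>"
    using w act_not_init[of \<phi> u a] push.hyps by (simp add: mk_def)
  moreover have "(u, a) # w \<in> W" "fst ` set ((u, a) # w) \<subseteq> S" using w push.hyps \<open>u \<in> S\<close> by auto
  ultimately show ?case by metis
qed

end

text \<open>Words over \<Delta> never touch the projection to \<open>v\<close>, whereas a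
  non-trivial syllable at \<open>v\<close> leaves a trace in it; so this syllable lies outside the
  image.\<close>

lemma gp_embed_proper:
  assumes D: "graph_groups \<Delta> G" and "graph_groups \<Gamma> G"
    and sub: "vertices \<Delta> \<subseteq> vertices \<Gamma>" "edges \<Delta> \<subseteq> edges \<Gamma>"
    and v: "v \<in> vertices \<Gamma>" "v \<notin> vertices \<Delta>" "a \<in> carrier (G v)" "a \<noteq> \<one>\<^bsub>G v\<^esub>"
  shows "gp_embed \<Delta> \<Gamma> G ` carrier (graph_product \<Delta> G) \<subset> carrier (graph_product \<Gamma> G)"
proof -
  interpret D: graph_groups \<Delta> G by fact
  interpret graph_groups \<Gamma> G by fact
  have img: "gp_embed \<Delta> \<Gamma> G ` carrier (graph_product \<Delta> G) = gp_class \<Gamma> G ` D.W"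
    using gp_embed_gp_class[OF assms(1-4)] unfolding D.carrier_graph_product by (auto simp: image_iff)
  have WW: "D.W \<subseteq> W" using sub(1) by (auto simp: words_def)
  have "gp_class \<Gamma> G [(v, a)] \<notin> gp_class \<Gamma> G ` D.W"
  proof
    assume "gp_class \<Gamma> G [(v, a)] \<in> gp_class \<Gamma> G ` D.W"
    then obtain w where w: "w \<in> D.W" "pcls [(v, a)] = pcls w" unfolding gp_class_eq by blast
    then have eq: "wact [(v, a)] void = wact w void"
      using v WW by (intro wact_eq) (auto intro: X.void)
    have "v \<notin> fst ` set w" using w(1) v(2) by (auto simp: words_def)
    then have "wact w void v v = []" by (simp add: wact_other)
    moreover have "wact [(v, a)] void = push v a void"
      using act_not_init[OF X.void v(1,3)] v(4) by (simp add: mk_def)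
    ultimately have "push v a void v v = []" using eq by simp
    then show False by (simp add: push_def)
  qed
  moreover have "gp_class \<Gamma> G [(v, a)] \<in> carrier (graph_product \<Gamma> G)"
    using v by (intro gp_class_syllable)
  moreover have "gp_class \<Gamma> G ` D.W \<subseteq> carrier (graph_product \<Gamma> G)"
    unfolding carrier_graph_product using WW by blast
  ultimately show ?thesis unfolding img by blast
qed

context graph_amalgam
begin

text \<open>An element without syllables outside the intersection is the normal form of a word over
  \<Delta>, hence comes from an element of the finite group \<open>C\<close>.\<close>

lemma finite_supported_in_intersection:
  assumes "finite (carrier C)"
  shows "finite {\<phi> \<in> U.X. \<forall>v\<in>(vertices \<Gamma>1 - vertices \<Gamma>2) \<union> (vertices \<Gamma>2 - vertices \<Gamma>1). \<phi> v v = []}"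
    (is "finite ?K")
proof -
  obtain h where h: "\<And>w. w \<in> D.W \<Longrightarrow> h (gp_class \<Delta> G w) = gp_class \<Upsilon> G w"
    by (rule gp_class_subgraph[OF D.graph_groups_axioms U.graph_groups_axioms])
      (auto simp: graph_inter_def graph_union_def)
  have "?K \<subseteq> (\<lambda>c. U.nf (h c)) ` carrier C"
  proof
    fix \<phi> assume \<phi>: "\<phi> \<in> ?K"
    have out: "\<phi> v v = []" if "v \<in> U.V - D.V" for v
      using that \<phi> by (auto simp: graph_union_def graph_inter_def)
    obtain w where w: "w \<in> U.W" "fst ` set w \<subseteq> D.V" "\<phi> = U.wact w U.void"
      using U.X_supported[of \<phi> D.V] \<phi> out by blast
    have wD: "w \<in> D.W" using w(1,2) by (auto simp: words_def)
    have "\<phi> = U.nf (h (gp_class \<Delta> G w))"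
      unfolding h[OF wD] U.gp_class_eq U.nf_pcls[OF w(1)] by (rule w(3))
    then show "\<phi> \<in> (\<lambda>c. U.nf (h c)) ` carrier C"
      unfolding D.carrier_graph_product using wD by blast
  qed
  then show ?thesis using assms by (meson finite_imageI finite_subset)
qed

text \<open>Every edge of the union belongs to \<Gamma>1 or \<Gamma>2, so no edge joins a vertex
  outside \<Gamma>2 to one outside \<Gamma>1. The intersection thus separates the union, and
  \<open>splits_at_infinity_separated\<close> applies.\<close>

lemma splits_at_infinity_amalgam:
  assumes fin: "finite (carrier C)"
    and y: "y \<in> vertices \<Gamma>1" "y \<notin> vertices \<Gamma>2" "a \<in> carrier (G y)" "a \<noteq> \<one>\<^bsub>G y\<^esub>"
    and z: "z \<in> vertices \<Gamma>2" "z \<notin> vertices \<Gamma>1" "b \<in> carrier (G z)" "b \<noteq> \<one>\<^bsub>G z\<^esub>"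
  shows "splits_at_infinity (amalgamated_product A B C \<alpha> \<beta>)"
proof -
  have "splits_at_infinity U.Q"
  proof (rule U.splits_at_infinity_separated[of "vertices \<Gamma>1 - vertices \<Gamma>2" "vertices \<Gamma>2 - vertices \<Gamma>1" y a z b])
    show "{u, w} \<notin> edges \<Upsilon>"
      if "u \<in> vertices \<Gamma>1 - vertices \<Gamma>2" "w \<in> vertices \<Gamma>2 - vertices \<Gamma>1" for u w
      using that G1.edgeD[of u w] G2.edgeD[of u w] by (auto simp: graph_union_def)
  qed (use y z finite_supported_in_intersection[OF fin] in \<open>auto simp: graph_union_def\<close>)
  then show ?thesis
    using splits_at_infinity_iso[OF P.Q.is_group U.Q.is_group] amalgamated_product_iso
    unfolding amalgamated_product_eq U.graph_product_eq by blast
qed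

end

context fg_graph_groups
begin

text \<open>The two subgraphs are induced on \<open>\<sigma> \<union> Y\<close> and
  \<open>\<sigma> \<union> Z\<close>. Without edges between \<open>Y\<close> and \<open>Z\<close>
  their union is all of \<Gamma>, and over the clique \<open>\<sigma>\<close> the group is a finite
  direct product. Vertices in \<open>Y\<close> and in \<open>Z\<close> make the amalgam
  non-trivial.\<close>

lemma separated_amalgam:
  assumes "\<not> unseparated" shows "\<exists>\<Gamma>1 \<Gamma>2. finite_splitting \<Gamma> G \<Gamma>1 \<Gamma>2"
proof -
  have "\<exists>\<sigma> Y Z. \<sigma> \<subseteq> V \<and> (\<forall>u\<in>\<sigma>. \<forall>w\<in>\<sigma>. u \<noteq> w \<longrightarrow> {u, w} \<in> edges \<Gamma>) \<and>
      (\<forall>v\<in>\<sigma>. finite (carrier (G v))) \<and> Y \<union> Z = V - \<sigma> \<and> Y \<inter> Z = {} \<and>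
      (\<forall>u\<in>Y. \<forall>w\<in>Z. {u, w} \<notin> edges \<Gamma>) \<and> \<not> (Y = {} \<or> Z = {})"
    using assms unfolding unseparated_def not_all not_imp .
  then obtain \<sigma> Y Z where \<sigma>: "\<sigma> \<subseteq> V" "\<And>u w. u \<in> \<sigma> \<Longrightarrow> w \<in> \<sigma> \<Longrightarrow> u \<noteq> w \<Longrightarrow> {u, w} \<in> edges \<Gamma>"
      "\<And>v. v \<in> \<sigma> \<Longrightarrow> finite (carrier (G v))"
    and YZ: "Y \<union> Z = V - \<sigma>" "Y \<inter> Z = {}" "\<And>u w. u \<in> Y \<Longrightarrow> w \<in> Z \<Longrightarrow> {u, w} \<notin> edges \<Gamma>"
      "Y \<noteq> {}" "Z \<noteq> {}"
    by (elim exE conjE) (simp add: that)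
  define \<Gamma>1 \<Gamma>2 where "\<Gamma>1 = induced \<Gamma> (\<sigma> \<union> Y)" and "\<Gamma>2 = induced \<Gamma> (\<sigma> \<union> Z)"
  have V12: "vertices \<Gamma>1 = \<sigma> \<union> Y" "vertices \<Gamma>2 = \<sigma> \<union> Z"
    and E12: "edges \<Gamma>1 = {e \<in> edges \<Gamma>. e \<subseteq> \<sigma> \<union> Y}" "edges \<Gamma>2 = {e \<in> edges \<Gamma>. e \<subseteq> \<sigma> \<union> Z}"
    by (simp_all add: \<Gamma>1_def \<Gamma>2_def induced_def)
  have full: "full_subgraph \<Gamma>1 \<Gamma>" "full_subgraph \<Gamma>2 \<Gamma>"
    unfolding \<Gamma>1_def \<Gamma>2_def using \<sigma>(1) YZ(1) by (auto intro!: full_subgraph_induced[OF simplicial])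
  interpret graph_amalgam \<Gamma>1 \<Gamma>2 G
    using full_subgraph_groups[OF graph_groups_axioms] full by (simp add: graph_amalgam_def)
  obtain y z where y: "y \<in> Y" and z: "z \<in> Z" using YZ by blast
  then have yz: "y \<in> V" "y \<notin> vertices \<Gamma>2" "z \<in> V" "z \<notin> vertices \<Gamma>1"
    "y \<in> vertices \<Gamma>1" "z \<in> vertices \<Gamma>2"
    using YZ V12 by auto
  obtain a b where a: "a \<in> carrier (G y)" "a \<noteq> \<one>\<^bsub>G y\<^esub>" and b: "b \<in> carrier (G z)" "b \<noteq> \<one>\<^bsub>G z\<^esub>"
    using ex_nontrivial yz by blast
  have not_sub: "\<not> subgraph \<Gamma>1 \<Gamma>2" "\<not> subgraph \<Gamma>2 \<Gamma>1"
    using yz by (auto simp: subgraph_def)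
  have D: "vertices \<Delta> = \<sigma>" using V12 YZ by (auto simp: graph_inter_def)
  have "complete_graph \<Delta>"
    unfolding complete_graph_def D using \<sigma>(2) E12 by (auto simp: graph_inter_def)
  then have fin: "finite (carrier C)"
    unfolding D.graph_product_eq D.finite_Q_iff by (rule D.finite_X) (use \<sigma>(3) D in auto)
  have nontriv: "nontrivial_amalgam A B C \<alpha> \<beta>"
    unfolding nontrivial_amalgam_def
  proof
    show "\<alpha> ` carrier C \<subset> carrier A"
      by (rule gp_embed_proper[OF D.graph_groups_axioms G1.graph_groups_axioms _ _ yz(5) _ a])
        (use yz in \<open>auto simp: graph_inter_def\<close>)
    show "\<beta> ` carrier C \<subset> carrier B"
      by (rule gp_embed_proper[OF D.graph_groups_axioms G2.graph_groups_axioms _ _ yz(6) _ b])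
        (use yz in \<open>auto simp: graph_inter_def\<close>)
  qed
  have "edges \<Gamma>1 \<union> edges \<Gamma>2 = edges \<Gamma>"
  proof
    show "edges \<Gamma> \<subseteq> edges \<Gamma>1 \<union> edges \<Gamma>2"
    proof
      fix e assume e: "e \<in> edges \<Gamma>"
      then obtain u w where uw: "u \<in> V" "w \<in> V" "e = {u, w}"
        using simplicial by (auto simp: simplicial_graph_def)
      have "\<not> (u \<in> Y \<and> w \<in> Z)" "\<not> (u \<in> Z \<and> w \<in> Y)"
        using e uw YZ(3) edge_sym by blast+
      then show "e \<in> edges \<Gamma>1 \<union> edges \<Gamma>2" using e uw YZ(1) E12 by blast
    qed
  qed (use E12 in auto)
  moreover have "vertices \<Gamma>1 \<union> vertices \<Gamma>2 = V" using V12 YZ(1) \<sigma>(1) by auto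
  ultimately have "\<Upsilon> = \<Gamma>" by (simp add: graph_union_def)
  then have "amalgamated_product A B C \<alpha> \<beta> \<cong> graph_product \<Gamma> G"
    using amalgamated_product_iso by simp
  then have iso: "graph_product \<Gamma> G \<cong> amalgamated_product A B C \<alpha> \<beta>"
    using group.iso_sym P.Q.is_group unfolding amalgamated_product_eq by blast
  show ?thesis
    unfolding finite_splitting_def Let_def
    by (intro exI[of _ \<Gamma>1] exI[of _ \<Gamma>2] conjI full not_sub nontriv iso fin) (use yz in auto)
qed

end

theorem theoremA:
  fixes \<Gamma> :: "'v sgraph" and G :: "'v \<Rightarrow> ('a, 'b) monoid_scheme"
  assumes "simplicial_graph \<Gamma>" and "finite_graph \<Gamma>"
    and "\<And>v. v \<in> vertices \<Gamma> \<Longrightarrow> finitely_generated_group (G v)"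
    and "\<And>v. v \<in> vertices \<Gamma> \<Longrightarrow> carrier (G v) \<noteq> {\<one>\<^bsub>G v\<^esub>}"
  shows "number_of_ends (graph_product \<Gamma> G) > 1 \<longleftrightarrow>
    (complete_graph \<Gamma> \<and>
       (\<exists>v\<in>vertices \<Gamma>. number_of_ends (G v) > 1 \<and>
          (\<forall>w\<in>vertices \<Gamma> - {v}. \<not> number_of_ends (G w) > 1) \<and>
          (\<forall>w\<in>vertices \<Gamma> - {v}. finite (carrier (G w))))) \<or>
    (\<exists>\<Gamma>1 \<Gamma>2.
       full_subgraph \<Gamma>1 \<Gamma> \<and> full_subgraph \<Gamma>2 \<Gamma> \<and>
       vertices \<Gamma>1 \<noteq> {} \<and> vertices \<Gamma>2 \<noteq> {} \<and>
       \<not> subgraph \<Gamma>1 \<Gamma>2 \<and> \<not> subgraph \<Gamma>2 \<Gamma>1 \<and>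
       (let A = graph_product \<Gamma>1 G; B = graph_product \<Gamma>2 G;
            \<Delta> = graph_inter \<Gamma>1 \<Gamma>2; C = graph_product \<Delta> G;
            \<alpha> = gp_embed \<Delta> \<Gamma>1 G; \<beta> = gp_embed \<Delta> \<Gamma>2 G
        in nontrivial_amalgam A B C \<alpha> \<beta> \<and>
           graph_product \<Gamma> G \<cong> amalgamated_product A B C \<alpha> \<beta> \<and>
           finite (carrier C)))"
proof -
  interpret fg_graph_groups \<Gamma> G
    using assms
    by (auto simp: fg_graph_groups_def fg_graph_groups_axioms_def graph_groups_def finite_graph_def
        finitely_generated_group_def)
  have ends: "number_of_ends (graph_product \<Gamma> G) > 1 \<longleftrightarrow> splits_at_infinity Q"
    unfolding graph_product_eq
    by (rule number_of_ends_gt_1_iff[OF finitely_generated[OF finite_vertices fg_vertex]])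
  have ends_vertex: "number_of_ends (G v) > 1 \<longleftrightarrow> splits_at_infinity (G v)" if "v \<in> V" for v
    by (rule number_of_ends_gt_1_iff[OF fg_vertex[OF that]])
  \<comment> \<open>This turns finiteness of the other vertex groups into the clause that none of
    them has more than one end.\<close>
  have finite_imp: "\<not> splits_at_infinity (G v)" if "finite (carrier (G v))" for v
    using that finite_subset unfolding splits_at_infinity_def by blast
  let ?i = "complete_graph \<Gamma> \<and>
       (\<exists>v\<in>vertices \<Gamma>. number_of_ends (G v) > 1 \<and>
          (\<forall>w\<in>vertices \<Gamma> - {v}. \<not> number_of_ends (G w) > 1) \<and>
          (\<forall>w\<in>vertices \<Gamma> - {v}. finite (carrier (G w))))"
  show ?thesis
    unfolding ends finite_splitting_def[symmetric]
  proof
    assume s: "splits_at_infinity Q"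
    show "?i \<or> (\<exists>\<Gamma>1 \<Gamma>2. finite_splitting \<Gamma> G \<Gamma>1 \<Gamma>2)"
    proof (cases "complete_graph \<Gamma>")
      case True
      obtain v where "v \<in> V" "splits_at_infinity (G v)" "\<forall>w\<in>V - {v}. finite (carrier (G w))"
        using splits_complete_imp[OF s True] by blast
      then have ?i using True finite_imp ends_vertex by blast
      then show ?thesis ..
    next
      case False
      show ?thesis by (rule disjI2[OF separated_amalgam[OF splits_imp_separated[OF s False]]])
    qed
  next
    assume "?i \<or> (\<exists>\<Gamma>1 \<Gamma>2. finite_splitting \<Gamma> G \<Gamma>1 \<Gamma>2)"
    then show "splits_at_infinity Q"
    proof (elim disjE exE)
      assume ?i
      then show ?thesis using splits_at_infinity_complete ends_vertex by blast
    next
      fix \<Gamma>1 \<Gamma>2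
      assume *: "finite_splitting \<Gamma> G \<Gamma>1 \<Gamma>2"
      then have full: "full_subgraph \<Gamma>1 \<Gamma>" "full_subgraph \<Gamma>2 \<Gamma>"
        and not_sub: "\<not> subgraph \<Gamma>1 \<Gamma>2" "\<not> subgraph \<Gamma>2 \<Gamma>1"
        by (simp_all add: finite_splitting_def)
      interpret A: graph_amalgam \<Gamma>1 \<Gamma>2 G
        using full_subgraph_groups[OF graph_groups_axioms] full by (simp add: graph_amalgam_def)
      have iso: "graph_product \<Gamma> G \<cong> amalgamated_product A.A A.B A.C A.\<alpha> A.\<beta>"
        and fin: "finite (carrier A.C)"
        using * unfolding finite_splitting_def Let_def by simp_all
      obtain y where y: "y \<in> vertices \<Gamma>1" "y \<notin> vertices \<Gamma>2"
        using not_subgraph_vertex[OF full not_sub(1)] by blast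
      obtain z where z: "z \<in> vertices \<Gamma>2" "z \<notin> vertices \<Gamma>1"
        using not_subgraph_vertex[OF full(2,1) not_sub(2)] by blast
      have "y \<in> V" "z \<in> V" using y z full by (auto simp: full_subgraph_def subgraph_def)
      then obtain a b where "a \<in> carrier (G y)" "a \<noteq> \<one>\<^bsub>G y\<^esub>" "b \<in> carrier (G z)" "b \<noteq> \<one>\<^bsub>G z\<^esub>"
        using ex_nontrivial by blast
      then have s: "splits_at_infinity A.P.Q"
        using A.splits_at_infinity_amalgam[OF fin y _ _ z] unfolding A.amalgamated_product_eq by blast
      show ?thesis
        using splits_at_infinity_iso[OF Q.is_group A.P.Q.is_group] iso s
        unfolding graph_product_eq A.amalgamated_product_eq by blast
    qed
  qed
qed

end
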